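(* Let $\lambda,\Omega,\omega>0$ and $\Delta=\Omega-\omega$. For all $\Psi\in\mathbb{C}^2\otimes\mathscr{S}(\mathbb{R})$ and all $t\in\mathbb{R}$, $$\bigl\|(U_2(t)-U_1(t))\Psi\bigr\|\le\frac{\lambda}{\omega}\Bigl[\|(N+2)^{1/2}\Psi\|+|t|\Bigl(|\Delta|\,\|(N+2)^{1/2}\Psi\|+3\lambda\,\bigl\|\bigl((N+2)(N+3)\bigr)^{1/2}\Psi\bigr\|\Bigr)\Bigr],$$ where $N=I\otimes a^\dagger a$. Moreover, for all $\Psi\in\mathbb{C}^2\otimes L^2(\mathbb{R})$, $$\lim_{\omega\to+\infty}\bigl\|(e^{-itH_{\mathrm{RWA}}}-e^{-itH})\Psi\bigr\|=0,$$ uniformly for $t$ in compact sets.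
   Context: On Schwartz space $\mathscr{S}(\mathbb{R})\subset L^2(\mathbb{R})$ let $a=\frac{1}{\sqrt2}(x+\frac{d}{dx})$ and $a^\dagger=\frac{1}{\sqrt2}(x-\frac{d}{dx})$, so $[a,a^\dagger]=I$. Let $$\sigma_x=\begin{pmatrix}0&1\\1&0\end{pmatrix},\quad \sigma_z=\begin{pmatrix}1&0\\0&-1\end{pmatrix},\quad \sigma_+=\begin{pmatrix}0&1\\0&0\end{pmatrix},\quad \sigma_-=\begin{pmatrix}0&0\\1&0\end{pmatrix}.$$ On $\mathbb{C}^2\otimes\mathscr{S}(\mathbb{R})$, a subspace of the Hilbert space $\mathbb{C}^2\otimes L^2(\mathbb{R})$, define, for real parameters $\lambda,\Omega,\omega$, $$H=\tfrac{\Omega}{2}\sigma_z\otimes I+I\otimes\omega a^\dagger a+\lambda\,\sigma_x\otimes(a+a^\dagger),$$ $$H_{\mathrm{RWA}}=\tfrac{\Omega}{2}\sigma_z\otimes I+I\otimes\omega a^\dagger a+\lambda(\sigma_+\otimes a+\sigma_-\otimes a^\dagger),$$ $$H_0=\tfrac{\omega}{2}\sigma_z\otimes I+I\otimes\omega a^\dagger a.$$ The same symbols denote the closures of these operators ($\mathbb{C}^2\otimes\mathscr{S}(\mathbb{R})$ is a common invariant core). The number $\Delta=\Omega-\omega$ is called the detuning. For $t\in\mathbb{R}$ set $U_1(t)=e^{itH_0}e^{-itH}$ and $U_2(t)=e^{itH_0}e^{-itH_{\mathrm{RWA}}}$. Functions of $N$ are defined by functional calculus. *)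

theory Defs
  imports "HOL-Analysis.Analysis"
begin

section \<open>The Hilbert space\<close>

text \<open>
  The tensor product of \<open>\<complex>\<^sup>2\<close> with a space of complex functions on \<open>\<real>\<close> is identified with the
  space of \<open>\<complex>\<^sup>2\<close>-valued functions whose two components lie in that space: \<open>v \<otimes> f\<close> is
  \<open>\<lambda>x. f x *s v\<close>. Thus \<open>\<complex>\<^sup>2 \<otimes> L\<^sup>2(\<real>)\<close> is \<open>L\<^sup>2(\<real>; \<complex>\<^sup>2)\<close>, the type \<open>spinor\<close> of almost-everywhere
  classes of square-integrable functions; \<open>ket f\<close> is the class of \<open>f\<close>.
\<close>

definition sq_int :: "(real \<Rightarrow> complex ^ 2) \<Rightarrow> bool" where
  "sq_int f \<longleftrightarrow> f \<in> borel_measurable lborel \<and> integrable lborel (\<lambda>x. (norm (f x))\<^sup>2)"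

definition spinor_rel :: "(real \<Rightarrow> complex ^ 2) \<Rightarrow> (real \<Rightarrow> complex ^ 2) \<Rightarrow> bool" where
  "spinor_rel f g \<longleftrightarrow> sq_int f \<and> sq_int g \<and> (AE x in lborel. f x = g x)"

lemma sq_int_0: "sq_int (\<lambda>_. 0)"
  by (simp add: sq_int_def)

lemma sq_int_bound:
  assumes "f \<in> borel_measurable lborel" "sq_int g" "\<And>x. norm (f x) \<le> c * norm (g x)"
  shows "sq_int f"
proof -
  have "integrable lborel (\<lambda>x. c\<^sup>2 * (norm (g x))\<^sup>2)"
    using assms(2) by (simp add: sq_int_def)
  then have "integrable lborel (\<lambda>x. (norm (f x))\<^sup>2)"
  proof (rule Bochner_Integration.integrable_bound)
    show "(\<lambda>x. (norm (f x))\<^sup>2) \<in> borel_measurable lborel"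
      using assms(1) by measurable
    show "AE x in lborel. norm ((norm (f x))\<^sup>2) \<le> norm (c\<^sup>2 * (norm (g x))\<^sup>2)"
      using power_mono[OF assms(3) norm_ge_zero, of _ 2] by (simp add: power_mult_distrib)
  qed
  with assms(1) show ?thesis by (simp add: sq_int_def)
qed

lemma sq_int_add:
  assumes "sq_int f" "sq_int g"
  shows "sq_int (\<lambda>x. f x + g x)"
proof -
  have [measurable]: "f \<in> borel_measurable lborel" "g \<in> borel_measurable lborel"
    using assms by (auto simp: sq_int_def)
  have "integrable lborel (\<lambda>x. 2 * (norm (f x))\<^sup>2 + 2 * (norm (g x))\<^sup>2)"
    using assms by (simp add: sq_int_def)
  then have "integrable lborel (\<lambda>x. (norm (f x + g x))\<^sup>2)"
  proof (rule Bochner_Integration.integrable_bound)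
    show "(\<lambda>x. (norm (f x + g x))\<^sup>2) \<in> borel_measurable lborel" by measurable
    have "(norm (a + b))\<^sup>2 \<le> 2 * (norm a)\<^sup>2 + 2 * (norm b)\<^sup>2" for a b :: "complex ^ 2"
    proof -
      have "(norm (a + b))\<^sup>2 \<le> (norm a + norm b)\<^sup>2"
        by (simp add: norm_triangle_ineq power_mono)
      also have "\<dots> \<le> 2 * (norm a)\<^sup>2 + 2 * (norm b)\<^sup>2"
        using sum_squares_ge_zero[of "norm a - norm b" 0]
        by (simp add: power2_eq_square algebra_simps)
      finally show ?thesis .
    qed
    then show "AE x in lborel. norm ((norm (f x + g x))\<^sup>2)
        \<le> norm (2 * (norm (f x))\<^sup>2 + 2 * (norm (g x))\<^sup>2)" by simp
  qed
  then show ?thesis by (simp add: sq_int_def)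
qed

lemma norm_vector_scalar_mult: "norm (c *s v) = cmod c * norm (v :: complex ^ 2)"
  by (simp add: norm_vec_def L2_set_def norm_mult power_mult_distrib real_sqrt_mult
      flip: sum_distrib_left)

lemma borel_measurable_vector_scalar_mult [measurable (raw)]:
  assumes [measurable]: "f \<in> borel_measurable M"
  shows "(\<lambda>x. c *s (f x :: complex ^ 2)) \<in> borel_measurable M"
proof -
  have "continuous_on UNIV (\<lambda>v :: complex ^ 2. c *s v)"
    unfolding vector_scalar_mult_def by (intro continuous_intros)
  then have "(\<lambda>v :: complex ^ 2. c *s v) \<in> borel_measurable borel"
    by (rule borel_measurable_continuous_onI)
  then show ?thesis by (rule measurable_compose[OF assms])
qed

lemma sq_int_scale: "sq_int f \<Longrightarrow> sq_int (\<lambda>x. c *s f x)"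
  by (rule sq_int_bound[where c = "cmod c" and g = f])
    (auto simp: norm_vector_scalar_mult sq_int_def)

lemma sq_int_scaleR: "sq_int f \<Longrightarrow> sq_int (\<lambda>x. c *\<^sub>R f x)"
  by (rule sq_int_bound[where c = "\<bar>c\<bar>" and g = f]) (auto simp: sq_int_def)

lemma sq_int_uminus: "sq_int f \<Longrightarrow> sq_int (\<lambda>x. - f x)"
  using sq_int_scaleR[of f "-1"] by simp

lemma sq_int_diff: "sq_int f \<Longrightarrow> sq_int g \<Longrightarrow> sq_int (\<lambda>x. f x - g x)"
  using sq_int_add[of f "\<lambda>x. - g x"] sq_int_uminus[of g] by simp

lemma integrable_inner:
  assumes "sq_int f" "sq_int g"
  shows "integrable lborel (\<lambda>x. f x \<bullet> g x)"
proof -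
  have [measurable]: "f \<in> borel_measurable lborel" "g \<in> borel_measurable lborel"
    using assms by (auto simp: sq_int_def)
  have "integrable lborel (\<lambda>x. (norm (f x))\<^sup>2 + (norm (g x))\<^sup>2)"
    using assms by (simp add: sq_int_def)
  then show ?thesis
  proof (rule Bochner_Integration.integrable_bound)
    show "(\<lambda>x. f x \<bullet> g x) \<in> borel_measurable lborel" by measurable
    have "\<bar>a \<bullet> b\<bar> \<le> (norm a)\<^sup>2 + (norm b)\<^sup>2" for a b :: "complex ^ 2"
    proof -
      have "\<bar>a \<bullet> b\<bar> \<le> norm a * norm b" by (rule Cauchy_Schwarz_ineq2)
      also have "\<dots> \<le> (norm a)\<^sup>2 + (norm b)\<^sup>2"
      proof -
        have "0 \<le> norm a * norm b" by simp
        with sum_squares_bound[of "norm a" "norm b"] show ?thesis by linarith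
      qed
      finally show ?thesis .
    qed
    then show "AE x in lborel. norm (f x \<bullet> g x) \<le> norm ((norm (f x))\<^sup>2 + (norm (g x))\<^sup>2)"
      by simp
  qed
qed

quotient_type spinor = "real \<Rightarrow> complex ^ 2" / partial: spinor_rel
  morphisms rep_spinor ket
proof (rule part_equivpI)
  show "\<exists>f. spinor_rel f f"
    by (rule exI[of _ "\<lambda>_. 0"]) (simp add: spinor_rel_def sq_int_0)
  show "symp spinor_rel"
    by (rule sympI) (auto simp: spinor_rel_def elim: eventually_mono)
  show "transp spinor_rel"
  proof (rule transpI)
    fix f g h assume "spinor_rel f g" "spinor_rel g h"
    then show "spinor_rel f h"
      unfolding spinor_rel_def by (auto elim: eventually_elim2)
  qed
qed

instantiation spinor :: real_inner
begin

lift_definition zero_spinor :: spinor is "\<lambda>_. 0"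
  by (simp add: spinor_rel_def sq_int_0)

lift_definition plus_spinor :: "spinor \<Rightarrow> spinor \<Rightarrow> spinor" is "\<lambda>f g x. f x + g x"
  by (auto simp: spinor_rel_def sq_int_add elim: eventually_elim2)

lift_definition minus_spinor :: "spinor \<Rightarrow> spinor \<Rightarrow> spinor" is "\<lambda>f g x. f x - g x"
  by (auto simp: spinor_rel_def sq_int_diff elim: eventually_elim2)

lift_definition uminus_spinor :: "spinor \<Rightarrow> spinor" is "\<lambda>f x. - f x"
  by (auto simp: spinor_rel_def sq_int_uminus elim: eventually_mono)

lift_definition scaleR_spinor :: "real \<Rightarrow> spinor \<Rightarrow> spinor" is "\<lambda>c f x. c *\<^sub>R f x"
  by (auto simp: spinor_rel_def sq_int_scaleR elim: eventually_mono)

lift_definition inner_spinor :: "spinor \<Rightarrow> spinor \<Rightarrow> real" is "\<lambda>f g. LINT x|lborel. f x \<bullet> g x"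
proof -
  fix f f' g g' assume *: "spinor_rel f f'" "spinor_rel g g'"
  then have [measurable]: "f \<in> borel_measurable lborel" "g \<in> borel_measurable lborel"
      "f' \<in> borel_measurable lborel" "g' \<in> borel_measurable lborel"
    by (auto simp: spinor_rel_def sq_int_def)
  have "AE x in lborel. f x \<bullet> g x = f' x \<bullet> g' x"
    using * by (auto simp: spinor_rel_def elim: eventually_elim2)
  then show "(LINT x|lborel. f x \<bullet> g x) = (LINT x|lborel. f' x \<bullet> g' x)"
    by (intro integral_cong_AE) auto
qed

definition norm_spinor :: "spinor \<Rightarrow> real" where
  "norm_spinor \<psi> = sqrt (\<psi> \<bullet> \<psi>)"

definition sgn_spinor :: "spinor \<Rightarrow> spinor" where
  "sgn_spinor \<psi> = scaleR (inverse (norm \<psi>)) \<psi>"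

definition dist_spinor :: "spinor \<Rightarrow> spinor \<Rightarrow> real" where
  "dist_spinor \<phi> \<psi> = norm (\<phi> - \<psi>)"

definition uniformity_spinor :: "(spinor \<times> spinor) filter" where
  "uniformity_spinor = (INF e\<in>{0<..}. principal {(\<phi>, \<psi>). dist \<phi> \<psi> < e})"

definition open_spinor :: "spinor set \<Rightarrow> bool" where
  "open_spinor S \<longleftrightarrow> (\<forall>\<phi>\<in>S. \<forall>\<^sub>F (\<phi>', \<psi>) in uniformity. \<phi>' = \<phi> \<longrightarrow> \<psi> \<in> S)"

instance
proof
  fix \<phi> \<psi> \<eta> :: spinor and r s :: real
  show "\<phi> + \<psi> + \<eta> = \<phi> + (\<psi> + \<eta>)"
    by transfer (auto simp: spinor_rel_def algebra_simps intro!: sq_int_add)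
  show "\<phi> + \<psi> = \<psi> + \<phi>"
    by transfer (auto simp: spinor_rel_def algebra_simps intro!: sq_int_add)
  show "0 + \<phi> = \<phi>"
    by transfer (auto simp: spinor_rel_def)
  show "- \<phi> + \<phi> = 0"
    by transfer (auto simp: spinor_rel_def sq_int_0)
  show "\<phi> - \<psi> = \<phi> + - \<psi>"
    by transfer (auto simp: spinor_rel_def intro!: sq_int_diff)
  show "r *\<^sub>R (\<phi> + \<psi>) = r *\<^sub>R \<phi> + r *\<^sub>R \<psi>"
    by transfer (auto simp: spinor_rel_def scaleR_add_right intro!: sq_int_scaleR sq_int_add)
  show "(r + s) *\<^sub>R \<phi> = r *\<^sub>R \<phi> + s *\<^sub>R \<phi>"
    by transfer (auto simp: spinor_rel_def scaleR_add_left intro!: sq_int_scaleR sq_int_add)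
  show "r *\<^sub>R s *\<^sub>R \<phi> = (r * s) *\<^sub>R \<phi>"
    by transfer (auto simp: spinor_rel_def intro!: sq_int_scaleR)
  show "1 *\<^sub>R \<phi> = \<phi>"
    by transfer (auto simp: spinor_rel_def)
  show "dist \<phi> \<psi> = norm (\<phi> - \<psi>)"
    by (rule dist_spinor_def)
  show "sgn \<phi> = scaleR (inverse (norm \<phi>)) \<phi>"
    by (rule sgn_spinor_def)
  show "norm \<phi> = sqrt (\<phi> \<bullet> \<phi>)"
    by (rule norm_spinor_def)
  show "uniformity = (INF e\<in>{0<..}. principal {(\<phi> :: spinor, \<psi>). dist \<phi> \<psi> < e})"
    by (rule uniformity_spinor_def)
  show "open S \<longleftrightarrow> (\<forall>\<phi>\<in>S. \<forall>\<^sub>F (\<phi>', \<psi>) in uniformity. \<phi>' = \<phi> \<longrightarrow> \<psi> \<in> S)"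
    for S :: "spinor set"
    by (rule open_spinor_def)
  show "\<phi> \<bullet> \<psi> = \<psi> \<bullet> \<phi>"
    by transfer (simp add: inner_commute)
  show "(\<phi> + \<psi>) \<bullet> \<eta> = \<phi> \<bullet> \<eta> + \<psi> \<bullet> \<eta>"
    by transfer (simp add: spinor_rel_def inner_add_left integrable_inner)
  show "r *\<^sub>R \<phi> \<bullet> \<psi> = r * (\<phi> \<bullet> \<psi>)"
    by transfer simp
  show "0 \<le> \<phi> \<bullet> \<phi>"
    by transfer simp
  show "\<phi> \<bullet> \<phi> = 0 \<longleftrightarrow> \<phi> = 0"
  proof transfer
    fix f assume "spinor_rel f f"
    then have f: "sq_int f" by (simp add: spinor_rel_def)
    have "(LINT x|lborel. f x \<bullet> f x) = 0 \<longleftrightarrow> (AE x in lborel. f x \<bullet> f x = 0)"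
      using integrable_inner[OF f f] by (intro integral_nonneg_eq_0_iff_AE) auto
    then show "(LINT x|lborel. f x \<bullet> f x) = 0 \<longleftrightarrow> spinor_rel f (\<lambda>_. 0)"
      using f by (simp add: spinor_rel_def sq_int_0)
  qed
qed

end

lift_definition scaleC :: "complex \<Rightarrow> spinor \<Rightarrow> spinor" (infixr \<open>*\<^sub>C\<close> 75)
  is "\<lambda>c f x. c *s f x"
  by (auto simp: spinor_rel_def sq_int_scale elim: eventually_mono)

text \<open>
  The complex inner product, antilinear in the first argument; its real part is the inner product
  of the class \<^class>\<open>real_inner\<close>.
\<close>

lift_definition cinner :: "spinor \<Rightarrow> spinor \<Rightarrow> complex"
  is "\<lambda>f g. LINT x|lborel. (\<Sum>i\<in>UNIV. cnj (f x $ i) * g x $ i)"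
proof -
  fix f f' g g' assume *: "spinor_rel f f'" "spinor_rel g g'"
  then have [measurable]: "f \<in> borel_measurable lborel" "g \<in> borel_measurable lborel"
      "f' \<in> borel_measurable lborel" "g' \<in> borel_measurable lborel"
    by (auto simp: spinor_rel_def sq_int_def)
  have c: "(\<lambda>x. \<Sum>i\<in>UNIV. cnj (u x $ i) * v x $ i) \<in> borel_measurable lborel"
    if [measurable]: "u \<in> borel_measurable lborel" "v \<in> borel_measurable lborel"
    for u v :: "real \<Rightarrow> complex ^ 2"
  proof -
    have "continuous_on UNIV (\<lambda>p :: (complex ^ 2) \<times> (complex ^ 2).
        \<Sum>i\<in>UNIV. cnj (fst p $ i) * snd p $ i)"
      by (intro continuous_intros)
    from measurable_compose[OF borel_measurable_Pair[OF that] borel_measurable_continuous_onI[OF this]]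
    show ?thesis by simp
  qed
  have "AE x in lborel. (\<Sum>i\<in>UNIV. cnj (f x $ i) * g x $ i)
      = (\<Sum>i\<in>UNIV. cnj (f' x $ i) * g' x $ i)"
    using * by (auto simp: spinor_rel_def elim: eventually_elim2)
  then show "(LINT x|lborel. (\<Sum>i\<in>UNIV. cnj (f x $ i) * g x $ i))
      = (LINT x|lborel. (\<Sum>i\<in>UNIV. cnj (f' x $ i) * g' x $ i))"
    by (rule integral_cong_AE[rotated 2]) (rule c; measurable)+
qed

section \<open>Operators and unitary groups\<close>

text \<open>Unbounded operators are represented by their graphs.\<close>

type_synonym operator = "(spinor \<times> spinor) set"

definition app :: "operator \<Rightarrow> spinor \<Rightarrow> spinor" where
  "app A \<psi> = (THE \<eta>. (\<psi>, \<eta>) \<in> A)"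

definition clinear_graph :: "operator \<Rightarrow> bool" where
  "clinear_graph A \<longleftrightarrow> single_valued A \<and> (0, 0) \<in> A \<and>
     (\<forall>\<psi> \<eta> \<psi>' \<eta>'. (\<psi>, \<eta>) \<in> A \<longrightarrow> (\<psi>', \<eta>') \<in> A \<longrightarrow> (\<psi> + \<psi>', \<eta> + \<eta>') \<in> A) \<and>
     (\<forall>c \<psi> \<eta>. (\<psi>, \<eta>) \<in> A \<longrightarrow> (c *\<^sub>C \<psi>, c *\<^sub>C \<eta>) \<in> A)"

definition clinear :: "(spinor \<Rightarrow> spinor) \<Rightarrow> bool" where
  "clinear T \<longleftrightarrow> (\<forall>\<phi> \<psi>. T (\<phi> + \<psi>) = T \<phi> + T \<psi>) \<and> (\<forall>c \<psi>. T (c *\<^sub>C \<psi>) = c *\<^sub>C T \<psi>)"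

definition unitary :: "(spinor \<Rightarrow> spinor) \<Rightarrow> bool" where
  "unitary T \<longleftrightarrow> clinear T \<and> surj T \<and> (\<forall>\<psi>. norm (T \<psi>) = norm \<psi>)"

text \<open>
  \<open>propagator A t\<close> is \<open>e\<^sup>-\<^sup>i\<^sup>t\<^sup>A\<close>: the strongly continuous one-parameter unitary group whose
  generator, with its full domain, is \<open>A\<close>. By Stone's theorem it exists, and is then unique,
  precisely when \<open>A\<close> is self-adjoint; otherwise the description is unspecified.
\<close>

definition generates :: "operator \<Rightarrow> (real \<Rightarrow> spinor \<Rightarrow> spinor) \<Rightarrow> bool" where
  "generates A U \<longleftrightarrow>
     (\<forall>t. unitary (U t)) \<and> U 0 = id \<and> (\<forall>s t. U (s + t) = U s \<circ> U t) \<and>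
     (\<forall>\<psi>. continuous_on UNIV (\<lambda>t. U t \<psi>)) \<and>
     A = {(\<psi>, \<eta>). ((\<lambda>t. U t \<psi>) has_vector_derivative ((- \<i>) *\<^sub>C \<eta>)) (at 0)}"

definition propagator :: "operator \<Rightarrow> real \<Rightarrow> spinor \<Rightarrow> spinor" where
  "propagator A = (THE U. generates A U)"

section \<open>Functional calculus\<close>

definition orth_projection :: "(spinor \<Rightarrow> spinor) \<Rightarrow> bool" where
  "orth_projection P \<longleftrightarrow>
     clinear P \<and> P \<circ> P = P \<and> (\<forall>\<phi> \<psi>. cinner (P \<phi>) \<psi> = cinner \<phi> (P \<psi>))"

definition projection_valued_measure :: "(real set \<Rightarrow> spinor \<Rightarrow> spinor) \<Rightarrow> bool" where
  "projection_valued_measure E \<longleftrightarrow>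
     (\<forall>B\<in>sets borel. orth_projection (E B)) \<and> E UNIV = id \<and>
     (\<forall>F \<psi>. range F \<subseteq> sets borel \<longrightarrow> disjoint_family F \<longrightarrow>
        (\<lambda>n. E (F n) \<psi>) sums E (\<Union>n. F n) \<psi>)"

definition diag_measure :: "(real set \<Rightarrow> spinor \<Rightarrow> spinor) \<Rightarrow> spinor \<Rightarrow> real measure" where
  "diag_measure E \<psi> = measure_of UNIV (sets borel) (\<lambda>B. ennreal (Re (cinner \<psi> (E B \<psi>))))"

text \<open>
  \<open>T\<close> is the integral of the Borel function \<open>f\<close> against \<open>E\<close>. By polarisation, the linear operator
  \<open>T\<close> is determined by its domain and its quadratic form.
\<close>

definition is_spectral_integral ::
  "(real set \<Rightarrow> spinor \<Rightarrow> spinor) \<Rightarrow> (real \<Rightarrow> complex) \<Rightarrow> operator \<Rightarrow> bool" where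
  "is_spectral_integral E f T \<longleftrightarrow>
     clinear_graph T \<and>
     Domain T = {\<psi>. integrable (diag_measure E \<psi>) (\<lambda>x. (cmod (f x))\<^sup>2)} \<and>
     (\<forall>(\<psi>, \<eta>)\<in>T. cinner \<psi> \<eta> = (LINT x|diag_measure E \<psi>. f x))"

definition spectral_measure :: "operator \<Rightarrow> (real set \<Rightarrow> spinor \<Rightarrow> spinor) \<Rightarrow> bool" where
  "spectral_measure A E \<longleftrightarrow> projection_valued_measure E \<and> is_spectral_integral E complex_of_real A"

definition fun_calc :: "(real \<Rightarrow> complex) \<Rightarrow> operator \<Rightarrow> operator" where
  "fun_calc f A = (THE T. \<exists>E. spectral_measure A E \<and> is_spectral_integral E f T)"

section \<open>The Rabi and Jaynes-Cummings Hamiltonians\<close>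

definition dx :: "(real \<Rightarrow> complex) \<Rightarrow> real \<Rightarrow> complex" where
  "dx f x = vector_derivative f (at x)"

definition schwartz :: "(real \<Rightarrow> complex) set" where
  "schwartz = {f. (\<forall>n x. (dx ^^ n) f differentiable at x) \<and>
                  (\<forall>m n. bounded (range (\<lambda>x. x ^ m *\<^sub>R (dx ^^ n) f x)))}"

definition schwartz_spinor :: "(real \<Rightarrow> complex ^ 2) set" where
  "schwartz_spinor = {\<Psi>. \<forall>i. (\<lambda>x. \<Psi> x $ i) \<in> schwartz}"

definition ann :: "(real \<Rightarrow> complex) \<Rightarrow> real \<Rightarrow> complex" where
  "ann f x = (1 / sqrt 2) *\<^sub>R (x *\<^sub>R f x + dx f x)"

definition cre :: "(real \<Rightarrow> complex) \<Rightarrow> real \<Rightarrow> complex" where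
  "cre f x = (1 / sqrt 2) *\<^sub>R (x *\<^sub>R f x - dx f x)"

definition \<sigma>x :: "complex ^ 2 ^ 2" where "\<sigma>x = vector [vector [0, 1], vector [1, 0]]"
definition \<sigma>z :: "complex ^ 2 ^ 2" where "\<sigma>z = vector [vector [1, 0], vector [0, -1]]"
definition \<sigma>plus :: "complex ^ 2 ^ 2" where "\<sigma>plus = vector [vector [0, 1], vector [0, 0]]"
definition \<sigma>minus :: "complex ^ 2 ^ 2" where "\<sigma>minus = vector [vector [0, 0], vector [1, 0]]"

text \<open>\<open>tensor M T\<close> is \<open>M \<otimes> T\<close>.\<close>

definition tensor :: "complex ^ 2 ^ 2 \<Rightarrow> ((real \<Rightarrow> complex) \<Rightarrow> real \<Rightarrow> complex) \<Rightarrow>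
    (real \<Rightarrow> complex ^ 2) \<Rightarrow> real \<Rightarrow> complex ^ 2" where
  "tensor M T \<Psi> x = M *v (\<chi> i. T (\<lambda>y. \<Psi> y $ i) x)"

definition core_closure :: "((real \<Rightarrow> complex ^ 2) \<Rightarrow> real \<Rightarrow> complex ^ 2) \<Rightarrow> operator" where
  "core_closure T = closure ((\<lambda>\<Psi>. (ket \<Psi>, ket (T \<Psi>))) ` schwartz_spinor)"

text \<open>The arguments of the Hamiltonians are the coupling \<open>l\<close> and the frequencies \<open>\<Omega>\<close>, \<open>\<omega>\<close>.\<close>

definition H :: "real \<Rightarrow> real \<Rightarrow> real \<Rightarrow> operator" where
  "H l \<Omega> \<omega> = core_closure (\<lambda>\<Psi> x.
     (\<Omega> / 2) *\<^sub>R tensor \<sigma>z id \<Psi> x + \<omega> *\<^sub>R tensor (mat 1) (cre \<circ> ann) \<Psi> x +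
     l *\<^sub>R tensor \<sigma>x (\<lambda>f x. ann f x + cre f x) \<Psi> x)"

definition H_RWA :: "real \<Rightarrow> real \<Rightarrow> real \<Rightarrow> operator" where
  "H_RWA l \<Omega> \<omega> = core_closure (\<lambda>\<Psi> x.
     (\<Omega> / 2) *\<^sub>R tensor \<sigma>z id \<Psi> x + \<omega> *\<^sub>R tensor (mat 1) (cre \<circ> ann) \<Psi> x +
     l *\<^sub>R (tensor \<sigma>plus ann \<Psi> x + tensor \<sigma>minus cre \<Psi> x))"

definition H0 :: "real \<Rightarrow> operator" where
  "H0 \<omega> = core_closure (\<lambda>\<Psi> x.
     (\<omega> / 2) *\<^sub>R tensor \<sigma>z id \<Psi> x + \<omega> *\<^sub>R tensor (mat 1) (cre \<circ> ann) \<Psi> x)"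

definition num_op :: operator where
  "num_op = core_closure (tensor (mat 1) (cre \<circ> ann))"

definition sqrt_N2 :: operator where
  "sqrt_N2 = fun_calc (\<lambda>n. complex_of_real (sqrt (n + 2))) num_op"

definition sqrt_N2_N3 :: operator where
  "sqrt_N2_N3 = fun_calc (\<lambda>n. complex_of_real (sqrt ((n + 2) * (n + 3)))) num_op"

definition U1 :: "real \<Rightarrow> real \<Rightarrow> real \<Rightarrow> real \<Rightarrow> spinor \<Rightarrow> spinor" where
  "U1 l \<Omega> \<omega> t = propagator (H0 \<omega>) (- t) \<circ> propagator (H l \<Omega> \<omega>) t"

definition U2 :: "real \<Rightarrow> real \<Rightarrow> real \<Rightarrow> real \<Rightarrow> spinor \<Rightarrow> spinor" where
  "U2 l \<Omega> \<omega> t = propagator (H0 \<omega>) (- t) \<circ> propagator (H_RWA l \<Omega> \<omega>) t"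

end

theory Submission
  imports Defs "HOL-Probability.Probability"
begin

text \<open>
  Write \<open>R\<close> for \<open>H_RWA\<close>. With \<open>K = \<sigma>\<^sub>+ \<otimes> a\<^sup>\<dagger> - \<sigma>\<^sub>- \<otimes> a\<close>, \<open>C = \<sigma>\<^sub>+ \<otimes> a\<^sup>\<dagger> + \<sigma>\<^sub>- \<otimes> a\<close> and \<open>G = \<sigma>\<^sub>+ \<otimes> a + \<sigma>\<^sub>- \<otimes> a\<^sup>\<dagger>\<close> one has
  \<open>H - R = \<lambda> C\<close> and \<open>H K - K R = (\<omega> + \<Omega>) C + \<lambda> (G K + C K - K G)\<close>, so the derivative of
  \<open>e\<^sup>i\<^sup>t\<^sup>H (1 - \<kappa> K) e\<^sup>-\<^sup>i\<^sup>t\<^sup>R\<close> involves only \<open>(\<lambda> - \<kappa> (\<omega> + \<Omega>)) C\<close> and a term of size \<open>\<kappa> \<lambda>\<close>.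
  The choice \<open>\<kappa> = \<lambda> / (2 \<omega>)\<close> gives the bound, and \<open>\<kappa> = \<lambda> / (\<omega> + \<Omega>)\<close> gives both limits, at fixed
  \<open>\<Omega>\<close> and at fixed detuning. The unbounded factors are controlled along \<open>e\<^sup>-\<^sup>i\<^sup>t\<^sup>R\<close> because
  \<open>R\<close> commutes with the excitation number \<open>N + (1 + \<sigma>\<^sub>z) / 2\<close>.

  The propagators exist without Stone's theorem: \<open>H\<^sub>0\<close> and \<open>R\<close> have explicit orthonormal eigenbases
  of Schwartz functions, and \<open>H\<close> is the bounded perturbation \<open>(\<Omega> / 2) \<sigma>\<^sub>z\<close> of a displaced oscillator,
  which has an eigenbasis of translated Hermite functions.
\<close>

subsection \<open>The complex Hilbert space\<close>

text \<open>\<open>propagator\<close> and \<open>fun_calc\<close> are definite descriptions, so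
  nothing can be said about either before existence and uniqueness are both proved; for the
  functional calculus this includes that a diagonal operator has only one spectral measure.
  Eigenbases reduce these questions to coefficient sequences. The analytic obstacle is that
  \<open>H\<close> does not commute with the excitation number M, so no unbounded factor may be
  carried past its propagator. In the differentiated product the factor of \<open>H\<close> stands
  on the far left, where only its isometry is used. K changes the free energy by plus or minus
  \<omega> + \<Omega>, so dividing by that gap amounts to integrating the fast oscillation by parts:
  the two boundary terms cost 2 \<kappa> times a first-order norm, the remainder |t| times
  second-order norms. Domain questions are avoided by working with finite sums of eigenvectors of
  \<open>R\<close>, which remain Schwartz spinors under the evolution; unitarity carries the bound
  to the limit. Finally M <= N + 1 turns the weights M + 1 and (M + 1)(M + 2) into N + 2 and (N +
  2)(N + 3).\<close>

lemma vec2_ext: "(x :: 'a ^ 2) = y \<longleftrightarrow> x $ 1 = y $ 1 \<and> x $ 2 = y $ 2"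
  by (auto simp: vec_eq_iff forall_2)

lemma scaleC_add_right: "c *\<^sub>C (\<phi> + \<psi>) = c *\<^sub>C \<phi> + c *\<^sub>C \<psi>"
  by transfer (auto simp: spinor_rel_def vec_eq_iff algebra_simps intro!: sq_int_scale sq_int_add)

lemma scaleC_add_left: "(c + d) *\<^sub>C \<psi> = c *\<^sub>C \<psi> + d *\<^sub>C \<psi>"
  by transfer (auto simp: spinor_rel_def vec_eq_iff algebra_simps intro!: sq_int_scale sq_int_add)

lemma scaleC_scaleC [simp]: "c *\<^sub>C d *\<^sub>C \<psi> = (c * d) *\<^sub>C \<psi>"
  by transfer (auto simp: spinor_rel_def vec_eq_iff algebra_simps intro!: sq_int_scale)

lemma scaleC_of_real: "complex_of_real r *\<^sub>C \<psi> = r *\<^sub>R \<psi>"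
proof -
  have "complex_of_real r *s v = r *\<^sub>R v" for v :: "complex ^ 2"
    unfolding vec_eq_iff vector_scaleR_component vector_smult_component
    by (simp only: scaleR_conv_of_real simp_thms)
  then show ?thesis by transfer (auto simp: spinor_rel_def intro!: sq_int_scaleR)
qed

lemma scaleC_one [simp]: "1 *\<^sub>C \<psi> = \<psi>"
  using scaleC_of_real[of 1 \<psi>] by simp

lemma scaleC_zero_left [simp]: "0 *\<^sub>C \<psi> = 0"
  using scaleC_of_real[of 0 \<psi>] by simp

lemma scaleC_minus_one: "(- 1) *\<^sub>C \<psi> = - \<psi>"
  using scaleC_of_real[of "-1" \<psi>] by simp

lemma scaleC_minus_left [simp]: "(- c) *\<^sub>C \<psi> = - (c *\<^sub>C \<psi>)"
  using scaleC_minus_one[of "c *\<^sub>C \<psi>"] by simp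

lemma scaleC_zero_right [simp]: "c *\<^sub>C 0 = 0"
  using scaleC_scaleC[of c 0 0] by simp

lemma scaleC_minus_right [simp]: "c *\<^sub>C (- \<psi>) = - (c *\<^sub>C \<psi>)"
  using scaleC_scaleC[of c "-1" \<psi>] by (simp add: scaleC_minus_one)

lemma scaleC_diff_right: "c *\<^sub>C (\<phi> - \<psi>) = c *\<^sub>C \<phi> - c *\<^sub>C \<psi>"
  using scaleC_add_right[of c \<phi> "- \<psi>"] by simp

lemma scaleC_scaleR: "c *\<^sub>C (r *\<^sub>R \<psi>) = r *\<^sub>R (c *\<^sub>C \<psi>)"
  by (simp add: mult.commute flip: scaleC_of_real)

lemma scaleC_sum_right: "c *\<^sub>C (\<Sum>i\<in>I. f i) = (\<Sum>i\<in>I. c *\<^sub>C f i)"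
  by (induction I rule: infinite_finite_induct) (auto simp: scaleC_add_right)

lemma scaleC_Re_Im: "c *\<^sub>C \<psi> = Re c *\<^sub>R \<psi> + Im c *\<^sub>R (\<i> *\<^sub>C \<psi>)"
proof -
  have "c = complex_of_real (Re c) + complex_of_real (Im c) * \<i>"
    by (simp add: complex_eq_iff)
  then have "c *\<^sub>C \<psi> = (complex_of_real (Re c) + complex_of_real (Im c) * \<i>) *\<^sub>C \<psi>" by simp
  then show ?thesis by (simp only: scaleC_add_left scaleC_of_real flip: scaleC_scaleC)
qed

lemma norm_scaleC [simp]: "norm (c *\<^sub>C \<psi>) = cmod c * norm \<psi>"
proof -
  have "(c *\<^sub>C \<psi>) \<bullet> (c *\<^sub>C \<psi>) = (cmod c)\<^sup>2 * (\<psi> \<bullet> \<psi>)"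
    by transfer (simp add: norm_vector_scalar_mult power_mult_distrib flip: power2_norm_eq_inner)
  then show ?thesis by (simp add: norm_eq_sqrt_inner real_sqrt_mult)
qed

lemma bounded_linear_scaleC: "bounded_linear ((*\<^sub>C) c)"
  by (rule bounded_linear_intro[of _ "cmod c"]) (auto simp: scaleC_add_right scaleC_scaleR mult.commute)

lemma bounded_bilinear_scaleC: "bounded_bilinear (*\<^sub>C)"
  by standard (auto simp: scaleC_add_left scaleC_add_right scaleC_scaleR scaleR_conv_of_real
      simp flip: scaleC_scaleC simp: scaleC_of_real intro!: exI[of _ 1])

lemmas tendsto_scaleC [tendsto_intros] = bounded_bilinear.tendsto[OF bounded_bilinear_scaleC]
lemmas continuous_on_scaleC [continuous_intros] = bounded_bilinear.continuous_on[OF bounded_bilinear_scaleC]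
lemmas has_vector_derivative_scaleC = bounded_bilinear.has_vector_derivative[OF bounded_bilinear_scaleC]

lemma inner_i_right: "\<phi> \<bullet> (\<i> *\<^sub>C \<psi>) = - ((\<i> *\<^sub>C \<phi>) \<bullet> \<psi>)"
proof (transfer, goal_cases)
  case (1 f g)
  have "f x \<bullet> (\<i> *s g x) = - ((\<i> *s f x) \<bullet> g x)" for x
    by (simp add: inner_vec_def sum_2 inner_complex_def)
  then show ?case by simp
qed

lemma inner_scaleC_right: "\<phi> \<bullet> (c *\<^sub>C \<psi>) = Re c * (\<phi> \<bullet> \<psi>) - Im c * ((\<i> *\<^sub>C \<phi>) \<bullet> \<psi>)"
  by (subst scaleC_Re_Im) (simp add: inner_add_right inner_i_right)

text \<open>Multiplication by \<open>\<i>\<close> recovers the imaginary part from the real inner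
  product, so facts about \<open>cinner\<close> follow from the class \<open>real_inner\<close>
  without returning to integrals.\<close>

lemma cinner_eq: "cinner \<phi> \<psi> = Complex (\<phi> \<bullet> \<psi>) ((\<i> *\<^sub>C \<phi>) \<bullet> \<psi>)"
proof (transfer, goal_cases)
  case (1 f g)
  then have f: "sq_int f" and g: "sq_int g" by (auto simp: spinor_rel_def)
  have f_i: "sq_int (\<lambda>x. \<i> *s f x)" by (rule sq_int_scale[OF f])
  have *: "(\<Sum>i\<in>UNIV. cnj (f x $ i) * g x $ i) =
      complex_of_real (f x \<bullet> g x) + \<i> * complex_of_real ((\<i> *s f x) \<bullet> g x)" for x
    by (simp add: complex_eq_iff inner_vec_def sum_2 inner_complex_def)
  show ?case
    unfolding * using integrable_inner[OF f g] integrable_inner[OF f_i g]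
    by (simp add: Complex_eq integral_complex_of_real)
qed

lemma cinner_add_left: "cinner (\<phi> + \<psi>) \<eta> = cinner \<phi> \<eta> + cinner \<psi> \<eta>"
  by (simp add: cinner_eq inner_add_left scaleC_add_right complex_eq_iff)

lemma cinner_add_right: "cinner \<eta> (\<phi> + \<psi>) = cinner \<eta> \<phi> + cinner \<eta> \<psi>"
  by (simp add: cinner_eq inner_add_right complex_eq_iff)

lemma cinner_commute: "cinner \<phi> \<psi> = cnj (cinner \<psi> \<phi>)"
  using inner_i_right[of \<psi> \<phi>] by (simp add: cinner_eq complex_eq_iff inner_commute)

lemma cinner_scaleC_right [simp]: "cinner \<phi> (c *\<^sub>C \<psi>) = c * cinner \<phi> \<psi>"
  by (simp add: cinner_eq complex_eq_iff inner_scaleC_right)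

lemma cinner_scaleC_left [simp]: "cinner (c *\<^sub>C \<phi>) \<psi> = cnj c * cinner \<phi> \<psi>"
  by (subst (1 2) cinner_commute) simp

lemma cinner_zero_left [simp]: "cinner 0 \<psi> = 0"
  and cinner_zero_right [simp]: "cinner \<psi> 0 = 0"
  by (simp_all add: cinner_eq complex_eq_iff)

lemma cinner_minus_left [simp]: "cinner (- \<phi>) \<psi> = - cinner \<phi> \<psi>"
  and cinner_minus_right [simp]: "cinner \<phi> (- \<psi>) = - cinner \<phi> \<psi>"
  by (simp_all add: cinner_eq complex_eq_iff)

lemma cinner_diff_right: "cinner \<eta> (\<phi> - \<psi>) = cinner \<eta> \<phi> - cinner \<eta> \<psi>"
  using cinner_add_right[of \<eta> \<phi> "-\<psi>"] by simp

lemma cinner_sum_right: "cinner \<phi> (\<Sum>i\<in>I. f i) = (\<Sum>i\<in>I. cinner \<phi> (f i))"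
  by (induction I rule: infinite_finite_induct) (auto simp: cinner_add_right)

lemma cinner_sum_left: "cinner (\<Sum>i\<in>I. f i) \<phi> = (\<Sum>i\<in>I. cinner (f i) \<phi>)"
  by (induction I rule: infinite_finite_induct) (auto simp: cinner_add_left)

lemma cinner_self: "cinner \<psi> \<psi> = complex_of_real ((norm \<psi>)\<^sup>2)"
  using inner_i_right[of \<psi> \<psi>]
  by (simp add: cinner_eq complex_eq_iff power2_norm_eq_inner inner_commute)

lemma Re_cinner: "Re (cinner \<phi> \<psi>) = \<phi> \<bullet> \<psi>"
  by (simp add: cinner_eq)

text \<open>The real inequality controls only the real part; rotating \<open>\<psi>\<close> by the
  conjugate phase makes the complex product real and nonnegative.\<close>

lemma cinner_cauchy_schwarz: "cmod (cinner \<phi> \<psi>) \<le> norm \<phi> * norm \<psi>"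
proof (cases "cinner \<phi> \<psi> = 0")
  case False
  define z where "z = cnj (cinner \<phi> \<psi>) / cmod (cinner \<phi> \<psi>)"
  have "cinner \<phi> (z *\<^sub>C \<psi>) = complex_of_real (cmod (cinner \<phi> \<psi>))"
    using False complex_norm_square[of "cinner \<phi> \<psi>"]
    by (simp add: z_def field_simps power2_eq_square)
  then have "cmod (cinner \<phi> \<psi>) = \<phi> \<bullet> (z *\<^sub>C \<psi>)"
    by (simp flip: Re_cinner)
  also have "\<dots> \<le> norm \<phi> * norm (z *\<^sub>C \<psi>)" by (rule norm_cauchy_schwarz)
  also have "norm (z *\<^sub>C \<psi>) = norm \<psi>" using False by (simp add: z_def norm_divide)
  finally show ?thesis .
qed simp

lemma tendsto_cinner [tendsto_intros]:
  assumes "(f \<longlongrightarrow> a) F" "(g \<longlongrightarrow> b) F"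
  shows "((\<lambda>x. cinner (f x) (g x)) \<longlongrightarrow> cinner a b) F"
  unfolding cinner_eq using assms by (intro tendsto_intros)

lemma continuous_on_cinner [continuous_intros]:
  "continuous_on S f \<Longrightarrow> continuous_on S g \<Longrightarrow> continuous_on S (\<lambda>x. cinner (f x) (g x))"
  unfolding continuous_on_def by (auto intro: tendsto_cinner)

lemma bounded_linear_cinner_right: "bounded_linear (cinner \<phi>)"
  by (rule bounded_linear_intro[of _ "norm \<phi>"])
    (auto simp: cinner_add_right scaleR_conv_of_real simp flip: scaleC_of_real
      intro: order.trans[OF cinner_cauchy_schwarz])

lemma inner_self_pythagoras:
  assumes "cinner \<phi> \<psi> = 0"
  shows "(norm (\<phi> + \<psi>))\<^sup>2 = (norm \<phi>)\<^sup>2 + (norm \<psi>)\<^sup>2"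
  using assms unfolding cinner_eq power2_norm_eq_inner
  by (simp add: inner_add_left inner_add_right inner_commute complex_eq_iff)

lemma clinearD:
  assumes "clinear T"
  shows "T (\<phi> + \<psi>) = T \<phi> + T \<psi>" "T (c *\<^sub>C \<psi>) = c *\<^sub>C T \<psi>" "T 0 = 0" "T (- \<psi>) = - T \<psi>"
    "T (\<phi> - \<psi>) = T \<phi> - T \<psi>" "T (r *\<^sub>R \<psi>) = r *\<^sub>R T \<psi>" "T (\<Sum>i\<in>I. f i) = (\<Sum>i\<in>I. T (f i))"
proof -
  show a: "T (\<phi> + \<psi>) = T \<phi> + T \<psi>" for \<phi> \<psi> using assms by (simp add: clinear_def)
  show s: "T (c *\<^sub>C \<psi>) = c *\<^sub>C T \<psi>" for c \<psi> using assms by (simp add: clinear_def)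
  show z: "T 0 = 0" using s[of 0 0] by simp
  show m: "T (- \<psi>) = - T \<psi>" for \<psi> using s[of "-1" \<psi>] by (simp add: scaleC_minus_one)
  show "T (\<phi> - \<psi>) = T \<phi> - T \<psi>" using a[of \<phi> "-\<psi>"] m by simp
  show "T (r *\<^sub>R \<psi>) = r *\<^sub>R T \<psi>" using s[of r \<psi>] by (simp add: scaleC_of_real)
  show "T (\<Sum>i\<in>I. f i) = (\<Sum>i\<in>I. T (f i))"
    by (induction I rule: infinite_finite_induct) (auto simp: z a)
qed

lemma bounded_linear_clinear:
  assumes "clinear T" "\<And>\<psi>. norm (T \<psi>) \<le> b * norm \<psi>"
  shows "bounded_linear T"
  using clinearD[OF assms(1)] assms(2) by (intro bounded_linear_intro[of _ b]) (auto simp: mult.commute)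

subsection \<open>Completeness\<close>

lemma norm_ket:
  assumes "sq_int f"
  shows "(norm (ket f))\<^sup>2 = (LINT x|lborel. (norm (f x))\<^sup>2)"
proof -
  have "spinor_rel f f" using assms by (simp add: spinor_rel_def)
  then have "ket f \<bullet> ket f = (LINT x|lborel. f x \<bullet> f x)"
    by (simp add: inner_spinor.abs_eq)
  then show ?thesis by (simp add: power2_norm_eq_inner)
qed

lemma sq_int_rep: "sq_int (rep_spinor \<psi>)"
proof -
  have "spinor_rel (rep_spinor \<psi>) (rep_spinor \<psi>)"
    using Quotient_rep_reflp[OF Quotient_spinor] .
  then show ?thesis by (simp add: spinor_rel_def)
qed

lemma ket_rep [simp]: "ket (rep_spinor \<psi>) = \<psi>"
  using Quotient_abs_rep[OF Quotient_spinor] .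

lemma ket_eq_iff:
  assumes "sq_int f" "sq_int g"
  shows "ket f = ket g \<longleftrightarrow> (AE x in lborel. f x = g x)"
proof -
  have "spinor_rel f f" "spinor_rel g g" using assms by (simp_all add: spinor_rel_def)
  then have "ket f = ket g \<longleftrightarrow> spinor_rel f g"
    using Quotient_rel[OF Quotient_spinor, of f g] by blast
  then show ?thesis using assms by (simp add: spinor_rel_def)
qed

lemma ket_add: "sq_int f \<Longrightarrow> sq_int g \<Longrightarrow> ket (\<lambda>x. f x + g x) = ket f + ket g"
  and ket_diff: "sq_int f \<Longrightarrow> sq_int g \<Longrightarrow> ket (\<lambda>x. f x - g x) = ket f - ket g"
  and ket_scale: "sq_int f \<Longrightarrow> ket (\<lambda>x. c *s f x) = c *\<^sub>C ket f"
  by (simp_all add: plus_spinor.abs_eq minus_spinor.abs_eq scaleC.abs_eq spinor_rel_def)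

text \<open>Bridge from Fatou's lemma, which bounds a nonnegative integral, back to membership in
  the space and its norm.\<close>

lemma square_integrable_nn_integral:
  fixes f :: "real \<Rightarrow> complex ^ 2"
  assumes [measurable]: "f \<in> borel_measurable lborel"
    and le: "(\<integral>\<^sup>+x. ennreal ((norm (f x))\<^sup>2) \<partial>lborel) \<le> ennreal c" and "0 \<le> c"
  shows "sq_int f" "(norm (ket f))\<^sup>2 \<le> c"
proof -
  have fin: "(\<integral>\<^sup>+x. ennreal ((norm (f x))\<^sup>2) \<partial>lborel) < \<infinity>"
    using order.strict_trans1[OF le ennreal_less_top] by simp
  have int: "integrable lborel (\<lambda>x. (norm (f x))\<^sup>2)"
    by (rule integrableI_nonneg) (use fin in auto)
  then show s: "sq_int f" using assms(1) by (simp add: sq_int_def)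
  have "ennreal (LINT x|lborel. (norm (f x))\<^sup>2) \<le> ennreal c"
    using le int by (simp add: nn_integral_eq_integral)
  then show "(norm (ket f))\<^sup>2 \<le> c"
    using \<open>0 \<le> c\<close> s by (simp add: norm_ket)
qed

lemma nn_integral_norm_ket:
  "sq_int f \<Longrightarrow> (\<integral>\<^sup>+x. ennreal ((norm (f x))\<^sup>2) \<partial>lborel) = ennreal ((norm (ket f))\<^sup>2)"
  by (simp add: norm_ket sq_int_def nn_integral_eq_integral)

text \<open>The squared increments integrate to at most 4^(-k), so even weighted by 2^k their sum is
  integrable and hence finite almost everywhere. The weight is what lets the squares control the
  increments themselves.\<close>

lemma spinor_fast_Cauchy_AE_convergent:
  assumes fast: "\<And>k. norm (ket (f (Suc k)) - ket (f k)) \<le> (1/2) ^ k" and f: "\<And>k. sq_int (f k)"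
  shows "AE x in lborel. convergent (\<lambda>k. f k x)"
proof -
  define d where "d k x = f (Suc k) x - f k x" for k x
  have sd: "sq_int (d k)" for k unfolding d_def by (intro sq_int_diff f)
  then have [measurable]: "d k \<in> borel_measurable lborel" for k by (simp add: sq_int_def)
  have nd: "(norm (ket (d k)))\<^sup>2 \<le> (1/4) ^ k" for k
  proof -
    have "ket (d k) = ket (f (Suc k)) - ket (f k)" unfolding d_def by (intro ket_diff f)
    then have "(norm (ket (d k)))\<^sup>2 \<le> ((1/2) ^ k)\<^sup>2" using fast by (intro power_mono) auto
    also have "\<dots> = (1/4::real) ^ k"
      by (subst power_mult[symmetric], subst mult.commute, subst power_mult) (simp add: power2_eq_square)
    finally show ?thesis .
  qed
  have "(\<integral>\<^sup>+x. (\<Sum>k. ennreal (2 ^ k * (norm (d k x))\<^sup>2)) \<partial>lborel)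
      = (\<Sum>k. \<integral>\<^sup>+x. ennreal (2 ^ k * (norm (d k x))\<^sup>2) \<partial>lborel)"
    by (intro nn_integral_suminf) auto
  also have "\<dots> \<le> (\<Sum>k. ennreal ((1/2) ^ k))"
  proof (intro suminf_le)
    fix k
    have "(\<integral>\<^sup>+x. ennreal (2 ^ k * (norm (d k x))\<^sup>2) \<partial>lborel)
        = (\<integral>\<^sup>+x. ennreal (2 ^ k) * ennreal ((norm (d k x))\<^sup>2) \<partial>lborel)"
      by (intro nn_integral_cong ennreal_mult) auto
    also have "\<dots> = ennreal (2 ^ k) * ennreal ((norm (ket (d k)))\<^sup>2)"
      by (subst nn_integral_cmult) (measurable, simp only: nn_integral_norm_ket[OF sd])
    also have "\<dots> = ennreal (2 ^ k * (norm (ket (d k)))\<^sup>2)"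
      by (rule ennreal_mult[symmetric]) auto
    also have "\<dots> \<le> ennreal (2 ^ k * (1/4) ^ k)"
      using nd by (intro ennreal_leI mult_left_mono) auto
    also have "2 ^ k * (1/4::real) ^ k = (1/2) ^ k" by (simp flip: power_mult_distrib)
    finally show "(\<integral>\<^sup>+x. ennreal (2 ^ k * (norm (d k x))\<^sup>2) \<partial>lborel) \<le> ennreal ((1/2) ^ k)" .
  qed auto
  also have "\<dots> < \<infinity>"
    by (subst suminf_ennreal2) (auto simp: summable_geometric)
  finally have "AE x in lborel. (\<Sum>k. ennreal (2 ^ k * (norm (d k x))\<^sup>2)) \<noteq> \<infinity>"
    by (intro nn_integral_PInf_AE) auto
  then show ?thesis
  proof (rule eventually_mono)
    fix x assume "(\<Sum>k. ennreal (2 ^ k * (norm (d k x))\<^sup>2)) \<noteq> \<infinity>"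
    then have "summable (\<lambda>k. 2 ^ k * (norm (d k x))\<^sup>2)"
      by (intro summable_suminf_not_top) auto
    then have s: "summable (\<lambda>k. 2 ^ k * (norm (d k x))\<^sup>2 + (1/2) ^ k)"
      by (intro summable_add) (auto simp: summable_geometric)
    have "summable (\<lambda>k. d k x)"
    proof (rule summable_comparison_test'[OF s, of 0])
      fix k
      have "norm (d k x) * 1 \<le> 2 ^ k * (norm (d k x))\<^sup>2 + (1/2) ^ k"
      proof -
        define a where "a = (2::real) ^ k" have a: "a > 0" "(1/2) ^ k = 1 / a" by (auto simp: a_def power_one_over)
        \<comment> \<open>Expanding gives a d <= a^2 d^2 + 1; division by a = 2^k bounds the
          increment by two summable terms.\<close>
        have "0 \<le> (a * norm (d k x) - 1)\<^sup>2 + a * norm (d k x)" using a by simp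
        then have "a * norm (d k x) \<le> a * (a * (norm (d k x))\<^sup>2 + 1 / a)"
          using a(1) by (simp add: power2_eq_square algebra_simps)
        then show ?thesis using a(1) unfolding a(2) a_def[symmetric] by simp
      qed
      then show "norm (d k x) \<le> 2 ^ k * (norm (d k x))\<^sup>2 + (1/2) ^ k" by simp
    qed
    then have "convergent (\<lambda>n. f 0 x + (\<Sum>k<n. d k x))"
      by (intro convergent_add) (auto simp: summable_iff_convergent convergent_const)
    also have "(\<lambda>n. f 0 x + (\<Sum>k<n. d k x)) = (\<lambda>k. f k x)"
      using sum_lessThan_telescope[of "\<lambda>k. f k x"] by (simp add: d_def)
    finally show "convergent (\<lambda>k. f k x)" .
  qed
qed

text \<open>Riesz-Fischer: a rapidly convergent subsequence has a pointwise limit almost everywhere,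
  and Fatou's lemma applied to its differences shows that this limit is also the norm limit.\<close>

lemma spinor_Cauchy_convergent:
  fixes X :: "nat \<Rightarrow> spinor"
  assumes C: "Cauchy X"
  shows "convergent X"
proof -
  have "\<exists>N. \<forall>m\<ge>N. \<forall>n\<ge>N. dist (X m) (X n) < (1/2) ^ k" for k :: nat
    using C unfolding Cauchy_def by simp
  then obtain N where N: "\<And>k m n. m \<ge> N k \<Longrightarrow> n \<ge> N k \<Longrightarrow> dist (X m) (X n) < (1/2) ^ k"
    by metis
  \<comment> \<open>The partial sum dominates \<open>N k\<close>, and the added \<open>k\<close>
    makes the selection strictly increasing.\<close>
  define r where "r k = (\<Sum>j\<le>k. N j) + k" for k
  have r: "strict_mono r" by (rule strict_monoI_Suc) (simp add: r_def)
  have rN: "r k \<ge> N k" for k unfolding r_def by (simp add: member_le_sum trans_le_add1)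
  define f where "f k = rep_spinor (X (r k))" for k
  have f: "sq_int (f k)" and Xf: "X (r k) = ket (f k)" for k by (simp_all add: f_def sq_int_rep)
  have [measurable]: "f k \<in> borel_measurable lborel" for k using f by (simp add: sq_int_def)
  have "norm (ket (f (Suc k)) - ket (f k)) \<le> (1/2) ^ k" for k
    using N[of k "r (Suc k)" "r k"] rN[of k] strict_monoD[OF r, of k "Suc k"]
    by (simp add: Xf[symmetric] dist_norm)
  from spinor_fast_Cauchy_AE_convergent[OF this f]
  have conv: "AE x in lborel. convergent (\<lambda>k. f k x)" .
  \<comment> \<open>Where the sequence diverges \<open>lim\<close> is some unspecified value, but
    this happens only on a null set.\<close>
  define F where "F x = lim (\<lambda>k. f k x)" for x
  have [measurable]: "F \<in> borel_measurable lborel"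
    unfolding F_def by (rule borel_measurable_lim_metric) simp
  have bound: "sq_int (\<lambda>x. F x - f m x) \<and> (norm (ket (\<lambda>x. F x - f m x)))\<^sup>2 \<le> ((1/2) ^ m)\<^sup>2" for m
  proof -
    have "(\<integral>\<^sup>+x. ennreal ((norm (F x - f m x))\<^sup>2) \<partial>lborel)
        = (\<integral>\<^sup>+x. liminf (\<lambda>k. ennreal ((norm (f k x - f m x))\<^sup>2)) \<partial>lborel)"
    proof (rule nn_integral_cong_AE, use conv in eventually_elim)
      fix x assume "convergent (\<lambda>k. f k x)"
      then have "(\<lambda>k. f k x) \<longlonglongrightarrow> F x" by (simp add: F_def convergent_LIMSEQ_iff)
      then have "(\<lambda>k. ennreal ((norm (f k x - f m x))\<^sup>2)) \<longlonglongrightarrow> ennreal ((norm (F x - f m x))\<^sup>2)"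
        by (intro tendsto_ennrealI tendsto_intros)
      then show "ennreal ((norm (F x - f m x))\<^sup>2) = liminf (\<lambda>k. ennreal ((norm (f k x - f m x))\<^sup>2))"
        by (intro lim_imp_Liminf[symmetric]) auto
    qed
    also have "\<dots> \<le> liminf (\<lambda>k. \<integral>\<^sup>+x. ennreal ((norm (f k x - f m x))\<^sup>2) \<partial>lborel)"
      by (rule nn_integral_liminf) simp
    also have "\<dots> \<le> ennreal (((1/2) ^ m)\<^sup>2)"
    proof (rule Liminf_le)
      have "\<forall>\<^sub>F k in sequentially. m \<le> k" by (rule eventually_ge_at_top)
      then show "\<forall>\<^sub>F k in sequentially. (\<integral>\<^sup>+x. ennreal ((norm (f k x - f m x))\<^sup>2) \<partial>lborel)
          \<le> ennreal (((1/2) ^ m)\<^sup>2)"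
      proof (rule eventually_mono)
        fix k assume "m \<le> k"
        then have "dist (X (r k)) (X (r m)) < (1/2) ^ m"
          using rN[of m] strict_mono_mono[OF r, THEN monoD, of m k] by (intro N) auto
        then show "(\<integral>\<^sup>+x. ennreal ((norm (f k x - f m x))\<^sup>2) \<partial>lborel) \<le> ennreal (((1/2) ^ m)\<^sup>2)"
          using f by (auto simp: nn_integral_norm_ket sq_int_diff ket_diff Xf dist_norm
              intro!: ennreal_leI power_mono)
      qed
    qed simp
    finally show ?thesis
      using square_integrable_nn_integral[of "\<lambda>x. F x - f m x" "((1/2) ^ m)\<^sup>2"] by auto
  qed
  have "sq_int (\<lambda>x. (F x - f 0 x) + f 0 x)" using bound f by (intro sq_int_add) auto
  then have F: "sq_int F" by simp
  have "(\<lambda>k. X (r k)) \<longlonglongrightarrow> ket F"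
  proof (rule LIMSEQ_I)
    fix e :: real assume "e > 0"
    then obtain n where n: "(1/2) ^ n < e" using real_arch_pow_inv[of e "1/2"] by auto
    show "\<exists>no. \<forall>k\<ge>no. norm (X (r k) - ket F) < e"
    proof (intro exI[of _ n] allI impI)
      fix k assume "n \<le> k"
      then have "(1/2::real) ^ k \<le> (1/2) ^ n" by (intro power_decreasing) auto
      moreover have "norm (ket F - X (r k)) \<le> (1/2) ^ k"
        using bound[of k] f F by (simp add: ket_diff Xf power2_le_iff_abs_le)
      ultimately show "norm (X (r k) - ket F) < e" using n by (simp only: norm_minus_commute[of "X (r k)"])
    qed
  qed
  then show ?thesis
    using C r Cauchy_converges_subseq[of X r "ket F"] by (auto simp: convergent_def o_def)
qed

instance spinor :: banach
  by standard (rule spinor_Cauchy_convergent)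

subsection \<open>Unitary groups\<close>

lemma unitaryD:
  assumes "unitary T"
  shows "clinear T" "norm (T \<psi>) = norm \<psi>" "surj T" "bounded_linear T"
  using assms by (auto simp: unitary_def intro!: bounded_linear_clinear[of _ 1])

lemma unitary_inner:
  assumes "unitary T"
  shows "T \<phi> \<bullet> T \<psi> = \<phi> \<bullet> \<psi>"
proof -
  have "(norm (T (\<phi> + \<psi>)))\<^sup>2 = (norm (\<phi> + \<psi>))\<^sup>2" "(norm (T \<phi>))\<^sup>2 = (norm \<phi>)\<^sup>2" "(norm (T \<psi>))\<^sup>2 = (norm \<psi>)\<^sup>2"
    using unitaryD(2)[OF assms] by auto
  then show ?thesis
    unfolding clinearD[OF unitaryD(1)[OF assms]] power2_norm_eq_inner
    by (simp add: inner_add_left inner_add_right inner_commute)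
qed

lemma unitary_cinner:
  assumes "unitary T"
  shows "cinner (T \<phi>) (T \<psi>) = cinner \<phi> \<psi>"
  unfolding cinner_eq clinearD(2)[OF unitaryD(1)[OF assms], symmetric] unitary_inner[OF assms] ..

text \<open>Conservation of the norm for a velocity orthogonal to the position; it yields uniqueness
  for both unitary groups and interaction-picture equations.\<close>

lemma norm_constant:
  fixes x :: "real \<Rightarrow> 'a :: real_inner"
  assumes "\<And>t. (x has_vector_derivative x' t) (at t)" "\<And>t. x t \<bullet> x' t = 0"
  shows "norm (x t) = norm (x 0)"
proof -
  have "((\<lambda>t. x t \<bullet> x t) has_vector_derivative 0) (at t)" for t
    using bounded_bilinear.has_vector_derivative[OF bounded_bilinear_inner assms(1) assms(1), of t] assms(2)[of t]
    by (simp add: inner_commute)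
  then have "\<forall>t. ((\<lambda>t. x t \<bullet> x t) has_real_derivative 0) (at t)"
    by (simp add: has_real_derivative_iff_has_vector_derivative)
  from DERIV_isconst_all[OF this, of t 0] show ?thesis by (simp add: norm_eq_sqrt_inner)
qed

text \<open>Strong continuity does not give continuity in operator norm. Isometry compensates:
  moving the argument costs exactly its displacement, uniformly in time.\<close>

lemma continuous_on_isometries:
  fixes W :: "real \<Rightarrow> spinor \<Rightarrow> spinor" and g :: "real \<Rightarrow> real"
  assumes W: "\<And>\<psi>. continuous_on UNIV (\<lambda>t. W t \<psi>)" "\<And>t. unitary (W t)"
    and f: "continuous_on UNIV f" and g: "continuous_on UNIV g"
  shows "continuous_on UNIV (\<lambda>t. W (g t) (f t))"
  unfolding continuous_on_def
proof
  fix a :: real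
  have "((\<lambda>t. W (g t) (f t) - W (g a) (f a)) \<longlongrightarrow> 0) (at a)"
  proof (rule tendsto_norm_zero_cancel, rule tendsto_sandwich[OF _ _ tendsto_const])
    show "\<forall>\<^sub>F t in at a. norm (W (g t) (f t) - W (g a) (f a))
        \<le> norm (f t - f a) + norm (W (g t) (f a) - W (g a) (f a))"
    proof (intro always_eventually allI)
      fix t
      have "W (g t) (f t) - W (g a) (f a) = W (g t) (f t - f a) + (W (g t) (f a) - W (g a) (f a))"
        by (simp add: clinearD(5)[OF unitaryD(1)[OF W(2)]])
      then show "norm (W (g t) (f t) - W (g a) (f a)) \<le> norm (f t - f a) + norm (W (g t) (f a) - W (g a) (f a))"
        by (metis norm_triangle_ineq unitaryD(2)[OF W(2)])
    qed
    have f': "(f \<longlongrightarrow> f a) (at a)" and "((\<lambda>t. W (g t) (f a)) \<longlongrightarrow> W (g a) (f a)) (at a)"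
      using f continuous_on_compose2[OF W(1) g, of "f a"] by (auto simp: continuous_on_def)
    then have "((\<lambda>t. norm (f t - f a) + norm (W (g t) (f a) - W (g a) (f a)))
        \<longlongrightarrow> norm (f a - f a) + norm (W (g a) (f a) - W (g a) (f a))) (at a)"
      by (intro tendsto_intros)
    then show "((\<lambda>t. norm (f t - f a) + norm (W (g t) (f a) - W (g a) (f a))) \<longlongrightarrow> 0) (at a)" by simp
  qed simp
  then show "((\<lambda>t. W (g t) (f t)) \<longlongrightarrow> W (g a) (f a)) (at a within UNIV)"
    by (simp add: LIM_zero_iff)
qed

lemma generatesD:
  assumes "generates A U"
  shows "unitary (U t)" "U 0 \<psi> = \<psi>" "U (s + t) \<psi> = U s (U t \<psi>)" "continuous_on UNIV (\<lambda>t. U t \<psi>)"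
    "(\<psi>, \<eta>) \<in> A \<longleftrightarrow> ((\<lambda>t. U t \<psi>) has_vector_derivative ((- \<i>) *\<^sub>C \<eta>)) (at 0)"
  using assms by (auto simp: generates_def)

lemma generates_inverse:
  assumes "generates A U"
  shows "U (- t) (U t \<psi>) = \<psi>" "U t (U (- t) \<psi>) = \<psi>"
  using generatesD(3)[OF assms, of "-t" t \<psi>] generatesD(3)[OF assms, of t "-t" \<psi>]
    generatesD(2)[OF assms] by simp_all

text \<open>The generator is defined by the derivative at 0 only; the group law and continuity of
  \<open>U t\<close> transport it to every time.\<close>

lemma generates_deriv:
  assumes U: "generates A U" and A: "(\<psi>, \<eta>) \<in> A"
  shows "((\<lambda>t. U t \<psi>) has_vector_derivative ((- \<i>) *\<^sub>C U t \<eta>)) (at t)"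
proof -
  have "((\<lambda>s. U t (U s \<psi>)) has_vector_derivative U t ((- \<i>) *\<^sub>C \<eta>)) (at 0)"
    using A unfolding generatesD(5)[OF U]
    by (rule bounded_linear.has_vector_derivative[OF unitaryD(4)[OF generatesD(1)[OF U]]])
  then have "((\<lambda>s. U (t + s) \<psi>) has_vector_derivative U t ((- \<i>) *\<^sub>C \<eta>)) (at 0)"
    by (simp add: generatesD(3)[OF U])
  then have "((\<lambda>s. U (t + s) \<psi>) has_vector_derivative U t ((- \<i>) *\<^sub>C \<eta>)) (at (t - t))"
    by simp
  moreover have "((\<lambda>s. s - t) has_vector_derivative 1) (at t)"
    by (auto intro!: derivative_eq_intros)
  ultimately have "((\<lambda>s. U (t + (s - t)) \<psi>) has_vector_derivative (1 *\<^sub>R U t ((- \<i>) *\<^sub>C \<eta>))) (at t)"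
    using vector_diff_chain_at[of "\<lambda>s. s - t" 1 t "\<lambda>s. U (t + s) \<psi>"] by (simp add: o_def)
  then show ?thesis
    by (simp only: clinearD(2)[OF unitaryD(1)[OF generatesD(1)[OF U]]] scaleR_one) simp
qed

lemma generates_invariant:
  assumes U: "generates A U" and A: "(\<psi>, \<eta>) \<in> A"
  shows "(U t \<psi>, U t \<eta>) \<in> A"
proof -
  have "((\<lambda>s. U t (U s \<psi>)) has_vector_derivative U t ((- \<i>) *\<^sub>C \<eta>)) (at 0)"
    using A unfolding generatesD(5)[OF U]
    by (rule bounded_linear.has_vector_derivative[OF unitaryD(4)[OF generatesD(1)[OF U]]])
  also have "(\<lambda>s. U t (U s \<psi>)) = (\<lambda>s. U s (U t \<psi>))"
    using generatesD(3)[OF U, of t] generatesD(3)[OF U, of _ t] by (auto simp: add.commute)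
  finally show ?thesis
    unfolding generatesD(5)[OF U] clinearD(2)[OF unitaryD(1)[OF generatesD(1)[OF U]]] .
qed

lemma generates_skew:
  assumes U: "generates A U" and A: "(\<psi>, \<eta>) \<in> A"
  shows "\<psi> \<bullet> ((- \<i>) *\<^sub>C \<eta>) = 0"
proof -
  have "((\<lambda>t. U t \<psi> \<bullet> U t \<psi>) has_vector_derivative
      (U 0 \<psi> \<bullet> ((- \<i>) *\<^sub>C U 0 \<eta>) + ((- \<i>) *\<^sub>C U 0 \<eta>) \<bullet> U 0 \<psi>)) (at 0)"
    by (intro bounded_bilinear.has_vector_derivative[OF bounded_bilinear_inner] generates_deriv[OF U A])
  moreover have "((\<lambda>t. U t \<psi> \<bullet> U t \<psi>) has_vector_derivative 0) (at 0)"
    by (simp add: unitary_inner[OF generatesD(1)[OF U]])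
  ultimately have "U 0 \<psi> \<bullet> ((- \<i>) *\<^sub>C U 0 \<eta>) + ((- \<i>) *\<^sub>C U 0 \<eta>) \<bullet> U 0 \<psi> = 0"
    by (rule vector_derivative_unique_at)
  then show ?thesis by (simp add: generatesD(2)[OF U] inner_commute)
qed

lemma generates_diff:
  assumes U: "generates A U" and A: "(\<psi>, \<eta>) \<in> A" "(\<psi>', \<eta>') \<in> A"
  shows "(\<psi> - \<psi>', \<eta> - \<eta>') \<in> A"
  using A unfolding generatesD(5)[OF U] clinearD(5)[OF unitaryD(1)[OF generatesD(1)[OF U]]]
  by (auto simp: scaleC_diff_right dest: has_vector_derivative_diff)

lemma unitary_eq_on_dense:
  assumes "unitary S" "unitary T" "closure D = UNIV" "\<And>\<psi>. \<psi> \<in> D \<Longrightarrow> S \<psi> = T \<psi>"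
  shows "S = T"
proof
  fix \<psi>
  have S: "continuous_on UNIV S" and T: "continuous_on UNIV T"
    using linear_continuous_on[OF unitaryD(4)] assms by auto
  show "S \<psi> = T \<psi>"
  proof (rule continuous_constant_on_closure[where S = D and a = 0 and f = "\<lambda>x. S x - T x", THEN eq_iff_diff_eq_0[THEN iffD2]])
    show "continuous_on (closure D) (\<lambda>x. S x - T x)"
      unfolding assms(3) by (intro continuous_on_diff S T)
  qed (use assms in auto)
qed

text \<open>Along a domain vector the difference of the two orbits stays in \<open>A\<close>, where
  generators are skew, so its norm keeps its initial value 0; density finishes. This is what gives
  the description in \<open>propagator\<close> a value.\<close>

lemma generates_unique:
  assumes U: "generates A U" and V: "generates A V" and dense: "closure (Domain A) = UNIV"
  shows "U = V"
proof
  fix t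
  show "U t = V t"
  proof (rule unitary_eq_on_dense[OF generatesD(1)[OF U] generatesD(1)[OF V] dense])
    fix \<psi> assume "\<psi> \<in> Domain A"
    then obtain \<eta> where A: "(\<psi>, \<eta>) \<in> A" by auto
    have "norm (U t \<psi> - V t \<psi>) = norm (U 0 \<psi> - V 0 \<psi>)"
    proof (rule norm_constant[where x' = "\<lambda>t. (- \<i>) *\<^sub>C (U t \<eta> - V t \<eta>)"])
      fix t
      show "((\<lambda>t. U t \<psi> - V t \<psi>) has_vector_derivative (- \<i>) *\<^sub>C (U t \<eta> - V t \<eta>)) (at t)"
        unfolding scaleC_diff_right
        by (intro has_vector_derivative_diff generates_deriv[OF U A] generates_deriv[OF V A])
      show "(U t \<psi> - V t \<psi>) \<bullet> ((- \<i>) *\<^sub>C (U t \<eta> - V t \<eta>)) = 0"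
        by (intro generates_skew[OF U] generates_diff[OF U] generates_invariant[OF U A] generates_invariant[OF V A])
    qed
    then show "U t \<psi> = V t \<psi>" using generatesD(2)[OF U] generatesD(2)[OF V] by simp
  qed
qed

lemma propagator_eq:
  assumes "generates A U" "closure (Domain A) = UNIV"
  shows "propagator A = U"
  unfolding propagator_def using assms generates_unique by blast

subsection \<open>Bounded perturbations\<close>

lemma antiderivative_real:
  fixes f :: "real \<Rightarrow> 'a :: banach"
  assumes f: "continuous_on UNIV f"
  obtains F where "F 0 = c" "\<And>t. (F has_vector_derivative f t) (at t)"
proof -
  \<comment> \<open>One of the two intervals is always empty or a point, so this is the integral
    from 0 to t with sign.\<close>
  define F where "F t = c + (integral {0..t} f - integral {t..0} f)" for t
  have F0: "F 0 = c" by (simp add: F_def)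
  have deriv: "(F has_vector_derivative f t) (at t)" for t
  proof -
  define R where "R = \<bar>t\<bar> + 1"
  have int: "f integrable_on {a..b}" for a b
    by (intro integrable_continuous_interval continuous_on_subset[OF f]) auto
  have F: "F s = c + (integral {-R..s} f - integral {-R..0} f)" if "s \<in> {-R..R}" for s
  proof (cases "0 \<le> s")
    case True
    then have "integral {-R..0} f + integral {0..s} f = integral {-R..s} f"
      using that by (intro Henstock_Kurzweil_Integration.integral_combine int) (auto simp: R_def)
    moreover have "integral {s..0} f = 0" using True by (cases "s = 0") auto
    ultimately show ?thesis unfolding F_def by (metis add_diff_cancel_left' diff_zero)
  next
    case False
    then have "integral {-R..s} f + integral {s..0} f = integral {-R..0} f"
      using that by (intro Henstock_Kurzweil_Integration.integral_combine int) (auto simp: R_def)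
    then show ?thesis using False by (simp add: F_def algebra_simps)
  qed
  have "((\<lambda>s. integral {-R..s} f) has_vector_derivative f t) (at t within {-R..R})"
    by (intro integral_has_vector_derivative continuous_on_subset[OF f]) (auto simp: R_def)
  then have "((\<lambda>s. c + (integral {-R..s} f - integral {-R..0} f)) has_vector_derivative (0 + (f t - 0))) (at t within {-R..R})"
    by (intro has_vector_derivative_add has_vector_derivative_diff has_vector_derivative_const)
  then have "(F has_vector_derivative f t) (at t within {-R..R})"
    by (intro has_vector_derivative_transform[where g = F and f = "\<lambda>s. c + (integral {-R..s} f - integral {-R..0} f)"])
      (use F in \<open>auto simp: R_def\<close>)
  moreover have "at t within {-R..R} = at t"
    by (rule at_within_interior) (auto simp: R_def)
  ultimately show ?thesis by simp
  qed
  show thesis by (rule that[OF F0 deriv])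
qed

text \<open>Each integration from 0 gains |t| / (n + 1), which builds up the factorials of the
  exponential series. Negative times reduce to positive ones by reflection.\<close>

lemma norm_antiderivative_le:
  fixes F :: "real \<Rightarrow> 'a :: real_normed_vector"
  assumes F: "\<And>t. (F has_vector_derivative f t) (at t)" and F0: "F 0 = 0"
    and le: "\<And>t. norm (f t) \<le> c * \<bar>t\<bar> ^ n"
  shows "norm (F t) \<le> c * \<bar>t\<bar> ^ Suc n / real (Suc n)"
proof -
  have pos: "norm (G t) \<le> c * t ^ Suc n / real (Suc n)"
    if "t > 0" and G: "\<And>t. (G has_vector_derivative g t) (at t)" "G 0 = 0" "\<And>t. norm (g t) \<le> c * \<bar>t\<bar> ^ n"
    for t and G g :: "real \<Rightarrow> 'a"
  proof -
    have "norm (G t - G 0) \<le> c * t ^ Suc n / real (Suc n) - c * 0 ^ Suc n / real (Suc n)"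
    proof (rule differentiable_bound_general[OF \<open>t > 0\<close>])
      show "continuous_on {0..t} G"
        using G(1) has_vector_derivative_continuous by (intro continuous_at_imp_continuous_on) blast
      show "((\<lambda>t. c * t ^ Suc n / real (Suc n)) has_vector_derivative c * s ^ n) (at s)" for s
        unfolding has_real_derivative_iff_has_vector_derivative[symmetric]
        by (rule derivative_eq_intros refl | simp)+
      show "norm (g s) \<le> c * s ^ n" if "0 < s" for s using G(3)[of s] that by simp
    qed (intro continuous_intros | simp add: G)+
    then show ?thesis by (simp add: G)
  qed
  show ?thesis
  proof (cases "t = 0")
    case False
    show ?thesis
    proof (cases "t > 0")
      case True
      then show ?thesis using pos[OF _ F F0 le] by simp
    next
      case f: False
      have "((\<lambda>s. F (- s)) has_vector_derivative - f (- s)) (at s)" for s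
      proof -
        have "(uminus has_vector_derivative - 1) (at s)" by (auto intro!: derivative_eq_intros)
        from vector_diff_chain_at[OF this F] show ?thesis by (simp add: o_def)
      qed
      from pos[of "-t", OF _ this] show ?thesis
        using f False F0 le[of "- _"] by simp
    qed
  qed (simp add: F0)
qed

text \<open>Picard iteration on the whole line. Continuity is assumed for the composite
  \<open>D t (f t)\<close> because the interaction-picture operators are only strongly continuous.
  The increments are dominated by the exponential series in b |t|.\<close>

lemma linear_ode_solution:
  fixes D :: "real \<Rightarrow> 'a :: banach \<Rightarrow> 'a"
  assumes cont: "\<And>f. continuous_on UNIV f \<Longrightarrow> continuous_on UNIV (\<lambda>t. D t (f t))"
    and diff: "\<And>t x y. D t (x - y) = D t x - D t y"
    and bound: "\<And>t x. norm (D t x) \<le> b * norm x" and "0 \<le> b"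
  obtains v where "v 0 = x" "\<And>t. (v has_vector_derivative D t (v t)) (at t)"
proof -
  define next_it where "next_it f = (SOME F. F 0 = x \<and> (\<forall>t. (F has_vector_derivative D t (f t)) (at t)))"
    for f :: "real \<Rightarrow> 'a"
  have next_it: "next_it f 0 = x \<and> (\<forall>t. (next_it f has_vector_derivative D t (f t)) (at t))"
    if f: "continuous_on UNIV f" for f
  proof -
    obtain F where "F 0 = x" "\<And>t. (F has_vector_derivative D t (f t)) (at t)"
      using antiderivative_real[OF cont[OF f]] by blast
    then have "\<exists>F. F 0 = x \<and> (\<forall>t. (F has_vector_derivative D t (f t)) (at t))" by blast
    then show ?thesis unfolding next_it_def by (rule someI_ex)
  qed
  define s where "s n = (next_it ^^ n) (\<lambda>_. x)" for n
  have s_cont: "continuous_on UNIV (s n)" for n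
  proof (induction n)
    case (Suc n)
    then show ?case
      using next_it[OF Suc] has_vector_derivative_continuous
      by (intro continuous_at_imp_continuous_on ballI) (simp add: s_def, blast)
  qed (simp add: s_def)
  have s_deriv: "(s (Suc n) has_vector_derivative D t (s n t)) (at t)" for n t
    using next_it[OF s_cont] by (simp add: s_def)
  have s0: "s n 0 = x" for n
    using next_it[OF s_cont] by (cases n) (auto simp: s_def)
  have step: "norm (s (Suc n) t - s n t) \<le> (norm x * b ^ Suc n / fact (Suc n)) * \<bar>t\<bar> ^ Suc n" for n t
  proof (induction n arbitrary: t)
    case 0
    have "((\<lambda>t. s (Suc 0) t - x) has_vector_derivative (D t x - 0)) (at t)" for t
      using s_deriv[of 0 t] by (intro has_vector_derivative_diff) (auto simp: s_def)
    from norm_antiderivative_le[OF this, of "b * norm x" 0 t] bound[of _ x]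
    have "norm (s (Suc 0) t - x) \<le> b * norm x * \<bar>t\<bar>" by (simp add: s0)
    moreover have "s 0 t = x" by (simp add: s_def)
    ultimately show ?case by (simp add: mult.commute)
  next
    case (Suc n)
    have "norm (s (Suc (Suc n)) t - s (Suc n) t)
        \<le> b * (norm x * b ^ Suc n / fact (Suc n)) * \<bar>t\<bar> ^ Suc (Suc n) / real (Suc (Suc n))"
    proof (rule norm_antiderivative_le)
      fix t
      show "((\<lambda>t. s (Suc (Suc n)) t - s (Suc n) t) has_vector_derivative D t (s (Suc n) t - s n t)) (at t)"
        unfolding diff by (intro has_vector_derivative_diff s_deriv)
      have "norm (D t (s (Suc n) t - s n t)) \<le> b * norm (s (Suc n) t - s n t)" by (rule bound)
      also have "\<dots> \<le> b * ((norm x * b ^ Suc n / fact (Suc n)) * \<bar>t\<bar> ^ Suc n)"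
        by (intro mult_left_mono Suc \<open>0 \<le> b\<close>)
      finally show "norm (D t (s (Suc n) t - s n t)) \<le> b * (norm x * b ^ Suc n / fact (Suc n)) * \<bar>t\<bar> ^ Suc n"
        by (simp only: mult.assoc)
    qed (simp add: s0)
    also have "\<dots> = (norm x * b ^ Suc (Suc n) / fact (Suc (Suc n))) * \<bar>t\<bar> ^ Suc (Suc n)"
      by (simp add: fact_Suc[of "Suc n"] field_simps del: fact_Suc)
    finally show ?case .
  qed
  define v where "v t = x + (\<Sum>n. s (Suc n) t - s n t)" for t
  have unif: "uniform_limit {-R..R} s v sequentially" if "R > 0" for R
  proof -
    have "uniform_limit {-R..R} (\<lambda>n t. \<Sum>i<n. s (Suc i) t - s i t) (\<lambda>t. \<Sum>i. s (Suc i) t - s i t) sequentially"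
    proof (rule Weierstrass_m_test)
      fix n t assume t: "t \<in> {-R..R}"
      have "norm (s (Suc n) t - s n t) \<le> (norm x * b ^ Suc n / fact (Suc n)) * \<bar>t\<bar> ^ Suc n" by (rule step)
      also have "\<dots> \<le> (norm x * b ^ Suc n / fact (Suc n)) * R ^ Suc n"
        using t \<open>0 \<le> b\<close> by (intro mult_left_mono power_mono) auto
      finally show "norm (s (Suc n) t - s n t) \<le> norm x * (inverse (fact (Suc n)) * (b * R) ^ Suc n)"
        by (simp add: field_simps power_mult_distrib)
    next
      have "summable (\<lambda>n. norm x * (inverse (fact n) * (b * R) ^ n))"
        by (intro summable_mult summable_exp)
      then show "summable (\<lambda>n. norm x * (inverse (fact (Suc n)) * (b * R) ^ Suc n))"
        by (subst summable_Suc_iff)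
    qed
    then have "uniform_limit {-R..R} (\<lambda>n t. x + (\<Sum>i<n. s (Suc i) t - s i t)) v sequentially"
      unfolding v_def by (intro uniform_limit_intros)
    moreover have "x + (\<Sum>i<n. s (Suc i) t - s i t) = s n t" for n t
      using sum_lessThan_telescope[of "\<lambda>i. s i t" n] by (simp add: s_def)
    ultimately show ?thesis by simp
  qed
  have "(v has_vector_derivative D t (v t)) (at t)" for t
  proof -
    define R where "R = \<bar>t\<bar> + 1"
    have R: "R > 0" by (simp add: R_def)
    have "\<exists>g. \<forall>t\<in>{-R..R}. (\<lambda>n. s (Suc n) t) \<longlonglongrightarrow> g t \<and>
        (g has_derivative (\<lambda>h. h *\<^sub>R D t (v t))) (at t within {-R..R})"
    proof (rule has_derivative_sequence)
      show "(s (Suc n) has_derivative (\<lambda>h. h *\<^sub>R D t (s n t))) (at t within {-R..R})" for n t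
        using s_deriv[of n t] has_vector_derivative_at_within unfolding has_vector_derivative_def
        by (blast intro: has_derivative_at_withinI)
      show "0 \<in> {-R..R}" "(\<lambda>n. s (Suc n) 0) \<longlonglongrightarrow> x" using R by (simp_all add: s0)
      fix e :: real assume "e > 0"
      \<comment> \<open>The shift by 1 covers the case \<open>b = 0\<close>.\<close>
      then have "e / (b + 1) > 0" using \<open>0 \<le> b\<close> by auto
      from uniform_limitD[OF unif[OF R] this]
      show "\<forall>\<^sub>F n in sequentially. \<forall>t\<in>{-R..R}. \<forall>h. norm (h *\<^sub>R D t (s n t) - h *\<^sub>R D t (v t)) \<le> e * norm h"
      proof (rule eventually_mono, intro ballI allI)
        fix n t and h :: real
        assume *: "\<forall>t\<in>{-R..R}. dist (s n t) (v t) < e / (b + 1)" and t: "t \<in> {-R..R}"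
        have "norm (D t (s n t - v t)) \<le> b * norm (s n t - v t)" by (rule bound)
        also have "\<dots> \<le> (b + 1) * (e / (b + 1))"
          using * t \<open>0 \<le> b\<close> by (intro mult_mono) (auto simp: dist_norm less_imp_le)
        also have "\<dots> = e" using \<open>0 \<le> b\<close> by simp
        finally have "\<bar>h\<bar> * norm (D t (s n t - v t)) \<le> \<bar>h\<bar> * e" by (intro mult_left_mono) auto
        then show "norm (h *\<^sub>R D t (s n t) - h *\<^sub>R D t (v t)) \<le> e * norm h"
          by (simp add: diff mult.commute flip: scaleR_diff_right)
      qed
    qed simp
    then obtain g where g: "\<And>t. t \<in> {-R..R} \<Longrightarrow> (\<lambda>n. s (Suc n) t) \<longlonglongrightarrow> g t"
        "\<And>t. t \<in> {-R..R} \<Longrightarrow> (g has_derivative (\<lambda>h. h *\<^sub>R D t (v t))) (at t within {-R..R})" by blast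
    have gv: "g t = v t" if "t \<in> {-R..R}" for t
      using g(1)[OF that] LIMSEQ_Suc[OF tendsto_uniform_limitI[OF unif[OF R] that]] LIMSEQ_unique by blast
    have t: "t \<in> {-R..R}" by (auto simp: R_def)
    have "(v has_vector_derivative D t (v t)) (at t within {-R..R})"
      using has_derivative_transform[OF t gv[symmetric] g(2)[OF t]] by (simp add: has_vector_derivative_def)
    moreover have "at t within {-R..R} = at t"
      by (rule at_within_interior) (auto simp: R_def)
    ultimately show ?thesis by simp
  qed
  moreover have "v 0 = x" by (simp add: v_def s0)
  ultimately show ?thesis using that by blast
qed

lemma has_vector_derivative_at_iff:
  "(f has_vector_derivative d) (at a) \<longleftrightarrow> ((\<lambda>t. (f t - f a) /\<^sub>R (t - a)) \<longlongrightarrow> d) (at a)"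
proof -
  have "(f has_vector_derivative d) (at a) \<longleftrightarrow> ((\<lambda>t. norm ((f t - f a) - (t - a) *\<^sub>R d) / norm (t - a)) \<longlongrightarrow> 0) (at a)"
    unfolding has_vector_derivative_def has_derivative_iff_norm by (simp add: bounded_linear_scaleR_left)
  also have "\<dots> \<longleftrightarrow> ((\<lambda>t. norm ((f t - f a) /\<^sub>R (t - a) - d)) \<longlongrightarrow> 0) (at a)"
  proof -
    have "norm ((f t - f a) - (t - a) *\<^sub>R d) / norm (t - a) = norm ((f t - f a) /\<^sub>R (t - a) - d)"
      if "t \<noteq> a" for t
    proof -
      have "(f t - f a) /\<^sub>R (t - a) - d = ((f t - f a) - (t - a) *\<^sub>R d) /\<^sub>R (t - a)"
        using that by (simp add: scaleR_diff_right)
      then show ?thesis by (simp add: divide_inverse mult.commute)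
    qed
    then have "\<forall>\<^sub>F t in at a. norm ((f t - f a) - (t - a) *\<^sub>R d) / norm (t - a) = norm ((f t - f a) /\<^sub>R (t - a) - d)"
      by (simp add: eventually_at_filter)
    then show ?thesis by (rule tendsto_cong)
  qed
  also have "\<dots> \<longleftrightarrow> ((\<lambda>t. (f t - f a) /\<^sub>R (t - a)) \<longlongrightarrow> d) (at a)"
    by (simp add: tendsto_norm_zero_iff LIM_zero_iff)
  finally show ?thesis .
qed

text \<open>Interaction picture: with U t = W t (v t), the equation for v involves only bounded
  operators and Picard iteration solves it. The stated graph shows that the domain is exactly that
  of \<open>A\<close>, as \<open>generates\<close> demands.\<close>

theorem generates_bounded_perturbation:
  assumes W: "generates A W" and B: "clinear B" "\<And>\<psi>. norm (B \<psi>) \<le> b * norm \<psi>"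
    and sym: "\<And>\<phi> \<psi>. cinner (B \<phi>) \<psi> = cinner \<phi> (B \<psi>)"
  obtains U where "generates {(\<psi>, \<eta> + B \<psi>) | \<psi> \<eta>. (\<psi>, \<eta>) \<in> A} U"
proof -
  note Wu = generatesD(1)[OF W]
  note Wl = clinearD[OF unitaryD(1)[OF Wu]]
  note Wc = generatesD(4)[OF W]
  note Bl = clinearD[OF B(1)]
  have b: "norm (B \<psi>) \<le> \<bar>b\<bar> * norm \<psi>" for \<psi>
    by (rule order_trans[OF B(2)]) (auto intro: mult_right_mono)
  have Bbl: "bounded_linear B" by (rule bounded_linear_clinear[OF B])
  have W_cont: "continuous_on UNIV (\<lambda>t. W t (f t))" if "continuous_on UNIV f" for f
    by (rule continuous_on_isometries[OF Wc Wu that continuous_on_id])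
  have W_cont': "continuous_on UNIV (\<lambda>t. W (- t) (f t))" if "continuous_on UNIV f" for f
    by (rule continuous_on_isometries[OF Wc Wu that]) (intro continuous_intros)
  \<comment> \<open>The perturbation seen from the frame moving with \<open>W\<close>; it is skew
    because \<open>B\<close> is symmetric and \<open>W\<close> unitary.\<close>
  define D where "D t \<psi> = (- \<i>) *\<^sub>C W (- t) (B (W t \<psi>))" for t \<psi>
  have D_cont: "continuous_on UNIV (\<lambda>t. D t (f t))" if f: "continuous_on UNIV f" for f
  proof -
    have "continuous_on UNIV (\<lambda>t. W t (f t))"
      by (rule W_cont[OF f])
    then have "continuous_on UNIV (\<lambda>t. B (W t (f t)))"
      by (rule bounded_linear.continuous_on[OF Bbl])
    then have "continuous_on UNIV (\<lambda>t. W (- t) (B (W t (f t))))"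
      by (rule W_cont')
    then show ?thesis unfolding D_def by (intro continuous_on_scaleC continuous_on_const)
  qed
  have D_add: "D t (\<phi> + \<psi>) = D t \<phi> + D t \<psi>" and D_diff: "D t (\<phi> - \<psi>) = D t \<phi> - D t \<psi>"
    and D_scale: "D t (c *\<^sub>C \<psi>) = c *\<^sub>C D t \<psi>" for t \<phi> \<psi> c
    by (simp_all add: D_def Wl Bl scaleC_add_right scaleC_diff_right mult.commute)
  have D_bound: "norm (D t \<psi>) \<le> \<bar>b\<bar> * norm \<psi>" for t \<psi>
    using b[of "W t \<psi>"] by (simp add: D_def unitaryD(2)[OF Wu])
  have "\<exists>v. v 0 = \<psi> \<and> (\<forall>t. (v has_vector_derivative D t (v t)) (at t))" for \<psi>
    using linear_ode_solution[of D "\<bar>b\<bar>" \<psi>, OF D_cont D_diff D_bound] by auto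
  then obtain v where v0: "\<And>\<psi>. v \<psi> 0 = \<psi>"
    and v: "\<And>\<psi> t. (v \<psi> has_vector_derivative D t (v \<psi> t)) (at t)" by metis
  have skew: "\<psi> \<bullet> D t \<psi> = 0" for \<psi> t
  proof -
    have "cinner \<psi> (W (- t) (B (W t \<psi>))) = cinner (W t \<psi>) (B (W t \<psi>))"
      using unitary_cinner[OF Wu, of t \<psi> "W (- t) (B (W t \<psi>))"] by (simp add: generates_inverse[OF W])
    also have "cnj \<dots> = \<dots>"
      by (subst sym[symmetric]) (rule cinner_commute[symmetric])
    finally have "cnj (cinner \<psi> (W (- t) (B (W t \<psi>)))) = cinner \<psi> (W (- t) (B (W t \<psi>)))"
      by (simp add: \<open>cinner \<psi> (W (- t) (B (W t \<psi>))) = cinner (W t \<psi>) (B (W t \<psi>))\<close>)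
    then have "Im (cinner \<psi> (W (- t) (B (W t \<psi>)))) = 0" by (simp add: complex_eq_iff)
    then show ?thesis unfolding D_def Re_cinner[symmetric] cinner_scaleC_right by simp
  qed
  have v_norm: "norm (u t) = norm (u 0)"
    if "\<And>t. (u has_vector_derivative D t (u t)) (at t)" for u t
    by (rule norm_constant[OF that]) (rule skew)
  have v_unique: "u t = w t" if u: "\<And>t. (u has_vector_derivative D t (u t)) (at t)"
    and w: "\<And>t. (w has_vector_derivative D t (w t)) (at t)" and "u 0 = w 0" for u w t
  proof -
    have "((\<lambda>t. u t - w t) has_vector_derivative D t (u t - w t)) (at t)" for t
      unfolding D_diff by (intro has_vector_derivative_diff u w)
    from v_norm[of "\<lambda>t. u t - w t", OF this, of t] show ?thesis using \<open>u 0 = w 0\<close> by simp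
  qed
  have v_add: "v (\<phi> + \<psi>) t = v \<phi> t + v \<psi> t" for \<phi> \<psi> t
    by (rule v_unique[OF v]) (auto simp: v0 D_add intro!: has_vector_derivative_add v)
  have v_scale: "v (c *\<^sub>C \<psi>) t = c *\<^sub>C v \<psi> t" for c \<psi> t
    by (rule v_unique[OF v]) (auto simp: v0 D_scale
        intro!: bounded_linear.has_vector_derivative[OF bounded_linear_scaleC] v)
  define U where "U t \<psi> = W t (v \<psi> t)" for t \<psi>
  have U0: "U 0 \<psi> = \<psi>" for \<psi> by (simp add: U_def v0 generatesD(2)[OF W])
  have U_group: "U (s + t) \<psi> = U s (U t \<psi>)" for s t \<psi>
  proof -
    \<comment> \<open>Both sides solve the same equation in \<open>s\<close> with value
      \<open>U t \<psi>\<close> at 0: conjugation by \<open>W t\<close> undoes the time shift in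
      \<open>D\<close>.\<close>
    have "v (U t \<psi>) s = W t (v \<psi> (s + t))"
    proof (rule v_unique[OF v, of "\<lambda>s. W t (v \<psi> (s + t))"])
      fix s
      have "((\<lambda>s. s + t) has_vector_derivative 1) (at s)"
        by (auto intro!: derivative_eq_intros)
      from vector_diff_chain_at[OF this v]
      have "((\<lambda>s. v \<psi> (s + t)) has_vector_derivative D (s + t) (v \<psi> (s + t))) (at s)"
        by (simp add: o_def)
      then have "((\<lambda>s. W t (v \<psi> (s + t))) has_vector_derivative W t (D (s + t) (v \<psi> (s + t)))) (at s)"
        by (rule bounded_linear.has_vector_derivative[OF unitaryD(4)[OF Wu]])
      also have "W t (D (s + t) (v \<psi> (s + t))) = D s (W t (v \<psi> (s + t)))"
        using generatesD(3)[OF W, of t "- (s + t)"] generatesD(3)[OF W, of s t]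
        by (simp add: D_def Wl)
      finally show "((\<lambda>s. W t (v \<psi> (s + t))) has_vector_derivative D s (W t (v \<psi> (s + t)))) (at s)" .
    qed (simp add: v0 U_def)
    then show ?thesis by (simp add: U_def generatesD(3)[OF W])
  qed
  have U_unitary: "unitary (U t)" for t
    unfolding unitary_def
  proof (intro conjI allI)
    show "clinear (U t)" by (simp add: clinear_def U_def v_add v_scale Wl)
    show "norm (U t \<psi>) = norm \<psi>" for \<psi>
      using v_norm[of "v \<psi>", OF v] by (simp add: U_def unitaryD(2)[OF Wu] v0)
    have "U t (U (- t) \<psi>) = \<psi>" for \<psi> using U_group[of t "-t" \<psi>] by (simp add: U0)
    then show "surj (U t)" by (metis surjI)
  qed
  have v_cont: "continuous_on UNIV (v \<psi>)" for \<psi>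
    using v has_vector_derivative_continuous by (intro continuous_at_imp_continuous_on) blast
  have U_cont: "continuous_on UNIV (\<lambda>t. U t \<psi>)" for \<psi>
    unfolding U_def by (rule W_cont[OF v_cont])
  have increment: "((\<lambda>t. W t (v \<psi> t - \<psi>)) has_vector_derivative (- \<i>) *\<^sub>C B \<psi>) (at 0)" for \<psi>
  proof -
    \<comment> \<open>The difference quotient is filled in at 0 by its limit. It is then continuous
      everywhere, so strong continuity of \<open>W\<close> suffices to pass to the limit in
      \<open>W t (q t)\<close>.\<close>
    define q where "q t = (if t = 0 then (- \<i>) *\<^sub>C B \<psi> else (v \<psi> t - \<psi>) /\<^sub>R t)" for t
    have "((\<lambda>t. (v \<psi> t - \<psi>) /\<^sub>R t) \<longlongrightarrow> (- \<i>) *\<^sub>C B \<psi>) (at 0)"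
      using v[of \<psi> 0] generatesD(2)[OF W] unfolding has_vector_derivative_at_iff by (simp add: v0 D_def)
    then have "(q \<longlongrightarrow> (- \<i>) *\<^sub>C B \<psi>) (at 0)"
      by (rule Lim_transform_eventually) (auto simp: q_def eventually_at_filter)
    then have q0: "(q \<longlongrightarrow> q 0) (at 0)" by (simp add: q_def[of 0])
    have "continuous_on UNIV q"
    proof (rule continuous_at_imp_continuous_on, rule ballI)
      fix t :: real
      show "isCont q t"
      proof (cases "t = 0")
        case False
        have "isCont (\<lambda>t. (v \<psi> t - \<psi>) /\<^sub>R t) t"
          using False v_cont[of \<psi>] by (intro continuous_intros) (auto simp: continuous_on_eq_continuous_at)
        moreover have "\<forall>\<^sub>F s in nhds t. q s = (v \<psi> s - \<psi>) /\<^sub>R s"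
          using t1_space_nhds[OF False] by (rule eventually_mono) (simp add: q_def)
        ultimately show ?thesis by (simp add: isCont_cong)
      qed (use q0 in \<open>simp add: continuous_at\<close>)
    qed
    then have "continuous_on UNIV (\<lambda>t. W t (q t))"
      by (rule W_cont)
    then have "((\<lambda>t. W t (q t)) \<longlongrightarrow> W 0 (q 0)) (at 0)"
      by (auto simp: continuous_on_def)
    then have "((\<lambda>t. W t (v \<psi> t - \<psi>) /\<^sub>R t) \<longlongrightarrow> (- \<i>) *\<^sub>C B \<psi>) (at 0)"
      unfolding generatesD(2)[OF W] q_def[of 0] if_P[OF refl]
      by (rule Lim_transform_eventually) (auto simp: q_def eventually_at_filter Wl(6))
    then show ?thesis
      unfolding has_vector_derivative_at_iff using generatesD(2)[OF W] by (simp add: v0)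
  qed
  \<comment> \<open>U t \<psi> is W t \<psi> plus the increment just differentiated, and the
    increment is differentiable for every \<open>\<psi>\<close>; so the two orbits are
    differentiable together.\<close>
  have "((\<lambda>t. U t \<psi>) has_vector_derivative (- \<i>) *\<^sub>C (\<eta> + B \<psi>)) (at 0)
      \<longleftrightarrow> ((\<lambda>t. W t \<psi>) has_vector_derivative (- \<i>) *\<^sub>C \<eta>) (at 0)" for \<psi> \<eta>
  proof
    assume *: "((\<lambda>t. W t \<psi>) has_vector_derivative (- \<i>) *\<^sub>C \<eta>) (at 0)"
    show "((\<lambda>t. U t \<psi>) has_vector_derivative (- \<i>) *\<^sub>C (\<eta> + B \<psi>)) (at 0)"
      using has_vector_derivative_add[OF * increment[of \<psi>]]
      by (simp only: U_def Wl(5) scaleC_add_right) simp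
  next
    assume *: "((\<lambda>t. U t \<psi>) has_vector_derivative (- \<i>) *\<^sub>C (\<eta> + B \<psi>)) (at 0)"
    show "((\<lambda>t. W t \<psi>) has_vector_derivative (- \<i>) *\<^sub>C \<eta>) (at 0)"
      using has_vector_derivative_diff[OF * increment[of \<psi>]]
      by (simp only: U_def Wl(5) scaleC_add_right) simp
  qed
  note deriv_iff = this
  have "generates {(\<psi>, \<eta> + B \<psi>) | \<psi> \<eta>. (\<psi>, \<eta>) \<in> A} U"
    unfolding generates_def
  proof (intro conjI allI U_unitary U_cont)
    show "U 0 = id" "U (s + t) = U s \<circ> U t" for s t by (auto simp: U0 U_group)
    have "(\<exists>\<eta>'. \<eta> = \<eta>' + B \<psi> \<and> (\<psi>, \<eta>') \<in> A)
        \<longleftrightarrow> ((\<lambda>t. U t \<psi>) has_vector_derivative (- \<i>) *\<^sub>C \<eta>) (at 0)" for \<psi> \<eta>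
    proof -
      have "(\<exists>\<eta>'. \<eta> = \<eta>' + B \<psi> \<and> (\<psi>, \<eta>') \<in> A) \<longleftrightarrow> (\<psi>, \<eta> - B \<psi>) \<in> A"
        by (metis add_diff_cancel diff_add_cancel)
      then show ?thesis using deriv_iff[of \<psi> "\<eta> - B \<psi>"] by (simp add: generatesD(5)[OF W])
    qed
    then show "{(\<psi>, \<eta> + B \<psi>) | \<psi> \<eta>. (\<psi>, \<eta>) \<in> A} =
        {(\<psi>, \<eta>). ((\<lambda>t. U t \<psi>) has_vector_derivative (- \<i>) *\<^sub>C \<eta>) (at 0)}"
      by auto
  qed
  then show ?thesis by (rule that)
qed

subsection \<open>Diagonal operators\<close>

locale orthonormal_basis =
  fixes e :: "nat \<Rightarrow> spinor"
  assumes orthonormal: "cinner (e i) (e j) = (if i = j then 1 else 0)"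
    and total: "(\<And>k. cinner (e k) \<psi> = 0) \<Longrightarrow> \<psi> = 0"
begin

lemma coeff_eqI: "(\<And>k. cinner (e k) \<phi> = cinner (e k) \<psi>) \<Longrightarrow> \<phi> = \<psi>"
  using total[of "\<phi> - \<psi>"] by (simp add: cinner_diff_right)

lemma coeff_sum: "finite I \<Longrightarrow> cinner (e j) (\<Sum>k\<in>I. c k *\<^sub>C e k) = (if j \<in> I then c j else 0)"
  by (simp add: cinner_sum_right orthonormal if_distrib cong: if_cong)

lemma norm_sum: "finite I \<Longrightarrow> (norm (\<Sum>k\<in>I. c k *\<^sub>C e k))\<^sup>2 = (\<Sum>k\<in>I. (cmod (c k))\<^sup>2)"
proof -
  assume I: "finite I"
  have "complex_of_real ((norm (\<Sum>k\<in>I. c k *\<^sub>C e k))\<^sup>2) = (\<Sum>j\<in>I. cnj (c j) * c j)"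
    unfolding cinner_self[symmetric] cinner_sum_left[of _ I] using I by (simp add: coeff_sum)
  also have "\<dots> = complex_of_real (\<Sum>j\<in>I. (cmod (c j))\<^sup>2)"
    unfolding of_real_sum by (intro sum.cong refl) (simp only: complex_norm_square mult.commute)
  finally show ?thesis by (simp only: of_real_eq_iff)
qed

lemma riesz_fischer:
  assumes "summable (\<lambda>k. (cmod (a k))\<^sup>2)"
  obtains \<psi> where "(\<lambda>k. a k *\<^sub>C e k) sums \<psi>" "\<And>k. cinner (e k) \<psi> = a k"
proof -
  have "summable (\<lambda>k. a k *\<^sub>C e k)"
    unfolding summable_Cauchy
  proof (intro allI impI)
    fix r :: real assume "r > 0"
    then have "r\<^sup>2 > 0" by simp
    then obtain N where N: "\<And>m n. m \<ge> N \<Longrightarrow> norm (\<Sum>k=m..<n. (cmod (a k))\<^sup>2) < r\<^sup>2"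
      using assms unfolding summable_Cauchy by meson
    show "\<exists>N. \<forall>m\<ge>N. \<forall>n. norm (\<Sum>k=m..<n. a k *\<^sub>C e k) < r"
    proof (intro exI[of _ N] allI impI)
      fix m n assume "m \<ge> N"
      then have "(norm (\<Sum>k=m..<n. a k *\<^sub>C e k))\<^sup>2 < r\<^sup>2"
        using N[of m n] by (simp add: norm_sum)
      then show "norm (\<Sum>k=m..<n. a k *\<^sub>C e k) < r"
        using \<open>r > 0\<close> by (simp add: power2_less_imp_less)
    qed
  qed
  then obtain \<psi> where s: "(\<lambda>k. a k *\<^sub>C e k) sums \<psi>" by (auto simp: summable_def)
  moreover have "cinner (e j) \<psi> = a j" for j
  proof (rule LIMSEQ_unique)
    show "(\<lambda>n. cinner (e j) (\<Sum>k<n. a k *\<^sub>C e k)) \<longlonglongrightarrow> cinner (e j) \<psi>"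
      using s unfolding sums_def by (intro tendsto_intros)
    have "\<forall>\<^sub>F n in sequentially. a j = cinner (e j) (\<Sum>k<n. a k *\<^sub>C e k)"
      using eventually_gt_at_top[of j] by (rule eventually_mono) (simp add: coeff_sum)
    then show "(\<lambda>n. cinner (e j) (\<Sum>k<n. a k *\<^sub>C e k)) \<longlonglongrightarrow> a j"
      by (rule Lim_transform_eventually[OF tendsto_const])
  qed
  ultimately show ?thesis by (rule that)
qed

definition trunc :: "nat \<Rightarrow> spinor \<Rightarrow> spinor" where
  "trunc n \<psi> = (\<Sum>k<n. cinner (e k) \<psi> *\<^sub>C e k)"

lemma bessel: "(\<Sum>k<n. (cmod (cinner (e k) \<psi>))\<^sup>2) \<le> (norm \<psi>)\<^sup>2"
proof -
  have "cinner (trunc n \<psi>) (\<psi> - trunc n \<psi>) = 0"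
    unfolding trunc_def cinner_sum_left cinner_diff_right cinner_scaleC_left
    by (simp add: coeff_sum)
  from inner_self_pythagoras[OF this] have "(norm (trunc n \<psi>))\<^sup>2 \<le> (norm \<psi>)\<^sup>2" by simp
  then show ?thesis by (simp add: trunc_def norm_sum)
qed

lemma summable_coeff: "summable (\<lambda>k. (cmod (cinner (e k) \<psi>))\<^sup>2)"
  by (rule bounded_imp_summable[of _ "(norm \<psi>)\<^sup>2"]) (simp_all only: bessel flip: lessThan_Suc_atMost, simp)

lemma expansion: "(\<lambda>k. cinner (e k) \<psi> *\<^sub>C e k) sums \<psi>"
proof -
  obtain \<phi> where "(\<lambda>k. cinner (e k) \<psi> *\<^sub>C e k) sums \<phi>" "\<And>k. cinner (e k) \<phi> = cinner (e k) \<psi>"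
    using riesz_fischer[OF summable_coeff, of \<psi>] by blast
  then show ?thesis using coeff_eqI[of \<phi> \<psi>] by simp
qed

lemma trunc_tendsto: "(\<lambda>n. trunc n \<psi>) \<longlonglongrightarrow> \<psi>"
  using expansion by (simp add: sums_def trunc_def)

lemma parseval: "(\<lambda>k. cnj (cinner (e k) \<phi>) * cinner (e k) \<psi>) sums cinner \<phi> \<psi>"
proof -
  have "(\<lambda>n. cinner (trunc n \<phi>) \<psi>) \<longlonglongrightarrow> cinner \<phi> \<psi>"
    by (intro tendsto_intros trunc_tendsto)
  then show ?thesis by (simp add: trunc_def cinner_sum_left sums_def)
qed

lemma parseval_norm: "(\<lambda>k. (cmod (cinner (e k) \<psi>))\<^sup>2) sums (norm \<psi>)\<^sup>2"
proof -
  have "(\<lambda>k. Re (cnj (cinner (e k) \<psi>) * cinner (e k) \<psi>)) sums Re (cinner \<psi> \<psi>)"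
    by (intro sums_Re parseval)
  then show ?thesis by (simp add: cinner_self) (simp add: cmod_power2 flip: power2_eq_square)
qed

text \<open>Maximal domain: asking for a vector \<open>\<eta>\<close> with the prescribed
  coefficients already encodes their square summability.\<close>

definition diag :: "(nat \<Rightarrow> real) \<Rightarrow> operator" where
  "diag \<mu> = {(\<psi>, \<eta>). \<forall>k. cinner (e k) \<eta> = complex_of_real (\<mu> k) * cinner (e k) \<psi>}"

lemma diag_basis: "(e k, complex_of_real (\<mu> k) *\<^sub>C e k) \<in> diag \<mu>"
  by (simp add: diag_def orthonormal)

lemma clinear_graph_diag: "clinear_graph (diag \<mu>)"
  unfolding clinear_graph_def
proof (intro conjI allI impI)
  show "single_valued (diag \<mu>)"
    by (auto simp: single_valued_def diag_def intro: coeff_eqI)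
qed (auto simp: diag_def cinner_add_right algebra_simps)

lemma closed_diag: "closed (diag \<mu>)"
proof -
  have "diag \<mu> = (\<Inter>k. {p. cinner (e k) (snd p) = complex_of_real (\<mu> k) * cinner (e k) (fst p)})"
    by (auto simp: diag_def)
  moreover have "closed {p. cinner (e k) (snd p) = complex_of_real (\<mu> k) * cinner (e k) (fst p)}" for k
    by (intro closed_Collect_eq continuous_intros continuous_on_fst continuous_on_snd continuous_on_id)
  ultimately show ?thesis by auto
qed

lemma diag_trunc: "(trunc n \<psi>, \<Sum>k<n. (\<mu> k * cinner (e k) \<psi>) *\<^sub>C e k) \<in> diag \<mu>"
  by (simp add: diag_def trunc_def coeff_sum)

lemma dense_domain_diag: "closure (Domain (diag \<mu>)) = UNIV"
proof -
  have "\<psi> \<in> closure (Domain (diag \<mu>))" for \<psi>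
    unfolding closure_sequential using diag_trunc trunc_tendsto by (metis DomainI)
  then show ?thesis by auto
qed

lemma diag_Domain_iff:
  "\<psi> \<in> Domain (diag \<mu>) \<longleftrightarrow> summable (\<lambda>k. (\<mu> k * cmod (cinner (e k) \<psi>))\<^sup>2)"
proof
  assume "\<psi> \<in> Domain (diag \<mu>)"
  then obtain \<eta> where "\<And>k. cinner (e k) \<eta> = complex_of_real (\<mu> k) * cinner (e k) \<psi>"
    by (auto simp: diag_def)
  with summable_coeff[of \<eta>] show "summable (\<lambda>k. (\<mu> k * cmod (cinner (e k) \<psi>))\<^sup>2)"
    by (simp add: norm_mult power_mult_distrib)
next
  assume "summable (\<lambda>k. (\<mu> k * cmod (cinner (e k) \<psi>))\<^sup>2)"
  then have "summable (\<lambda>k. (cmod (complex_of_real (\<mu> k) * cinner (e k) \<psi>))\<^sup>2)"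
    by (simp add: norm_mult power_mult_distrib)
  from riesz_fischer[OF this] show "\<psi> \<in> Domain (diag \<mu>)" by (auto simp: diag_def Domain_iff)
qed

text \<open>The description has a value when the multiplier is bounded. The bound 1 used below
  covers phases, spectral projections and the signs of \<sigma>z.\<close>

definition mult :: "(nat \<Rightarrow> complex) \<Rightarrow> spinor \<Rightarrow> spinor" where
  "mult m \<psi> = (THE \<phi>. \<forall>k. cinner (e k) \<phi> = m k * cinner (e k) \<psi>)"

lemma coeff_mult:
  assumes "\<And>k. cmod (m k) \<le> 1"
  shows "cinner (e k) (mult m \<psi>) = m k * cinner (e k) \<psi>"
proof -
  have "summable (\<lambda>k. (cmod (m k * cinner (e k) \<psi>))\<^sup>2)"
  proof (rule summable_comparison_test'[OF summable_coeff[of \<psi>], of 0])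
    fix k
    have "cmod (m k) * cmod (cinner (e k) \<psi>) \<le> 1 * cmod (cinner (e k) \<psi>)"
      by (intro mult_right_mono assms) simp
    then show "norm ((cmod (m k * cinner (e k) \<psi>))\<^sup>2) \<le> (cmod (cinner (e k) \<psi>))\<^sup>2"
      by (simp add: norm_mult power_mono)
  qed
  from riesz_fischer[OF this] obtain \<phi> where \<phi>: "\<And>k. cinner (e k) \<phi> = m k * cinner (e k) \<psi>"
    by blast
  have "\<exists>!\<phi>. \<forall>k. cinner (e k) \<phi> = m k * cinner (e k) \<psi>"
    by (rule ex1I[of _ \<phi>]) (auto simp: \<phi> intro: coeff_eqI)
  from theI'[OF this] show ?thesis unfolding mult_def by blast
qed

lemma mult_linear: "(\<And>k. cmod (m k) \<le> 1) \<Longrightarrow> clinear (mult m)"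
  unfolding clinear_def by (auto intro!: coeff_eqI simp: coeff_mult cinner_add_right algebra_simps)

lemma mult_self_adjoint:
  assumes "\<And>k. cmod (m k) \<le> 1" "\<And>k. cnj (m k) = m k"
  shows "cinner (mult m \<phi>) \<psi> = cinner \<phi> (mult m \<psi>)"
  using parseval[of "mult m \<phi>" \<psi>] parseval[of \<phi> "mult m \<psi>"]
  by (simp only: coeff_mult[OF assms(1)] complex_cnj_mult assms(2) mult.assoc mult.left_commute sums_unique2)

definition evol :: "(nat \<Rightarrow> real) \<Rightarrow> real \<Rightarrow> spinor \<Rightarrow> spinor" where
  "evol \<mu> t = mult (\<lambda>k. cis (- (t * \<mu> k)))"

lemma coeff_evol [simp]: "cinner (e k) (evol \<mu> t \<psi>) = cis (- (t * \<mu> k)) * cinner (e k) \<psi>"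
  unfolding evol_def by (rule coeff_mult) simp

lemma evol_linear: "clinear (evol \<mu> t)"
  unfolding evol_def by (rule mult_linear) simp

lemma evol_basis: "evol \<mu> t (e k) = cis (- (t * \<mu> k)) *\<^sub>C e k"
  by (rule coeff_eqI) (auto simp: orthonormal)

lemma evol_0: "evol \<mu> 0 \<psi> = \<psi>"
  and evol_add: "evol \<mu> (s + t) \<psi> = evol \<mu> s (evol \<mu> t \<psi>)"
  by (rule coeff_eqI, simp add: distrib_right cis_mult add.commute flip: mult.assoc)+

lemma evol_unitary: "unitary (evol \<mu> t)"
  unfolding unitary_def
proof (intro conjI allI evol_linear)
  have "evol \<mu> t (evol \<mu> (- t) \<psi>) = \<psi>" for \<psi>
    using evol_add[of \<mu> t "-t" \<psi>] by (simp add: evol_0)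
  then show "surj (evol \<mu> t)" by (metis surjI)
  fix \<psi>
  show "norm (evol \<mu> t \<psi>) = norm \<psi>"
  proof -
    have "(\<lambda>k. (cmod (cinner (e k) \<psi>))\<^sup>2) sums (norm (evol \<mu> t \<psi>))\<^sup>2"
      using parseval_norm[of "evol \<mu> t \<psi>"] by (simp add: norm_mult)
    from sums_unique2[OF parseval_norm this] show ?thesis by (simp add: power2_eq_iff_nonneg)
  qed
qed

lemma evol_trunc: "evol \<mu> t (trunc n \<psi>) = (\<Sum>k<n. (cis (- (t * \<mu> k)) * cinner (e k) \<psi>) *\<^sub>C e k)"
  unfolding trunc_def by (simp add: clinearD[OF evol_linear] evol_basis mult.commute)

text \<open>Isometry makes the truncated orbits converge uniformly in time.\<close>

lemma evol_continuous: "continuous_on UNIV (\<lambda>t. evol \<mu> t \<psi>)"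
proof (rule uniform_limit_theorem)
  show "\<forall>\<^sub>F n in sequentially. continuous_on UNIV (\<lambda>t. evol \<mu> t (trunc n \<psi>))"
    unfolding evol_trunc
    by (intro always_eventually allI continuous_on_sum continuous_on_scaleC continuous_intros)
  show "uniform_limit UNIV (\<lambda>n t. evol \<mu> t (trunc n \<psi>)) (\<lambda>t. evol \<mu> t \<psi>) sequentially"
    using tendstoD[OF trunc_tendsto[of \<psi>]]
    by (auto simp: uniform_limit_iff dist_norm unitaryD(2)[OF evol_unitary]
        simp flip: clinearD(5)[OF evol_linear])
qed simp

text \<open>If an orbit is differentiable at 0, its coefficients are too, which identifies
  \<open>\<eta>\<close>. Conversely the truncated orbits are differentiated term by term, and their
  derivatives converge uniformly in time because \<open>evol\<close> is isometric.\<close>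

lemma evol_generates: "generates (diag \<mu>) (evol \<mu>)"
  unfolding generates_def
proof (intro conjI allI evol_unitary evol_continuous)
  show "evol \<mu> 0 = id" "evol \<mu> (s + t) = evol \<mu> s \<circ> evol \<mu> t" for s t
    by (auto simp: evol_0 evol_add)
  have "(\<psi>, \<eta>) \<in> diag \<mu>" if *: "((\<lambda>t. evol \<mu> t \<psi>) has_vector_derivative - \<i> *\<^sub>C \<eta>) (at 0)" for \<psi> \<eta>
    unfolding diag_def
  proof (clarify)
    fix k
    have 1: "((\<lambda>t. cinner (e k) (evol \<mu> t \<psi>)) has_vector_derivative cinner (e k) (- \<i> *\<^sub>C \<eta>)) (at 0)"
      by (rule bounded_linear.has_vector_derivative[OF bounded_linear_cinner_right *])
    have "((\<lambda>t. cis (- (t * \<mu> k)) * cinner (e k) \<psi>) has_vector_derivative (- \<i> * \<mu> k) * cinner (e k) \<psi>) (at 0)"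
      by (auto simp: cis_conv_exp intro!: derivative_eq_intros has_vector_derivative_mult_left
          has_vector_derivative_real_field)
    with 1 have "cinner (e k) (- \<i> *\<^sub>C \<eta>) = (- \<i> * \<mu> k) * cinner (e k) \<psi>"
      unfolding coeff_evol by (rule vector_derivative_unique_at)
    then show "cinner (e k) \<eta> = complex_of_real (\<mu> k) * cinner (e k) \<psi>" by simp
  qed
  moreover have "((\<lambda>t. evol \<mu> t \<psi>) has_vector_derivative - \<i> *\<^sub>C \<eta>) (at 0)" if *: "(\<psi>, \<eta>) \<in> diag \<mu>" for \<psi> \<eta>
  proof -
    have "\<exists>g. \<forall>t\<in>UNIV. (\<lambda>n. evol \<mu> t (trunc n \<psi>)) \<longlonglongrightarrow> g t \<and>
        (g has_derivative (\<lambda>h. h *\<^sub>R (- \<i> *\<^sub>C evol \<mu> t \<eta>))) (at t within UNIV)"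
    proof (rule has_derivative_sequence[OF convex_UNIV _ _ UNIV_I])
      show "((\<lambda>t. evol \<mu> t (trunc n \<psi>)) has_derivative (\<lambda>h. h *\<^sub>R (- \<i> *\<^sub>C evol \<mu> t (trunc n \<eta>)))) (at t within UNIV)"
        for n t
      proof -
        have "((\<lambda>t. cis (- (t * \<mu> k)) * cinner (e k) \<psi>) has_vector_derivative
            - \<i> * (cis (- (t * \<mu> k)) * cinner (e k) \<eta>)) (at t)" for k
          using * by (auto simp: diag_def cis_conv_exp intro!: derivative_eq_intros has_vector_derivative_mult_left
              has_vector_derivative_real_field)
        then have "((\<lambda>t. (cis (- (t * \<mu> k)) * cinner (e k) \<psi>) *\<^sub>C e k) has_vector_derivative
            - \<i> *\<^sub>C (cis (- (t * \<mu> k)) * cinner (e k) \<eta>) *\<^sub>C e k) (at t)" for k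
          using bounded_linear.has_vector_derivative[OF
              bounded_bilinear.bounded_linear_left[OF bounded_bilinear_scaleC]] by fastforce
        then show ?thesis
          unfolding has_vector_derivative_def[symmetric] evol_trunc scaleC_sum_right
          by (intro has_vector_derivative_sum) auto
      qed
      show "(\<lambda>n. evol \<mu> 0 (trunc n \<psi>)) \<longlonglongrightarrow> \<psi>" by (simp add: evol_0 trunc_tendsto)
      fix r :: real assume "r > 0"
      from tendstoD[OF trunc_tendsto[of \<eta>] this]
      show "\<forall>\<^sub>F n in sequentially. \<forall>t\<in>UNIV. \<forall>h.
          norm (h *\<^sub>R (- \<i> *\<^sub>C evol \<mu> t (trunc n \<eta>)) - h *\<^sub>R (- \<i> *\<^sub>C evol \<mu> t \<eta>)) \<le> r * norm h"
      proof (rule eventually_mono, intro ballI allI)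
        fix n t and h :: real
        assume "dist (trunc n \<eta>) \<eta> < r"
        then have "norm (evol \<mu> t (trunc n \<eta> - \<eta>)) \<le> r"
          by (simp add: unitaryD(2)[OF evol_unitary] dist_norm)
        then have "\<bar>h\<bar> * norm (evol \<mu> t (trunc n \<eta> - \<eta>)) \<le> \<bar>h\<bar> * r" by (intro mult_left_mono) auto
        moreover have "h *\<^sub>R (- \<i> *\<^sub>C evol \<mu> t (trunc n \<eta>)) - h *\<^sub>R (- \<i> *\<^sub>C evol \<mu> t \<eta>)
            = h *\<^sub>R (- \<i> *\<^sub>C evol \<mu> t (trunc n \<eta> - \<eta>))"
          by (simp only: clinearD(5)[OF evol_linear] scaleC_diff_right scaleR_diff_right)
        ultimately show "norm (h *\<^sub>R (- \<i> *\<^sub>C evol \<mu> t (trunc n \<eta>)) - h *\<^sub>R (- \<i> *\<^sub>C evol \<mu> t \<eta>)) \<le> r * norm h"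
          by (simp add: mult.commute)
      qed
    qed
    then obtain g where g: "\<And>t. (\<lambda>n. evol \<mu> t (trunc n \<psi>)) \<longlonglongrightarrow> g t"
      "\<And>t. (g has_vector_derivative (- \<i> *\<^sub>C evol \<mu> t \<eta>)) (at t)"
      by (auto simp: has_vector_derivative_def)
    have "(\<lambda>n. evol \<mu> t (trunc n \<psi>)) \<longlonglongrightarrow> evol \<mu> t \<psi>" for t
      by (rule bounded_linear.tendsto[OF unitaryD(4)[OF evol_unitary] trunc_tendsto])
    then have "g = (\<lambda>t. evol \<mu> t \<psi>)" using g(1) LIMSEQ_unique by blast
    with g(2)[of 0] show ?thesis by (simp add: evol_0)
  qed
  ultimately show "diag \<mu> = {(\<psi>, \<eta>). ((\<lambda>t. evol \<mu> t \<psi>) has_vector_derivative - \<i> *\<^sub>C \<eta>) (at 0)}"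
    by blast
qed

lemma propagator_diag: "propagator (diag \<mu>) = evol \<mu>"
  by (rule propagator_eq[OF evol_generates dense_domain_diag])

end

subsection \<open>Schwartz functions\<close>

text \<open>A family stable under one derivative replaces bookkeeping for all higher derivatives: no
  Leibniz formula occurs anywhere.\<close>

lemma schwartzI:
  assumes "f \<in> \<F>"
    and "\<And>f x. f \<in> \<F> \<Longrightarrow> f differentiable at x" "\<And>f. f \<in> \<F> \<Longrightarrow> dx f \<in> \<F>"
    and "\<And>f m. f \<in> \<F> \<Longrightarrow> bounded (range (\<lambda>x. x ^ m *\<^sub>R f x))"
  shows "f \<in> schwartz"
proof -
  have "(dx ^^ n) f \<in> \<F>" for n by (induction n) (auto simp: assms)
  then show ?thesis by (auto simp: schwartz_def assms)
qed

lemma schwartz_deriv: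
  assumes "f \<in> schwartz"
  shows "(f has_vector_derivative dx f x) (at x)"
proof -
  have "(dx ^^ 0) f differentiable at x" using assms unfolding schwartz_def by blast
  then show ?thesis by (simp add: dx_def vector_derivative_works)
qed

lemma dx_eqI: "(\<And>x. (f has_vector_derivative g x) (at x)) \<Longrightarrow> dx f = g"
  by (rule ext) (simp add: dx_def vector_derivative_at)

lemma schwartz_bounded:
  assumes "f \<in> schwartz"
  shows "bounded (range (\<lambda>x. x ^ m *\<^sub>R f x))"
proof -
  have "bounded (range (\<lambda>x. x ^ m *\<^sub>R (dx ^^ 0) f x))" using assms unfolding schwartz_def by blast
  then show ?thesis by simp
qed

lemma schwartz_dx: "f \<in> schwartz \<Longrightarrow> dx f \<in> schwartz"
proof -
  assume f: "f \<in> schwartz"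
  have "(dx ^^ n) (dx f) = (dx ^^ Suc n) f" for n by (simp add: funpow_swap1)
  then show ?thesis using f unfolding schwartz_def by (simp del: funpow.simps)
qed

lemma schwartz_differentiable: "f \<in> schwartz \<Longrightarrow> f differentiable at x"
  using schwartz_deriv differentiableI_vector by blast

lemma dx_add: "f \<in> schwartz \<Longrightarrow> g \<in> schwartz \<Longrightarrow> dx (\<lambda>x. f x + g x) = (\<lambda>x. dx f x + dx g x)"
  by (intro dx_eqI has_vector_derivative_add schwartz_deriv)

lemma dx_diff: "f \<in> schwartz \<Longrightarrow> g \<in> schwartz \<Longrightarrow> dx (\<lambda>x. f x - g x) = (\<lambda>x. dx f x - dx g x)"
  by (intro dx_eqI has_vector_derivative_diff schwartz_deriv)

lemma dx_scale: "f \<in> schwartz \<Longrightarrow> dx (\<lambda>x. c * f x) = (\<lambda>x. c * dx f x)"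
  by (intro dx_eqI has_vector_derivative_mult_right schwartz_deriv)

lemma dx_mult_x:
  assumes "f \<in> schwartz"
  shows "dx (\<lambda>x. x *\<^sub>R f x) = (\<lambda>x. x *\<^sub>R dx f x + f x)"
  using schwartz_deriv[OF assms] by (intro dx_eqI) (auto intro!: derivative_eq_intros)

lemma dx_translate:
  assumes "f \<in> schwartz"
  shows "dx (\<lambda>x. f (x + c)) = (\<lambda>x. dx f (x + c))"
proof (rule dx_eqI)
  fix x
  have "((\<lambda>x. x + c) has_vector_derivative 1) (at x)" by (auto intro!: derivative_eq_intros)
  from vector_diff_chain_at[OF this schwartz_deriv[OF assms]]
  show "((\<lambda>x. f (x + c)) has_vector_derivative dx f (x + c)) (at x)" by (simp add: o_def)
qed

lemma dx_cnj: "f \<in> schwartz \<Longrightarrow> dx (\<lambda>x. cnj (f x)) = (\<lambda>x. cnj (dx f x))"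
  by (intro dx_eqI bounded_linear.has_vector_derivative[OF bounded_linear_cnj] schwartz_deriv)

lemma schwartz_0: "(\<lambda>_. 0) \<in> schwartz"
  by (rule schwartzI[of _ "{\<lambda>_. 0}"]) (auto simp: dx_def)

lemma schwartz_add:
  assumes "f \<in> schwartz" "g \<in> schwartz"
  shows "(\<lambda>x. f x + g x) \<in> schwartz"
proof (rule schwartzI[of _ "{\<lambda>x. f x + g x | f g. f \<in> schwartz \<and> g \<in> schwartz}"], safe)
  fix f g assume fg: "f \<in> schwartz" "g \<in> schwartz"
  from dx_add[OF fg] fg show "\<exists>f' g'. dx (\<lambda>x. f x + g x) = (\<lambda>x. f' x + g' x) \<and> f' \<in> schwartz \<and> g' \<in> schwartz"
    using schwartz_dx by blast
  show "(\<lambda>x. f x + g x) differentiable at x" for x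
    using fg by (intro differentiable_add schwartz_differentiable)
  show "bounded (range (\<lambda>x. x ^ m *\<^sub>R (f x + g x)))" for m
    unfolding scaleR_add_right by (intro bounded_plus_comp schwartz_bounded fg)
qed (use assms in blast)

lemma schwartz_scale:
  assumes "f \<in> schwartz"
  shows "(\<lambda>x. c * f x) \<in> schwartz"
proof (rule schwartzI[of _ "{\<lambda>x. c * f x | f. f \<in> schwartz}"], safe)
  fix f assume f: "f \<in> schwartz"
  from dx_scale[OF f] f show "\<exists>f'. dx (\<lambda>x. c * f x) = (\<lambda>x. c * f' x) \<and> f' \<in> schwartz"
    using schwartz_dx by blast
  show "(\<lambda>x. c * f x) differentiable at x" for x
    using f by (intro differentiable_mult differentiable_const schwartz_differentiable)
  show "bounded (range (\<lambda>x. x ^ m *\<^sub>R (c * f x)))" for m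
    using bounded_linear_image[OF schwartz_bounded[OF f, of m] bounded_linear_mult_right[of c]]
    by (simp add: image_image)
qed (use assms in blast)

lemma schwartz_uminus: "f \<in> schwartz \<Longrightarrow> (\<lambda>x. - f x) \<in> schwartz"
  using schwartz_scale[of f "-1"] by simp

lemma schwartz_diff: "f \<in> schwartz \<Longrightarrow> g \<in> schwartz \<Longrightarrow> (\<lambda>x. f x - g x) \<in> schwartz"
  using schwartz_add[OF _ schwartz_uminus, of f g] by simp

lemma schwartz_mult_x:
  assumes "f \<in> schwartz"
  shows "(\<lambda>x. x *\<^sub>R f x) \<in> schwartz"
\<comment> \<open>Functions x f alone are not stable under differentiation, since (x f)' = x f' + f;
  the extra summand \<open>g\<close> absorbs the second term.\<close>
proof (rule schwartzI[of _ "{\<lambda>x. x *\<^sub>R f x + g x | f g. f \<in> schwartz \<and> g \<in> schwartz}"], safe)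
  fix f g assume fg: "f \<in> schwartz" "g \<in> schwartz"
  have *: "((\<lambda>x. x *\<^sub>R f x + g x) has_vector_derivative (x *\<^sub>R dx f x + (f x + dx g x))) (at x)" for x
    using schwartz_deriv[OF fg(1)] schwartz_deriv[OF fg(2)]
    by (auto intro!: derivative_eq_intros)
  from dx_eqI[OF *] show "\<exists>f' g'. dx (\<lambda>x. x *\<^sub>R f x + g x) = (\<lambda>x. x *\<^sub>R f' x + g' x) \<and> f' \<in> schwartz \<and> g' \<in> schwartz"
    by (intro exI[of _ "dx f"] exI[of _ "\<lambda>x. f x + dx g x"] conjI schwartz_add schwartz_dx fg)
  show "(\<lambda>x. x *\<^sub>R f x + g x) differentiable at x" for x
    using * differentiableI_vector by blast
  have "(\<lambda>x. x ^ m *\<^sub>R (x *\<^sub>R f x + g x)) = (\<lambda>x. x ^ Suc m *\<^sub>R f x + x ^ m *\<^sub>R g x)" for m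
    by (auto simp: scaleR_add_right mult.commute)
  then show "bounded (range (\<lambda>x. x ^ m *\<^sub>R (x *\<^sub>R f x + g x)))" for m
    by (simp only: bounded_plus_comp schwartz_bounded fg)
next
  show "\<exists>f' g. (\<lambda>x. x *\<^sub>R f x) = (\<lambda>x. x *\<^sub>R f' x + g x) \<and> f' \<in> schwartz \<and> g \<in> schwartz"
    using assms schwartz_0 by (intro exI[of _ f] exI[of _ "\<lambda>_. 0"]) auto
qed

lemma schwartz_translate:
  assumes "f \<in> schwartz"
  shows "(\<lambda>x. f (x + c)) \<in> schwartz"
proof (rule schwartzI[of _ "{\<lambda>x. f (x + c) | f. f \<in> schwartz}"], safe)
  fix f assume f: "f \<in> schwartz"
  have *: "((\<lambda>x. f (x + c)) has_vector_derivative dx f (x + c)) (at x)" for x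
  proof -
    have "((\<lambda>x. x + c) has_vector_derivative 1) (at x)" by (auto intro!: derivative_eq_intros)
    from vector_diff_chain_at[OF this schwartz_deriv[OF f]] show ?thesis by (simp add: o_def)
  qed
  from dx_eqI[OF *] f show "\<exists>f'. dx (\<lambda>x. f (x + c)) = (\<lambda>x. f' (x + c)) \<and> f' \<in> schwartz"
    using schwartz_dx by blast
  show "(\<lambda>x. f (x + c)) differentiable at x" for x
    using * differentiableI_vector by blast
  \<comment> \<open>Boundedness of x^m f(x + c) becomes, after substitution, boundedness of (x -
    c)^m f(x).\<close>
  have "(\<lambda>x. (x - c) ^ m *\<^sub>R f x) \<in> schwartz" for m
  proof (induction m)
    case (Suc m)
    from schwartz_add[OF schwartz_mult_x[OF Suc] schwartz_scale[OF Suc, of "- c"]]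
    show ?case by (simp add: algebra_simps scaleR_conv_of_real)
  qed (simp add: f)
  from schwartz_bounded[OF this, of 0] have "bounded (range (\<lambda>x. (x - c) ^ m *\<^sub>R f x))" for m by simp
  then have "bounded ((\<lambda>x. (x - c) ^ m *\<^sub>R f x) ` range (\<lambda>x. x + c))" for m
    by (rule bounded_subset) auto
  then show "bounded (range (\<lambda>x. x ^ m *\<^sub>R f (x + c)))" for m
    unfolding image_image by simp
qed (use assms in blast)

text \<open>One term of the exponential series gives |x|^k / k! <= exp |x|, and |x| <= 1/2 +
  x^2/2.\<close>

lemma power_mult_gaussian_le: "\<bar>x\<bar> ^ k * exp (- x\<^sup>2 / 2) \<le> fact k * exp (1 / 2 :: real)"
proof -
  have "\<bar>x\<bar> ^ k / fact k \<le> exp \<bar>x\<bar>"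
    using sum_le_suminf[OF summable_exp[of "\<bar>x\<bar>"], of "{k}"]
    by (simp add: exp_def divide_inverse mult.commute)
  also have "\<bar>x\<bar> \<le> 1 / 2 + x\<^sup>2 / 2"
    using sum_squares_bound[of "\<bar>x\<bar>" 1] by simp
  then have "exp \<bar>x\<bar> \<le> exp (1 / 2) * exp (x\<^sup>2 / 2)" by (simp flip: exp_add)
  finally have "\<bar>x\<bar> ^ k / fact k * (fact k * exp (- x\<^sup>2 / 2)) \<le> (exp (1 / 2) * exp (x\<^sup>2 / 2)) * (fact k * exp (- x\<^sup>2 / 2))"
    by (intro mult_right_mono) auto
  also have "\<dots> = fact k * exp (1 / 2) * (exp (x\<^sup>2 / 2) * exp (- x\<^sup>2 / 2))" by (simp only: mult_ac)
  also have "exp (x\<^sup>2 / 2) * exp (- x\<^sup>2 / 2) = 1" by (simp flip: exp_add)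
  finally show ?thesis by simp
qed

text \<open>Polynomials times the Gaussian form a family closed under differentiation, with p
  replaced by p' - x p.\<close>

lemma gaussian_schwartz: "(\<lambda>x. complex_of_real (exp (- x\<^sup>2 / 2))) \<in> schwartz"
proof (rule schwartzI[of _ "{\<lambda>x. complex_of_real (poly p x * exp (- x\<^sup>2 / 2)) | p. True}"], safe)
  fix p :: "real poly"
  have *: "((\<lambda>x. complex_of_real (poly p x * exp (- x\<^sup>2 / 2))) has_vector_derivative
      complex_of_real (poly (pderiv p - [:0, 1:] * p) x * exp (- x\<^sup>2 / 2))) (at x)" for x
  proof -
    have "((\<lambda>x. poly p x * exp (- x\<^sup>2 / 2)) has_real_derivative
        poly (pderiv p - [:0, 1:] * p) x * exp (- x\<^sup>2 / 2)) (at x)"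
      by (auto intro!: derivative_eq_intros poly_DERIV simp: algebra_simps)
    then show ?thesis
      by (intro has_vector_derivative_of_real) (simp add: has_real_derivative_iff_has_vector_derivative)
  qed
  from dx_eqI[OF *] show "\<exists>q. dx (\<lambda>x. complex_of_real (poly p x * exp (- x\<^sup>2 / 2))) =
      (\<lambda>x. complex_of_real (poly q x * exp (- x\<^sup>2 / 2))) \<and> True"
    by blast
  show "(\<lambda>x. complex_of_real (poly p x * exp (- x\<^sup>2 / 2))) differentiable at x" for x
    using * differentiableI_vector by blast
  fix m :: nat
  have "norm (x ^ m *\<^sub>R complex_of_real (poly p x * exp (- x\<^sup>2 / 2)))
      \<le> (\<Sum>i\<le>degree p. \<bar>coeff p i\<bar> * (fact (i + m) * exp (1 / 2)))" for x
  proof -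
    have "norm (x ^ m *\<^sub>R complex_of_real (poly p x * exp (- x\<^sup>2 / 2)))
        = \<bar>(\<Sum>i\<le>degree p. coeff p i * (x ^ (i + m) * exp (- x\<^sup>2 / 2)))\<bar>"
    proof -
      have "x ^ m *\<^sub>R complex_of_real (poly p x * exp (- x\<^sup>2 / 2))
          = complex_of_real (\<Sum>i\<le>degree p. coeff p i * (x ^ (i + m) * exp (- x\<^sup>2 / 2)))"
        unfolding scaleR_conv_of_real of_real_mult[symmetric] poly_altdef sum_distrib_left sum_distrib_right
        by (simp only: power_add mult_ac)
      then show ?thesis by (simp only: norm_of_real)
    qed
    also have "\<dots> \<le> (\<Sum>i\<le>degree p. \<bar>coeff p i\<bar> * (\<bar>x\<bar> ^ (i + m) * exp (- x\<^sup>2 / 2)))"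
      by (rule order_trans[OF sum_abs]) (simp add: abs_mult power_abs)
    also have "\<dots> \<le> (\<Sum>i\<le>degree p. \<bar>coeff p i\<bar> * (fact (i + m) * exp (1 / 2)))"
      by (intro sum_mono mult_left_mono power_mult_gaussian_le) auto
    finally show ?thesis .
  qed
  then show "bounded (range (\<lambda>x. x ^ m *\<^sub>R complex_of_real (poly p x * exp (- x\<^sup>2 / 2))))"
    by (auto simp: bounded_iff)
qed (auto intro!: exI[of _ "1 :: real poly"])

lemma schwartz_continuous: "f \<in> schwartz \<Longrightarrow> continuous_on UNIV f"
  using schwartz_deriv has_vector_derivative_continuous
  by (intro continuous_at_imp_continuous_on) blast

lemma schwartz_measurable: "f \<in> schwartz \<Longrightarrow> f \<in> borel_measurable lborel"
  by (simp add: borel_measurable_continuous_onI schwartz_continuous)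

lemma schwartz_decay:
  assumes "f \<in> schwartz"
  obtains c where "\<And>x. norm (f x) \<le> c / (1 + x\<^sup>2)" "c > 0"
proof -
  obtain a where a: "\<And>x. norm (x ^ 0 *\<^sub>R f x) \<le> a"
    using schwartz_bounded[OF assms, of 0] unfolding bounded_iff by blast
  obtain b where b: "\<And>x. norm (x ^ 2 *\<^sub>R f x) \<le> b"
    using schwartz_bounded[OF assms, of 2] unfolding bounded_iff by blast
  have "(1 + x\<^sup>2) * norm (f x) \<le> \<bar>a\<bar> + \<bar>b\<bar> + 1" for x
    using a[of x] b[of x] by (simp add: algebra_simps)
  then show ?thesis
    using that[of "\<bar>a\<bar> + \<bar>b\<bar> + 1"]
    by (simp add: pos_le_divide_eq add_pos_nonneg mult.commute)
qed

lemma integrable_inverse_one_plus_square: "integrable lborel (\<lambda>x :: real. c / (1 + x\<^sup>2))"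
proof -
  have "integrable lborel (\<lambda>x :: real. inverse (1 + x\<^sup>2))"
    using integrable_inverse_1_plus_square by (simp add: set_integrable_def einterval_def)
  then show ?thesis by (simp add: divide_inverse)
qed

lemma schwartz_mult_decay:
  assumes "f \<in> schwartz" "g \<in> schwartz"
  obtains c where "\<And>x. norm (f x * g x) \<le> c / (1 + x\<^sup>2)" "c > 0"
proof -
  obtain a where a: "\<And>x. norm (f x) \<le> a / (1 + x\<^sup>2)" "a > 0" using schwartz_decay[OF assms(1)] by blast
  obtain b where b: "\<And>x. norm (x ^ 0 *\<^sub>R g x) \<le> b"
    using schwartz_bounded[OF assms(2), of 0] unfolding bounded_iff by blast
  have "norm (f x * g x) \<le> (a * (\<bar>b\<bar> + 1)) / (1 + x\<^sup>2)" for x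
  proof -
    have "norm (f x * g x) \<le> (a / (1 + x\<^sup>2)) * (\<bar>b\<bar> + 1)"
      unfolding norm_mult using a b[of x] by (intro mult_mono) auto
    then show ?thesis by simp
  qed
  moreover have "a * (\<bar>b\<bar> + 1) > 0" using a by auto
  ultimately show ?thesis by (rule that)
qed

lemma schwartz_cnj: "f \<in> schwartz \<Longrightarrow> (\<lambda>x. cnj (f x)) \<in> schwartz"
proof (rule schwartzI[of _ "{\<lambda>x. cnj (f x) | f. f \<in> schwartz}"], safe)
  fix f assume f: "f \<in> schwartz"
  have *: "((\<lambda>x. cnj (f x)) has_vector_derivative cnj (dx f x)) (at x)" for x
    by (rule bounded_linear.has_vector_derivative[OF bounded_linear_cnj schwartz_deriv[OF f]])
  from dx_eqI[OF *] f show "\<exists>f'. dx (\<lambda>x. cnj (f x)) = (\<lambda>x. cnj (f' x)) \<and> f' \<in> schwartz"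
    using schwartz_dx by blast
  show "(\<lambda>x. cnj (f x)) differentiable at x" for x
    using * differentiableI_vector by blast
  show "bounded (range (\<lambda>x. x ^ m *\<^sub>R cnj (f x)))" for m
    using bounded_linear_image[OF schwartz_bounded[OF f, of m] bounded_linear_cnj]
    by (simp add: image_image)
qed blast

lemma schwartz_integrable_mult:
  assumes "f \<in> schwartz" "g \<in> schwartz"
  shows "integrable lborel (\<lambda>x. f x * g x)"
proof -
  obtain c where c: "\<And>x. norm (f x * g x) \<le> c / (1 + x\<^sup>2)" "c > 0" using schwartz_mult_decay[OF assms] by blast
  note [measurable] = schwartz_measurable[OF assms(1)] schwartz_measurable[OF assms(2)]
  show ?thesis
  proof (rule Bochner_Integration.integrable_bound[OF integrable_inverse_one_plus_square[of c]])
    show "AE x in lborel. norm (f x * g x) \<le> norm (c / (1 + x\<^sup>2))"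
      using c by (intro always_eventually allI) (metis norm_ge_zero order_trans real_norm_def abs_of_nonneg)
  qed measurable
qed

text \<open>Products of Schwartz functions are dominated by c / (1 + x^2), so the boundary values at
  both infinities vanish.\<close>

lemma schwartz_integral_by_parts:
  assumes f: "f \<in> schwartz" and g: "g \<in> schwartz"
  shows "(LINT x|lborel. dx f x * g x) = - (LINT x|lborel. f x * dx g x)"
proof -
  obtain c where c: "\<And>x. norm (f x * g x) \<le> c / (1 + x\<^sup>2)" "c > 0" using schwartz_mult_decay[OF f g] by blast
  have int: "integrable lborel (\<lambda>x. f x * dx g x)" "integrable lborel (\<lambda>x. dx f x * g x)"
    using f g by (auto intro!: schwartz_integrable_mult schwartz_dx)
  have lim: "((\<lambda>x. f x * g x) \<longlongrightarrow> 0) F" if "((\<lambda>x. c / (1 + x\<^sup>2)) \<longlongrightarrow> 0) F" for F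
    by (rule Lim_null_comparison[OF _ that]) (simp add: c)
  have "(LBINT x=-\<infinity>..\<infinity>. (f x * dx g x + dx f x * g x)) = 0 - 0"
  proof (rule interval_integral_FTC_integrable[where F = "\<lambda>x. f x * g x"])
    show "((\<lambda>x. f x * g x) has_vector_derivative (f x * dx g x + dx f x * g x)) (at x)" for x
      by (intro has_vector_derivative_mult schwartz_deriv f g)
    have "continuous_on UNIV (\<lambda>x. f x * dx g x + dx f x * g x)"
      by (intro continuous_intros schwartz_continuous schwartz_dx f g)
    then show "isCont (\<lambda>x. f x * dx g x + dx f x * g x) x" for x
      by (simp add: continuous_on_eq_continuous_at)
    show "set_integrable lborel (einterval (-\<infinity>) \<infinity>) (\<lambda>x. f x * dx g x + dx f x * g x)"
      using int by (simp add: set_integrable_def einterval_def)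
    have "((\<lambda>x::real. c / (1 + x\<^sup>2)) \<longlongrightarrow> 0) at_bot" "((\<lambda>x::real. c / (1 + x\<^sup>2)) \<longlongrightarrow> 0) at_top"
    proof -
      have "filterlim (\<lambda>x::real. 1 + x\<^sup>2) at_top at_bot" "filterlim (\<lambda>x::real. 1 + x\<^sup>2) at_top at_top"
        by (intro filterlim_tendsto_add_at_top[OF tendsto_const] filterlim_pow_at_bot_even
            filterlim_pow_at_top filterlim_ident; simp)+
      then show "((\<lambda>x::real. c / (1 + x\<^sup>2)) \<longlongrightarrow> 0) at_bot" "((\<lambda>x::real. c / (1 + x\<^sup>2)) \<longlongrightarrow> 0) at_top"
        by (auto intro!: tendsto_divide_0[OF tendsto_const] filterlim_at_top_imp_at_infinity)
    qed
    then show "(((\<lambda>x. f x * g x) \<circ> real_of_ereal) \<longlongrightarrow> 0) (at_right (-\<infinity>))"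
      "(((\<lambda>x. f x * g x) \<circ> real_of_ereal) \<longlongrightarrow> 0) (at_left \<infinity>)"
      unfolding ereal_tendsto_simps by (auto intro: lim)
  qed simp
  moreover have "(LBINT x=-\<infinity>..\<infinity>. (f x * dx g x + dx f x * g x)) = (LINT x|lborel. (f x * dx g x + dx f x * g x))"
    by (simp add: interval_lebesgue_integral_def set_lebesgue_integral_def einterval_def)
  ultimately have "(LINT x|lborel. f x * dx g x) + (LINT x|lborel. dx f x * g x) = 0"
    using int by simp
  then show ?thesis by (simp add: add_eq_0_iff)
qed

section \<open>Ladder operators as total maps on a type of Schwartz functions\<close>

lemma ann_schwartz: "f \<in> schwartz \<Longrightarrow> ann f \<in> schwartz"
  and cre_schwartz: "f \<in> schwartz \<Longrightarrow> cre f \<in> schwartz"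
proof -
  assume f: "f \<in> schwartz"
  have *: "ann f = (\<lambda>x. complex_of_real (1 / sqrt 2) * (x *\<^sub>R f x + dx f x))"
    "cre f = (\<lambda>x. complex_of_real (1 / sqrt 2) * (x *\<^sub>R f x - dx f x))"
    by (rule ext, simp only: ann_def cre_def scaleR_conv_of_real)+
  show "ann f \<in> schwartz" "cre f \<in> schwartz"
    unfolding * by (intro schwartz_scale schwartz_add schwartz_diff schwartz_mult_x schwartz_dx f)+
qed

text \<open>As a type, Schwartz functions make linearity, adjointness and the commutation relation
  unconditional rewrite rules, free of membership premises.\<close>

typedef swf = schwartz
  morphisms swf_fun Swf
  using schwartz_0 by blast

setup_lifting type_definition_swf

instantiation swf :: ab_group_add
begin

lift_definition zero_swf :: swf is "\<lambda>_. 0" by (rule schwartz_0)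
lift_definition plus_swf :: "swf \<Rightarrow> swf \<Rightarrow> swf" is "\<lambda>f g x. f x + g x" by (rule schwartz_add)
lift_definition minus_swf :: "swf \<Rightarrow> swf \<Rightarrow> swf" is "\<lambda>f g x. f x - g x" by (rule schwartz_diff)
lift_definition uminus_swf :: "swf \<Rightarrow> swf" is "\<lambda>f x. - f x" by (rule schwartz_uminus)

instance
  by standard (transfer; simp add: algebra_simps)+

end

lift_definition scl :: "complex \<Rightarrow> swf \<Rightarrow> swf" (infixr \<open>*\<^sub>S\<close> 75) is "\<lambda>c f x. c * f x"
  by (rule schwartz_scale)

lift_definition an :: "swf \<Rightarrow> swf" is ann by (rule ann_schwartz)
lift_definition cr :: "swf \<Rightarrow> swf" is cre by (rule cre_schwartz)
lift_definition translate :: "real \<Rightarrow> swf \<Rightarrow> swf" is "\<lambda>c f x. f (x + c)" by (rule schwartz_translate)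
lift_definition mult_x :: "swf \<Rightarrow> swf" is "\<lambda>f x. x *\<^sub>R f x" by (rule schwartz_mult_x)
lift_definition gauss :: swf is "\<lambda>x. complex_of_real (exp (- x\<^sup>2 / 2))" by (rule gaussian_schwartz)

lift_definition sip :: "swf \<Rightarrow> swf \<Rightarrow> complex" is "\<lambda>f g. LINT x|lborel. cnj (f x) * g x" .

lemma scl_add_right: "c *\<^sub>S (f + g) = c *\<^sub>S f + c *\<^sub>S g"
  and scl_add_left: "(c + d) *\<^sub>S f = c *\<^sub>S f + d *\<^sub>S f"
  and scl_scl [simp]: "c *\<^sub>S d *\<^sub>S f = (c * d) *\<^sub>S f"
  and scl_one [simp]: "1 *\<^sub>S f = f"
  and scl_zero_left [simp]: "0 *\<^sub>S f = 0"
  and scl_zero_right [simp]: "c *\<^sub>S 0 = 0"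
  and scl_minus_right [simp]: "c *\<^sub>S (- f) = - (c *\<^sub>S f)"
  and scl_minus_left [simp]: "(- c) *\<^sub>S f = - (c *\<^sub>S f)"
  and scl_diff_right: "c *\<^sub>S (f - g) = c *\<^sub>S f - c *\<^sub>S g"
  by (transfer; simp add: algebra_simps)+

lemma scl_diff_left: "(c - d) *\<^sub>S f = c *\<^sub>S f - d *\<^sub>S f"
  using scl_add_left[of c "- d" f] by simp

lift_definition dif :: "swf \<Rightarrow> swf" is dx by (rule schwartz_dx)

lemma dif_simps:
  "dif (f + g) = dif f + dif g" "dif (f - g) = dif f - dif g" "dif (z *\<^sub>S f) = z *\<^sub>S dif f"
  "dif (mult_x f) = mult_x (dif f) + f" "dif (translate c f) = translate c (dif f)"
  by (transfer; simp add: dx_add dx_diff dx_scale dx_mult_x dx_translate)+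

lemma mult_x_simps:
  "mult_x (f + g) = mult_x f + mult_x g" "mult_x (f - g) = mult_x f - mult_x g" "mult_x (z *\<^sub>S f) = z *\<^sub>S mult_x f"
  "mult_x (translate c f) = translate c (mult_x f) - complex_of_real c *\<^sub>S translate c f"
  by (transfer; simp add: algebra_simps scaleR_conv_of_real)+

lemma translate_simps [simp]:
  "translate c (f + g) = translate c f + translate c g" "translate c (f - g) = translate c f - translate c g"
  "translate c (d *\<^sub>S f) = d *\<^sub>S translate c f"
  by (transfer; simp)+

lemma an_eq: "an f = complex_of_real (1 / sqrt 2) *\<^sub>S (mult_x f + dif f)"
  and cr_eq: "cr f = complex_of_real (1 / sqrt 2) *\<^sub>S (mult_x f - dif f)"
  by (transfer; simp only: ann_def[abs_def] cre_def[abs_def] scaleR_conv_of_real)+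

lemma an_add: "an (f + g) = an f + an g" and an_scl: "an (c *\<^sub>S f) = c *\<^sub>S an f"
  and cr_add: "cr (f + g) = cr f + cr g" and cr_scl: "cr (c *\<^sub>S f) = c *\<^sub>S cr f"
  by (simp_all add: an_eq cr_eq dif_simps mult_x_simps scl_add_right scl_diff_right mult.commute)

lemma additive_swf:
  fixes T :: "swf \<Rightarrow> swf"
  assumes "\<And>f g. T (f + g) = T f + T g"
  shows "T 0 = 0" "T (- f) = - T f" "T (f - g) = T f - T g"
proof -
  interpret additive T by standard (rule assms)
  show "T 0 = 0" "T (- f) = - T f" "T (f - g) = T f - T g" by (rule zero minus diff)+
qed

lemmas an_linear [simp] = an_add an_scl additive_swf[of an, OF an_add]
lemmas cr_linear [simp] = cr_add cr_scl additive_swf[of cr, OF cr_add]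

lemma mult_x_eq: "mult_x f = complex_of_real (1 / sqrt 2) *\<^sub>S (an f + cr f)"
proof -
  have "complex_of_real (1 / sqrt 2) * complex_of_real (1 / sqrt 2) = 1 / 2"
    by (simp only: of_real_mult[symmetric]) simp
  then have "complex_of_real (1 / sqrt 2) *\<^sub>S (an f + cr f) = (1 / 2) *\<^sub>S (mult_x f + mult_x f)"
    unfolding an_eq cr_eq scl_add_right[symmetric] scl_scl by simp
  also have "\<dots> = (1 / 2 + 1 / 2) *\<^sub>S mult_x f" unfolding scl_add_left scl_add_right ..
  finally show ?thesis by simp
qed

lemma an_cr: "an (cr f) = cr (an f) + f"
proof -
  have s: "complex_of_real (1 / sqrt 2) * complex_of_real (1 / sqrt 2) = 1 / 2"
    by (simp only: of_real_mult[symmetric]) simp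
  have "an (cr f) - cr (an f) = (1 / 2) *\<^sub>S (f + f)"
    unfolding an_eq cr_eq
    by (simp only: dif_simps mult_x_simps scl_add_right scl_diff_right scl_scl s) (simp add: algebra_simps)
  also have "\<dots> = (1 / 2 + 1 / 2) *\<^sub>S f" unfolding scl_add_left scl_add_right ..
  finally show ?thesis by (simp add: algebra_simps)
qed

lemma swf_in: "swf_fun f \<in> schwartz"
  by (rule swf_fun)

lemma sip_integrable: "integrable lborel (\<lambda>x. cnj (swf_fun f x) * swf_fun g x)"
  by (intro schwartz_integrable_mult schwartz_cnj swf_in)

lemma sip_eq: "sip f g = (LINT x|lborel. cnj (swf_fun f x) * swf_fun g x)"
  by (rule sip.rep_eq)

lemma sip_add_right: "sip f (g + h) = sip f g + sip f h"
  using sip_integrable[of f g] sip_integrable[of f h]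
  by (simp add: sip_eq plus_swf.rep_eq distrib_left)

lemma sip_scl_right [simp]: "sip f (c *\<^sub>S g) = c * sip f g"
  by (simp add: sip_eq scl.rep_eq mult.left_commute[of _ c])

lemma sip_commute: "sip f g = cnj (sip g f)"
proof -
  have "cnj (sip g f) = (LINT x|lborel. cnj (cnj (swf_fun g x) * swf_fun f x))"
    unfolding sip_eq using Bochner_Integration.integral_cnj[where M = lborel and f = "\<lambda>x. cnj (swf_fun g x) * swf_fun f x"] by (simp only:)
  then show ?thesis by (simp add: sip_eq mult.commute)
qed

lemma sip_add_left: "sip (f + g) h = sip f h + sip g h"
  by (subst (1 2 3) sip_commute) (simp add: sip_add_right)

lemma sip_scl_left [simp]: "sip (c *\<^sub>S f) g = cnj c * sip f g"
  by (subst (1 2) sip_commute) simp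

lemma sip_minus [simp]: "sip f (- g) = - sip f g" "sip (- f) g = - sip f g"
  using sip_scl_right[of f "-1" g] sip_scl_left[of "-1" f g] by simp_all

lemma sip_diff_right: "sip f (g - h) = sip f g - sip f h"
  and sip_diff_left: "sip (g - h) f = sip g f - sip h f"
  using sip_add_right[of f g "- h"] sip_add_left[of g "- h" f] by simp_all

lemma sip_zero [simp]: "sip f 0 = 0" "sip 0 f = 0"
  using sip_scl_right[of f 0 0] sip_scl_left[of 0 0 f] by simp_all

lemma sip_self: "sip f f = complex_of_real (LINT x|lborel. (cmod (swf_fun f x))\<^sup>2)"
proof -
  have "cnj z * z = complex_of_real ((cmod z)\<^sup>2)" for z
    by (simp only: complex_norm_square mult.commute)
  then show ?thesis unfolding sip_eq by (simp only: integral_complex_of_real)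
qed

lemma Re_sip_self_nonneg: "0 \<le> Re (sip f f)"
  by (simp add: sip_self)

lemma sip_mult_x: "sip (mult_x f) g = sip f (mult_x g)"
  by (simp add: sip_eq mult_x.rep_eq)

lemma sip_dif: "sip (dif f) g = - sip f (dif g)"
  unfolding sip_eq dif.rep_eq
  using schwartz_integral_by_parts[OF schwartz_cnj[OF swf_in[of f]] swf_in[of g]]
  by (simp only: dx_cnj[OF swf_in])

lemma sip_an: "sip (an f) g = sip f (cr g)"
  and sip_cr: "sip (cr f) g = sip f (an g)"
  by (simp_all add: an_eq cr_eq sip_add_left sip_add_right sip_diff_left sip_diff_right sip_mult_x sip_dif algebra_simps)

lemma sip_translate: "sip (translate c f) (translate c g) = sip f g"
  unfolding sip_eq translate.rep_eq
  using lborel_integral_real_affine[of 1 "\<lambda>x. cnj (swf_fun f x) * swf_fun g x" c]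
  by (simp add: add.commute)

subsection \<open>Hermite functions\<close>

lemma dif_gauss: "dif gauss = - mult_x gauss"
proof (transfer, rule dx_eqI)
  fix x :: real
  have "((\<lambda>x. exp (- x\<^sup>2 / 2)) has_real_derivative (- x * exp (- x\<^sup>2 / 2))) (at x)"
    by (auto intro!: derivative_eq_intros)
  then have "((\<lambda>x. complex_of_real (exp (- x\<^sup>2 / 2))) has_vector_derivative complex_of_real (- x * exp (- x\<^sup>2 / 2))) (at x)"
    by (intro has_vector_derivative_of_real) (simp add: has_real_derivative_iff_has_vector_derivative)
  then show "((\<lambda>x. complex_of_real (exp (- x\<^sup>2 / 2))) has_vector_derivative - (x *\<^sub>R complex_of_real (exp (- x\<^sup>2 / 2)))) (at x)"
    by (simp add: scaleR_conv_of_real)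
qed

lemma an_gauss: "an gauss = 0"
  by (simp add: an_eq dif_gauss)

lemma gauss_norm: "Re (sip gauss gauss) > 0"
proof -
  have "integrable lborel (\<lambda>x. (cmod (swf_fun gauss x))\<^sup>2)"
  proof -
    have "(cmod z)\<^sup>2 = Re (cnj z * z)" for z by (simp add: cmod_power2) (simp add: power2_eq_square)
    then show ?thesis using sip_integrable[of gauss gauss] by (simp only: integrable_Re)
  qed
  moreover have "\<not> (AE x in lborel. (cmod (swf_fun gauss x))\<^sup>2 = 0)"
    by (simp add: gauss.rep_eq ae_filter_eq_bot_iff)
  ultimately have "(LINT x|lborel. (cmod (swf_fun gauss x))\<^sup>2) \<noteq> 0"
    by (subst integral_nonneg_eq_0_iff_AE) auto
  then show ?thesis by (simp add: sip_self order_less_le eq_commute[of 0])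
qed

text \<open>Normalised Hermite functions, raised from the Gaussian ground state by the creation
  operator; Hermite polynomials never appear explicitly.\<close>

primrec hermite :: "nat \<Rightarrow> swf" where
  "hermite 0 = complex_of_real (1 / sqrt (Re (sip gauss gauss))) *\<^sub>S gauss"
| "hermite (Suc n) = complex_of_real (1 / sqrt (Suc n)) *\<^sub>S cr (hermite n)"

lemma cr_hermite: "cr (hermite n) = complex_of_real (sqrt (Suc n)) *\<^sub>S hermite (Suc n)"
  by (simp del: of_real_divide of_real_sqrt flip: of_real_mult)

lemma an_hermite_Suc: "an (hermite (Suc n)) = complex_of_real (sqrt (Suc n)) *\<^sub>S hermite n"
proof (induction n)
  case 0
  then show ?case by (simp add: an_cr an_gauss)
next
  case (Suc n)
  have "an (hermite (Suc (Suc n))) = complex_of_real (1 / sqrt (Suc (Suc n))) *\<^sub>S (cr (an (hermite (Suc n))) + hermite (Suc n))"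
    by (simp only: hermite.simps(2)[of "Suc n"] an_linear an_cr)
  also have "cr (an (hermite (Suc n))) = complex_of_real (sqrt (Suc n) * sqrt (Suc n)) *\<^sub>S hermite (Suc n)"
    by (simp only: Suc cr_linear cr_hermite scl_scl of_real_mult)
  also have "\<dots> + hermite (Suc n) = complex_of_real (real (Suc (Suc n))) *\<^sub>S hermite (Suc n)"
    using scl_add_left[of "complex_of_real (real (Suc n))" 1 "hermite (Suc n)"] by (simp add: add.commute)
  also have "complex_of_real (1 / sqrt (Suc (Suc n))) *\<^sub>S \<dots> = complex_of_real (sqrt (Suc (Suc n))) *\<^sub>S hermite (Suc n)"
    by (simp only: scl_scl of_real_mult[symmetric]) (simp add: real_div_sqrt)
  finally show ?case .
qed

lemma an_hermite_0: "an (hermite 0) = 0"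
  by (simp add: an_gauss)

lemma cr_an_hermite: "cr (an (hermite n)) = complex_of_real (real n) *\<^sub>S hermite n"
proof (cases n)
  case (Suc m)
  then show ?thesis
    by (simp only: Suc an_hermite_Suc cr_linear cr_hermite scl_scl of_real_mult[symmetric]) simp
qed (simp only: an_hermite_0 cr_linear, simp)

text \<open>Distinct indices are eigenvectors of the symmetric number operator for distinct
  eigenvalues; the norm is carried upwards by adjointness of \<open>cr\<close> and
  \<open>an\<close>.\<close>

lemma sip_hermite: "sip (hermite m) (hermite n) = (if m = n then 1 else 0)"
proof (cases "m = n")
  case False
  have "complex_of_real (real m) * sip (hermite m) (hermite n) = sip (cr (an (hermite m))) (hermite n)"
    by (simp add: cr_an_hermite)
  also have "\<dots> = sip (hermite m) (cr (an (hermite n)))" by (simp add: sip_cr sip_an)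
  also have "\<dots> = complex_of_real (real n) * sip (hermite m) (hermite n)" by (simp add: cr_an_hermite)
  finally show ?thesis using False by simp
next
  case True
  have "sip (hermite n) (hermite n) = 1"
  proof (induction n)
    case 0
    have "sip gauss gauss = complex_of_real (Re (sip gauss gauss))" by (simp add: sip_self)
    moreover have "complex_of_real (1 / sqrt r * (1 / sqrt r) * r) = 1" if "r > 0" for r
      using that by simp
    ultimately show ?case using gauss_norm
      by (simp only: hermite.simps sip_scl_left sip_scl_right complex_cnj_complex_of_real)
        (metis (no_types, lifting) mult.assoc of_real_mult)
  next
    case (Suc n)
    have "complex_of_real (sqrt (Suc n)) * sip (hermite (Suc n)) (hermite (Suc n)) = sip (cr (hermite n)) (hermite (Suc n))"
      by (simp only: cr_hermite sip_scl_left complex_cnj_complex_of_real)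
    also have "\<dots> = complex_of_real (sqrt (Suc n))"
      by (simp only: sip_cr an_hermite_Suc sip_scl_right Suc mult_1_right)
    finally show ?case by (simp del: hermite.simps)
  qed
  with True show ?thesis by simp
qed

section \<open>Completeness of the Hermite functions\<close>

lemma borel_measurable_cnj [measurable (raw)]:
  "f \<in> borel_measurable M \<Longrightarrow> (\<lambda>x. cnj (f x)) \<in> borel_measurable M"
  by (rule measurable_compose[OF _ borel_measurable_continuous_onI]) (auto intro!: continuous_intros)

lemma real_distribution_density:
  fixes p :: "real \<Rightarrow> real"
  assumes p: "integrable lborel p" "\<And>x. 0 \<le> p x" "(LINT x|lborel. p x) = 1"
  shows "real_distribution (density lborel (\<lambda>x. ennreal (p x)))"
proof -
  have "emeasure (density lborel (\<lambda>x. ennreal (p x))) UNIV = 1"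
    using p by (simp add: emeasure_density nn_integral_eq_integral)
  then have "prob_space (density lborel (\<lambda>x. ennreal (p x)))"
    by (intro prob_spaceI) simp
  then show ?thesis
    by (simp add: real_distribution_def real_distribution_axioms_def)
qed

text \<open>Positive and negative parts of \<open>r\<close> have the same Fourier transform. Once
  normalised they are probability densities, and Levy's uniqueness theorem for characteristic
  functions identifies them.\<close>

lemma fourier_vanishing_real:
  fixes r :: "real \<Rightarrow> real"
  assumes int: "integrable lborel r"
    and vanish: "\<And>t. (LINT x|lborel. complex_of_real (r x) * iexp (t * x)) = 0"
  shows "AE x in lborel. r x = 0"
proof -
  define p q where "p x = max (r x) 0" and "q x = max (- r x) 0" for x
  have r: "r x = p x - q x" for x by (simp add: p_def q_def)
  have pq: "integrable lborel p" "integrable lborel q" "\<And>x. 0 \<le> p x" "\<And>x. 0 \<le> q x"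
    using int by (auto simp: p_def[abs_def] q_def[abs_def])
  define c where "c = (LINT x|lborel. p x)"
  \<comment> \<open>Frequency 0 shows that both parts have the same mass \<open>c\<close>, so one
    constant normalises both.\<close>
  have "complex_of_real (LINT x|lborel. r x) = 0" using vanish[of 0] by simp
  then have c': "c = (LINT x|lborel. q x)" using pq(1,2) by (simp add: r c_def)
  show ?thesis
  proof (cases "c = 0")
    case True
    have "AE x in lborel. p x = 0" "AE x in lborel. q x = 0"
      using True c' integral_nonneg_eq_0_iff_AE[OF pq(1)] integral_nonneg_eq_0_iff_AE[OF pq(2)] pq(3,4)
      by (simp_all add: c_def)
    then show ?thesis by eventually_elim (simp add: r)
  next
    case False
    then have c: "c > 0" using pq by (simp add: c_def order_less_le eq_commute[of 0])
    have d: "real_distribution (density lborel (\<lambda>x. ennreal (p x / c)))"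
      "real_distribution (density lborel (\<lambda>x. ennreal (q x / c)))"
      using c pq c' by (auto intro!: real_distribution_density simp: c_def[symmetric])
    have char: "char (density lborel (\<lambda>x. ennreal (f x / c))) t = (LINT x|lborel. complex_of_real (f x) * iexp (t * x)) / c"
      if f: "integrable lborel f" "\<And>x. 0 \<le> f x" for f t
    proof -
      have [measurable]: "f \<in> borel_measurable borel" using f(1) by auto
      have "char (density lborel (\<lambda>x. ennreal (f x / c))) t = (LINT x|lborel. (f x / c) *\<^sub>R iexp (t * x))"
        unfolding char_def using f(2) c by (intro integral_density) auto
      also have "\<dots> = (LINT x|lborel. complex_of_real (f x) * iexp (t * x) / c)"
        by (simp add: scaleR_conv_of_real)
      finally show ?thesis by simp
    qed
    have int': "integrable lborel (\<lambda>x. complex_of_real (f x) * iexp (t * x))" if f: "integrable lborel f" for f t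
    proof -
      have [measurable]: "f \<in> borel_measurable borel" using f by auto
      show ?thesis
        by (rule Bochner_Integration.integrable_bound[OF f]) (auto simp: norm_mult)
    qed
    have "char (density lborel (\<lambda>x. ennreal (p x / c))) t = char (density lborel (\<lambda>x. ennreal (q x / c))) t" for t
    proof -
      have "(LINT x|lborel. complex_of_real (p x) * iexp (t * x)) - (LINT x|lborel. complex_of_real (q x) * iexp (t * x)) = 0"
        using vanish[of t] int'[OF pq(1)] int'[OF pq(2)] by (simp add: r left_diff_distrib)
      then show ?thesis using pq by (simp add: char)
    qed
    then have "density lborel (\<lambda>x. ennreal (p x / c)) = density lborel (\<lambda>x. ennreal (q x / c))"
      by (intro Levy_uniqueness d ext)
    then have "AE x in lborel. ennreal (p x / c) = ennreal (q x / c)"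
      using pq by (subst (asm) sigma_finite_measure.density_unique_iff[OF sigma_finite_lborel]) auto
    then show ?thesis by eventually_elim (use c pq in \<open>simp add: r\<close>)
  qed
qed

text \<open>Conjugation reflects the frequency, so the conjugate has vanishing transform too; hence
  so do the real and imaginary parts.\<close>

lemma fourier_vanishing:
  fixes u :: "real \<Rightarrow> complex"
  assumes int: "integrable lborel u"
    and vanish: "\<And>t. (LINT x|lborel. u x * iexp (t * x)) = 0"
  shows "AE x in lborel. u x = 0"
proof -
  have [measurable]: "u \<in> borel_measurable borel" using int by auto
  have i1: "integrable lborel (\<lambda>x. u x * iexp (t * x))" "integrable lborel (\<lambda>x. cnj (u x) * iexp (t * x))" for t
    by (rule Bochner_Integration.integrable_bound[OF int], measurable, simp add: norm_mult)+
  have vanish': "(LINT x|lborel. cnj (u x) * iexp (t * x)) = 0" for t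
  proof -
    have "cnj (u x) * iexp (t * x) = cnj (u x * iexp (- t * x))" for x
      by (simp add: exp_cnj)
    then have "(LINT x|lborel. cnj (u x) * iexp (t * x)) = cnj (LINT x|lborel. u x * iexp (- t * x))"
      by (simp only: Bochner_Integration.integral_cnj)
    then show ?thesis by (simp only: vanish complex_cnj_zero)
  qed
  have "AE x in lborel. Re (u x) = 0"
  proof (rule fourier_vanishing_real)
    fix t
    have "complex_of_real (Re (u x)) * iexp (t * x) = (u x * iexp (t * x) + cnj (u x) * iexp (t * x)) / 2" for x
      by (simp add: complex_add_cnj flip: distrib_right)
    then show "(LINT x|lborel. complex_of_real (Re (u x)) * iexp (t * x)) = 0"
      by (simp only: integral_divide_zero Bochner_Integration.integral_add[OF i1] vanish vanish') simp
  qed (use int in simp)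
  moreover have "AE x in lborel. Im (u x) = 0"
  proof (rule fourier_vanishing_real)
    fix t
    have "complex_of_real (Im (u x)) * iexp (t * x) = (u x * iexp (t * x) - cnj (u x) * iexp (t * x)) / (2 * \<i>)" for x
    proof -
      have "u x - cnj (u x) = complex_of_real (Im (u x)) * (2 * \<i>)" by (simp add: complex_eq_iff)
      then have "complex_of_real (Im (u x)) = (u x - cnj (u x)) / (2 * \<i>)"
        by (simp only:) (rule nonzero_mult_div_cancel_right[symmetric], simp)
      then show ?thesis by (simp only: left_diff_distrib times_divide_eq_left)
    qed
    then show "(LINT x|lborel. complex_of_real (Im (u x)) * iexp (t * x)) = 0"
      by (simp only: integral_divide_zero Bochner_Integration.integral_diff[OF i1] vanish vanish') simp
  qed (use int in simp)
  ultimately show ?thesis by eventually_elim (simp add: complex_eq_iff)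
qed

text \<open>Finite linear combinations. Since x is a multiple of \<open>an\<close> +
  \<open>cr\<close>, the set is stable under \<open>mult_x\<close> and contains every monomial times
  the Gaussian.\<close>

inductive_set hermite_span :: "swf set" where
  "hermite n \<in> hermite_span"
| "f \<in> hermite_span \<Longrightarrow> g \<in> hermite_span \<Longrightarrow> f + g \<in> hermite_span"
| "f \<in> hermite_span \<Longrightarrow> c *\<^sub>S f \<in> hermite_span"

lemma hermite_span_mult_x: "f \<in> hermite_span \<Longrightarrow> mult_x f \<in> hermite_span"
proof -
  have an: "an f \<in> hermite_span" if "f \<in> hermite_span" for f
    using that
  proof induction
    case (1 n)
    have "0 *\<^sub>S hermite 0 \<in> hermite_span" by (intro hermite_span.intros)
    then show ?case by (cases n) (auto simp: an_hermite_0 an_hermite_Suc intro: hermite_span.intros simp del: hermite.simps)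
  qed (auto intro: hermite_span.intros)
  have cr: "cr f \<in> hermite_span" if "f \<in> hermite_span" for f
    using that by induction (auto simp: cr_hermite intro: hermite_span.intros simp del: hermite.simps)
  assume "f \<in> hermite_span"
  then show ?thesis unfolding mult_x_eq by (intro hermite_span.intros an cr)
qed

lemma gauss_in_hermite_span: "(mult_x ^^ k) gauss \<in> hermite_span"
proof (induction k)
  case 0
  have "complex_of_real (sqrt (Re (sip gauss gauss))) *\<^sub>S hermite 0 \<in> hermite_span"
    by (intro hermite_span.intros)
  also have "complex_of_real (sqrt (Re (sip gauss gauss))) *\<^sub>S hermite 0 = gauss"
    using gauss_norm by (simp del: of_real_divide of_real_sqrt flip: of_real_mult)
  finally show ?case by simp
qed (simp add: hermite_span_mult_x)

lemma swf_fun_mult_x_power: "swf_fun ((mult_x ^^ k) f) x = complex_of_real (x ^ k) * swf_fun f x"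
  by (induction k) (simp_all add: mult_x.rep_eq scaleR_conv_of_real)

lemma square_integrable_mult:
  fixes f g :: "real \<Rightarrow> complex"
  assumes [measurable]: "f \<in> borel_measurable lborel" "g \<in> borel_measurable lborel"
    and int: "integrable lborel (\<lambda>x. (cmod (f x))\<^sup>2)" "integrable lborel (\<lambda>x. (cmod (g x))\<^sup>2)"
  shows "integrable lborel (\<lambda>x. f x * g x)"
proof (rule Bochner_Integration.integrable_bound[OF Bochner_Integration.integrable_add[OF int]])
  have "a * b \<le> a\<^sup>2 + b\<^sup>2" if "0 \<le> a" "0 \<le> b" for a b :: real
  proof -
    have "0 \<le> a * b" using that by simp
    with sum_squares_bound[of a b] show ?thesis by linarith
  qed
  then show "AE x in lborel. norm (f x * g x) \<le> norm ((cmod (f x))\<^sup>2 + (cmod (g x))\<^sup>2)"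
    by (simp add: norm_mult)
qed simp

text \<open>After undoing the translation, all moments of \<open>\<eta>\<close> times the Gaussian
  vanish. Expanding the exponential under the integral makes its Fourier transform vanish, hence the
  product itself, and the Gaussian is nowhere zero.\<close>

lemma hermite_total:
  fixes \<phi> :: "real \<Rightarrow> complex"
  assumes [measurable]: "\<phi> \<in> borel_measurable lborel" and int: "integrable lborel (\<lambda>x. (cmod (\<phi> x))\<^sup>2)"
    and orth: "\<And>n. (LINT x|lborel. cnj (swf_fun (translate c (hermite n)) x) * \<phi> x) = 0"
  shows "AE x in lborel. \<phi> x = 0"
proof -
  define \<eta> where "\<eta> x = \<phi> (x - c)" for x
  have [measurable]: "\<eta> \<in> borel_measurable lborel" unfolding \<eta>_def by measurable
  have \<eta>_int: "integrable lborel (\<lambda>x. (cmod (\<eta> x))\<^sup>2)"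
    unfolding \<eta>_def using lborel_integrable_real_affine[OF int, of 1 "- c"] by (simp add: algebra_simps)
  have sq: "integrable lborel (\<lambda>x. (cmod (swf_fun f x))\<^sup>2)" for f
  proof -
    have "(cmod z)\<^sup>2 = Re (cnj z * z)" for z by (simp add: cmod_power2) (simp add: power2_eq_square)
    then show ?thesis using sip_integrable[of f f] by (simp only: integrable_Re)
  qed
  have meas [measurable]: "swf_fun f \<in> borel_measurable borel" for f
    using schwartz_measurable[OF swf_in[of f]] by simp
  have prod_int: "integrable lborel (\<lambda>x. cnj (swf_fun f x) * \<eta> x)" for f
    by (rule square_integrable_mult) (auto simp: sq \<eta>_int)
  have orth': "(LINT x|lborel. cnj (swf_fun f x) * \<eta> x) = 0" if "f \<in> hermite_span" for f
    using that
  proof induction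
    case (1 n)
    have "(LINT x|lborel. cnj (swf_fun (hermite n) x) * \<eta> x) = (LINT x|lborel. cnj (swf_fun (translate c (hermite n)) x) * \<phi> x)"
      using lborel_integral_real_affine[of 1 "\<lambda>x. cnj (swf_fun (hermite n) x) * \<eta> x" c]
      by (simp add: translate.rep_eq \<eta>_def add.commute del: hermite.simps)
    then show ?case by (simp only: orth)
  next
    case (2 f g)
    then show ?case using prod_int[of f] prod_int[of g] by (simp add: plus_swf.rep_eq distrib_right)
  next
    case (3 f c)
    then show ?case by (simp add: scl.rep_eq mult.assoc)
  qed
  define u where "u x = \<eta> x * complex_of_real (exp (- x\<^sup>2 / 2))" for x
  have [measurable]: "u \<in> borel_measurable borel" unfolding u_def by measurable
  have moments: "(LINT x|lborel. complex_of_real (x ^ k) * u x) = 0" for k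
    using orth'[OF gauss_in_hermite_span[of k]]
    by (simp add: swf_fun_mult_x_power gauss.rep_eq u_def mult_ac)
  have gauss_int: "integrable lborel (\<lambda>x. a * exp (- x\<^sup>2 / 2))" for a :: real
  proof -
    obtain b where b: "\<And>x. norm (swf_fun gauss x) \<le> b / (1 + x\<^sup>2)" "b > 0"
      using schwartz_decay[OF swf_in[of gauss]] by blast
    have "integrable lborel (\<lambda>x :: real. exp (- x\<^sup>2 / 2))"
      by (rule Bochner_Integration.integrable_bound[OF integrable_inverse_one_plus_square[of b]])
        (use b in \<open>auto simp: gauss.rep_eq\<close>)
    then show ?thesis by simp
  qed
  have growth: "integrable lborel (\<lambda>x. cmod (u x) * exp \<bar>t * x\<bar>)" for t
  proof -
    have "integrable lborel (\<lambda>x. (cmod (complex_of_real (exp (\<bar>t * x\<bar> - x\<^sup>2 / 2))))\<^sup>2)"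
    proof (rule Bochner_Integration.integrable_bound[OF gauss_int[of "exp (2 * t\<^sup>2)"]])
      \<comment> \<open>Completing the square pays for exp(2 |t x|) with half of the squared
        Gaussian's exponent; the other half remains integrable.\<close>
      have *: "2 * \<bar>t * x\<bar> \<le> 2 * t\<^sup>2 + x\<^sup>2 / 2" for x :: real
        using sum_squares_bound[of "2 * \<bar>t\<bar>" "\<bar>x\<bar>"] by (simp add: abs_mult power_mult_distrib)
      have "exp (\<bar>t * x\<bar> - x\<^sup>2 / 2) * exp (\<bar>t * x\<bar> - x\<^sup>2 / 2) \<le> exp (2 * t\<^sup>2) * exp (- x\<^sup>2 / 2)" for x
        unfolding exp_add[symmetric] exp_le_cancel_iff using *[of x] by linarith
      then show "AE x in lborel. norm ((cmod (complex_of_real (exp (\<bar>t * x\<bar> - x\<^sup>2 / 2))))\<^sup>2)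
          \<le> norm (exp (2 * t\<^sup>2) * exp (- x\<^sup>2 / 2))"
        by (simp add: power2_eq_square)
    qed measurable
    from square_integrable_mult[OF _ _ \<eta>_int this]
    have "integrable lborel (\<lambda>x. \<eta> x * complex_of_real (exp (\<bar>t * x\<bar> - x\<^sup>2 / 2)))" by simp
    then have "integrable lborel (\<lambda>x. norm (\<eta> x * complex_of_real (exp (\<bar>t * x\<bar> - x\<^sup>2 / 2))))"
      by (rule integrable_norm)
    moreover have "exp (\<bar>t * x\<bar> - x\<^sup>2 / 2) = exp (- x\<^sup>2 / 2) * exp \<bar>t * x\<bar>" for x
      unfolding exp_add[symmetric] by simp
    ultimately show ?thesis by (simp only: u_def norm_mult norm_of_real abs_mult abs_exp_cancel mult.assoc)
  qed
  have u_int: "integrable lborel u"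
    by (rule Bochner_Integration.integrable_bound[OF growth[of 0]]) auto
  have "(LINT x|lborel. u x * iexp (t * x)) = 0" for t
  proof -
    \<comment> \<open>Partial sums of the exponential series times \<open>u\<close>: each integrates
      to a combination of moments, and all are dominated by \<open>growth\<close>.\<close>
    define s where "s n x = (\<Sum>k<n. (\<i> * complex_of_real (t * x)) ^ k /\<^sub>R fact k) * u x" for n x
    have "(\<lambda>n. LINT x|lborel. s n x) \<longlonglongrightarrow> (LINT x|lborel. iexp (t * x) * u x)"
    proof (rule integral_dominated_convergence[OF _ _ growth[of t]])
      show "AE x in lborel. (\<lambda>n. s n x) \<longlonglongrightarrow> iexp (t * x) * u x"
        using exp_converges unfolding s_def sums_def
        by (intro always_eventually allI tendsto_mult tendsto_const) blast
      have "norm (s n x) \<le> cmod (u x) * exp \<bar>t * x\<bar>" for n x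
      proof -
        have "norm (\<Sum>k<n. (\<i> * complex_of_real (t * x)) ^ k /\<^sub>R fact k) \<le> (\<Sum>k<n. \<bar>t * x\<bar> ^ k /\<^sub>R fact k)"
          by (rule order_trans[OF norm_sum]) (simp add: norm_mult norm_power abs_mult)
        also have "\<dots> \<le> exp \<bar>t * x\<bar>"
          unfolding exp_def by (intro sum_le_suminf summable_exp_generic) auto
        finally show ?thesis by (simp add: s_def norm_mult mult.commute mult_left_mono)
      qed
      then show "\<And>n. AE x in lborel. norm (s n x) \<le> cmod (u x) * exp \<bar>t * x\<bar>" by simp
    qed (auto simp: s_def)
    moreover have "(LINT x|lborel. s n x) = 0" for n
    proof -
      have "s n x = (\<Sum>k<n. ((\<i> * t) ^ k /\<^sub>R fact k) * (complex_of_real (x ^ k) * u x))" for x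
        unfolding s_def sum_distrib_right by (simp add: power_mult_distrib mult_ac scaleR_conv_of_real)
      moreover have "integrable lborel (\<lambda>x. complex_of_real (x ^ k) * u x)" for k
      proof -
        have "integrable lborel (\<lambda>x. cnj (swf_fun ((mult_x ^^ k) gauss) x) * \<eta> x)" by (rule prod_int)
        then show ?thesis by (simp add: swf_fun_mult_x_power gauss.rep_eq u_def mult_ac)
      qed
      ultimately show ?thesis
        by (simp only: Bochner_Integration.integral_sum Bochner_Integration.integrable_mult_right
            integral_mult_right_zero moments) simp
    qed
    ultimately have "(LINT x|lborel. iexp (t * x) * u x) = 0"
      using LIMSEQ_unique[OF _ tendsto_const] by simp
    then show ?thesis by (simp add: mult.commute)
  qed
  from fourier_vanishing[OF u_int this] have "AE x in lborel. \<eta> x = 0"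
    by (simp add: u_def)
  then have "AE x in distr lborel borel ((+) (- c)). \<phi> x = 0"
    by (subst AE_distr_iff) (auto simp: \<eta>_def)
  then show ?thesis by (simp only: lborel_distr_plus)
qed

subsection \<open>Schwartz spinors\<close>

definition spinor_fun :: "swf \<times> swf \<Rightarrow> real \<Rightarrow> complex ^ 2" where
  "spinor_fun p x = vector [swf_fun (fst p) x, swf_fun (snd p) x]"

definition sket :: "swf \<times> swf \<Rightarrow> spinor" where
  "sket p = ket (spinor_fun p)"

definition pscl :: "complex \<Rightarrow> swf \<times> swf \<Rightarrow> swf \<times> swf" (infixr \<open>*\<^sub>P\<close> 75) where
  "c *\<^sub>P p = (c *\<^sub>S fst p, c *\<^sub>S snd p)"

definition pip :: "swf \<times> swf \<Rightarrow> swf \<times> swf \<Rightarrow> complex" where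
  "pip p q = sip (fst p) (fst q) + sip (snd p) (snd q)"

lemma pscl_Pair [simp]: "c *\<^sub>P (f, g) = (c *\<^sub>S f, c *\<^sub>S g)"
  by (simp add: pscl_def)

lemma pip_Pair [simp]: "pip (f, g) (f', g') = sip f f' + sip g g'"
  by (simp add: pip_def)

lemma vec_nth_borel_measurable [measurable (raw)]:
  "f \<in> borel_measurable M \<Longrightarrow> (\<lambda>x. (f x :: complex ^ 2) $ i) \<in> borel_measurable M"
  by (rule measurable_compose[OF _ borel_measurable_continuous_onI]) (auto intro!: continuous_intros)

lemma spinor_fun_nth [simp]: "spinor_fun p x $ 1 = swf_fun (fst p) x" "spinor_fun p x $ 2 = swf_fun (snd p) x"
  by (simp_all add: spinor_fun_def vector_2)

lemma spinor_fun_sq_int: "sq_int (spinor_fun p)"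
  unfolding sq_int_def
proof
  have "spinor_fun p = (\<lambda>x. \<chi> i. if i = 1 then swf_fun (fst p) x else swf_fun (snd p) x)"
    by (simp add: fun_eq_iff vec2_ext)
  moreover have "continuous_on UNIV (\<lambda>x. if i = 1 then swf_fun (fst p) x else swf_fun (snd p) x)" for i :: 2
    by (cases "i = 1") (simp_all add: schwartz_continuous swf_in)
  then have "continuous_on UNIV (\<lambda>x. \<chi> i::2. if i = 1 then swf_fun (fst p) x else swf_fun (snd p) x)"
    by (rule continuous_on_vec_lambda)
  ultimately show "spinor_fun p \<in> borel_measurable lborel"
    by (simp add: borel_measurable_continuous_onI)
  have "(norm v)\<^sup>2 = Re (cnj (v $ 1) * v $ 1) + Re (cnj (v $ 2) * v $ 2)" for v :: "complex ^ 2"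
    by (simp add: norm_vec_def L2_set_def sum_2 cmod_power2) (simp add: power2_eq_square)
  then show "integrable lborel (\<lambda>x. (norm (spinor_fun p x))\<^sup>2)"
    using sip_integrable[of "fst p" "fst p"] sip_integrable[of "snd p" "snd p"]
    by (simp only: spinor_fun_nth integrable_Re Bochner_Integration.integrable_add)
qed

lemma cinner_ket:
  assumes "sq_int f" "sq_int g"
  shows "cinner (ket f) (ket g) = (LINT x|lborel. cnj (f x $ 1) * g x $ 1 + cnj (f x $ 2) * g x $ 2)"
  using assms by (simp add: cinner.abs_eq spinor_rel_def sum_2)

lemma cinner_sket: "cinner (sket p) (sket q) = pip p q"
  unfolding sket_def pip_def sip_eq
  by (simp add: cinner_ket spinor_fun_sq_int sip_integrable)

lemma component_square_integrable:
  assumes "sq_int f"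
  shows "(\<lambda>x. f x $ i) \<in> borel_measurable lborel" "integrable lborel (\<lambda>x. (cmod (f x $ i))\<^sup>2)"
proof -
  have [measurable]: "f \<in> borel_measurable lborel" using assms by (simp add: sq_int_def)
  show "(\<lambda>x. f x $ i) \<in> borel_measurable lborel" by measurable
  show "integrable lborel (\<lambda>x. (cmod (f x $ i))\<^sup>2)"
    by (rule Bochner_Integration.integrable_bound[of _ "\<lambda>x. (norm (f x))\<^sup>2"])
      (use assms in \<open>auto simp: sq_int_def intro!: power_mono Finite_Cartesian_Product.norm_nth_le\<close>)
qed

lemma swf_square_integrable: "integrable lborel (\<lambda>x. (cmod (swf_fun f x))\<^sup>2)"
  using component_square_integrable(2)[OF spinor_fun_sq_int[of "(f, 0)"], of 1] by simp

lemma cinner_sket_eq: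
  "cinner (sket p) \<psi> = (LINT x|lborel. cnj (swf_fun (fst p) x) * rep_spinor \<psi> x $ 1)
    + (LINT x|lborel. cnj (swf_fun (snd p) x) * rep_spinor \<psi> x $ 2)"
proof -
  have "integrable lborel (\<lambda>x. cnj (swf_fun f x) * rep_spinor \<psi> x $ i)" for f i
    by (rule square_integrable_mult)
      (use component_square_integrable[OF sq_int_rep] schwartz_measurable[OF swf_in[of f]] swf_square_integrable
        in auto)
  moreover have "cinner (sket p) (ket (rep_spinor \<psi>)) = (LINT x|lborel. cnj (swf_fun (fst p) x) * rep_spinor \<psi> x $ 1
      + cnj (swf_fun (snd p) x) * rep_spinor \<psi> x $ 2)"
    unfolding sket_def by (simp only: cinner_ket spinor_fun_sq_int sq_int_rep spinor_fun_nth)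
  ultimately show ?thesis by simp
qed

lemma sket_add: "sket (p + q) = sket p + sket q"
  and sket_diff: "sket (p - q) = sket p - sket q"
  and sket_scl: "sket (c *\<^sub>P p) = c *\<^sub>C sket p"
proof -
  have "spinor_fun (p + q) = (\<lambda>x. spinor_fun p x + spinor_fun q x)"
    "spinor_fun (p - q) = (\<lambda>x. spinor_fun p x - spinor_fun q x)"
    "spinor_fun (c *\<^sub>P p) = (\<lambda>x. c *s spinor_fun p x)"
    by (simp_all add: fun_eq_iff vec2_ext plus_swf.rep_eq minus_swf.rep_eq scl.rep_eq pscl_def)
  then show "sket (p + q) = sket p + sket q" "sket (p - q) = sket p - sket q" "sket (c *\<^sub>P p) = c *\<^sub>C sket p"
    by (simp_all add: sket_def ket_add ket_diff ket_scale spinor_fun_sq_int)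
qed

lemma sket_0 [simp]: "sket 0 = 0"
  using sket_add[of 0 0] by simp

lemma sket_sum: "sket (\<Sum>i\<in>I. f i) = (\<Sum>i\<in>I. sket (f i))"
  by (induction I rule: infinite_finite_induct) (auto simp: sket_add)

lemma range_spinor_fun: "range spinor_fun = schwartz_spinor"
proof (rule set_eqI)
  fix \<Psi>
  have "\<Psi> \<in> schwartz_spinor \<longleftrightarrow> (\<lambda>x. \<Psi> x $ 1) \<in> schwartz \<and> (\<lambda>x. \<Psi> x $ 2) \<in> schwartz"
    by (simp add: schwartz_spinor_def forall_2)
  also have "\<dots> \<longleftrightarrow> (\<exists>f g. (\<lambda>x. \<Psi> x $ 1) = swf_fun f \<and> (\<lambda>x. \<Psi> x $ 2) = swf_fun g)"
  proof -
    have "h \<in> schwartz \<longleftrightarrow> (\<exists>f. h = swf_fun f)" for h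
      by (auto simp: Swf_inverse swf_in intro!: exI[of _ "Swf h"])
    then show ?thesis by simp
  qed
  also have "\<dots> \<longleftrightarrow> \<Psi> \<in> range spinor_fun"
    by (simp add: image_iff fun_eq_iff vec2_ext all_conj_distrib)
  finally show "\<Psi> \<in> range spinor_fun \<longleftrightarrow> \<Psi> \<in> schwartz_spinor" by simp
qed

text \<open>Counterpart of \<open>core_closure\<close> for total maps on pairs of
  \<open>swf\<close>, where operator identities are plain algebra.\<close>

definition graph :: "(swf \<times> swf \<Rightarrow> swf \<times> swf) \<Rightarrow> operator" where
  "graph T = closure (range (\<lambda>p. (sket p, sket (T p))))"

lemma core_closure_eq_graph:
  assumes "\<And>p. S (spinor_fun p) = spinor_fun (T p)"
  shows "core_closure S = graph T"
  unfolding core_closure_def graph_def range_spinor_fun[symmetric] image_image sket_def assms ..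

lemma in_graph: "(sket p, sket (T p)) \<in> graph T"
  unfolding graph_def by (rule subsetD[OF closure_subset rangeI])

definition plinear :: "(swf \<times> swf \<Rightarrow> swf \<times> swf) \<Rightarrow> bool" where
  "plinear T \<longleftrightarrow> (\<forall>p q. T (p + q) = T p + T q) \<and> (\<forall>c p. T (c *\<^sub>P p) = c *\<^sub>P T p)"

definition psym :: "(swf \<times> swf \<Rightarrow> swf \<times> swf) \<Rightarrow> bool" where
  "psym T \<longleftrightarrow> (\<forall>p q. pip (T p) q = pip p (T q))"

lemma plinearD: "plinear T \<Longrightarrow> T (p + q) = T p + T q" "plinear T \<Longrightarrow> T (c *\<^sub>P p) = c *\<^sub>P T p"
  unfolding plinear_def by blast+

lemma psymD: "psym T \<Longrightarrow> pip (T p) q = pip p (T q)"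
  unfolding psym_def by blast

lemma plinear_sum:
  assumes "plinear T"
  shows "T (\<Sum>i\<in>I. c i *\<^sub>P p i) = (\<Sum>i\<in>I. c i *\<^sub>P T (p i))"
proof -
  have "T 0 = 0" using plinearD(1)[OF assms, of 0 0] by simp
  then show ?thesis
    by (induction I rule: infinite_finite_induct) (simp_all add: plinearD[OF assms])
qed

text \<open>The eigenvectors are themselves Schwartz spinors, so finite eigenvector sums lie in the
  core whose closure defines the operator.\<close>

locale schwartz_basis = orthonormal_basis "\<lambda>k. sket (v k)" for v :: "nat \<Rightarrow> swf \<times> swf" +
  fixes T :: "swf \<times> swf \<Rightarrow> swf \<times> swf" and \<mu> :: "nat \<Rightarrow> real"
  assumes lin: "plinear T" and sym: "psym T" and eigen: "T (v k) = complex_of_real (\<mu> k) *\<^sub>P v k"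
begin

lemma coeff_T: "cinner (sket (v k)) (sket (T p)) = complex_of_real (\<mu> k) * cinner (sket (v k)) (sket p)"
proof -
  have "pip (v k) (T p) = pip (T (v k)) p" by (rule psymD[OF sym, symmetric])
  also have "\<dots> = complex_of_real (\<mu> k) * pip (v k) p" by (simp add: eigen pip_def pscl_def distrib_left)
  finally show ?thesis by (simp add: cinner_sket)
qed

text \<open>Symmetry on the Schwartz spinors puts the closure inside the diagonal operator, and truncated
  expansions, which are Schwartz spinors, give the converse.\<close>

theorem graph_eq_diag: "graph T = diag \<mu>"
proof
  show "graph T \<subseteq> diag \<mu>"
    unfolding graph_def by (rule closure_minimal[OF _ closed_diag]) (auto simp: diag_def coeff_T)
  show "diag \<mu> \<subseteq> graph T"
  proof clarify
    fix \<psi> \<eta> assume d: "(\<psi>, \<eta>) \<in> diag \<mu>"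
    define p where "p n = (\<Sum>k<n. cinner (sket (v k)) \<psi> *\<^sub>P v k)" for n
    have "sket (p n) = trunc n \<psi>" for n
      by (simp add: p_def trunc_def sket_sum sket_scl)
    moreover have "sket (T (p n)) = trunc n \<eta>" for n
      using d by (simp add: p_def plinear_sum[OF lin] eigen trunc_def sket_sum sket_scl diag_def mult.commute)
    ultimately have "(\<lambda>n. (sket (p n), sket (T (p n)))) \<longlonglongrightarrow> (\<psi>, \<eta>)"
      by (simp add: tendsto_Pair trunc_tendsto)
    then show "(\<psi>, \<eta>) \<in> graph T"
      unfolding graph_def closure_sequential by (intro exI[of _ "\<lambda>n. (sket (p n), sket (T (p n)))"]) auto
  qed
qed

text \<open>A quadratic form becomes a weighted series of squared coefficients; forms along an orbit
  can then be compared coefficient by coefficient.\<close>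

lemma form_sums: "(\<lambda>k. \<mu> k * (cmod (cinner (sket (v k)) (sket p)))\<^sup>2) sums Re (pip p (T p))"
proof -
  have "(\<lambda>k. Re (cnj (cinner (sket (v k)) (sket p)) * cinner (sket (v k)) (sket (T p)))) sums Re (cinner (sket p) (sket (T p)))"
    by (intro sums_Re parseval)
  moreover have "Re (cnj z * (complex_of_real m * z)) = m * (cmod z)\<^sup>2" for z m
    by (simp add: cmod_power2 algebra_simps) (simp add: power2_eq_square)
  ultimately show ?thesis by (simp only: coeff_T cinner_sket[of p])
qed

end

section \<open>The Hamiltonians as algebraic maps on pairs\<close>

definition num_p :: "swf \<times> swf \<Rightarrow> swf \<times> swf" where "num_p p = (cr (an (fst p)), cr (an (snd p)))"
definition sz_p :: "swf \<times> swf \<Rightarrow> swf \<times> swf" where "sz_p p = (fst p, - snd p)"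
text \<open>The rotating coupling, called G in the overview; \<open>ctr_p\<close> is the
  counter-rotating C, and their sum is \<sigma>x tensored with a plus its adjoint.\<close>

definition rot_p :: "swf \<times> swf \<Rightarrow> swf \<times> swf" where "rot_p p = (an (snd p), cr (fst p))"
definition ctr_p :: "swf \<times> swf \<Rightarrow> swf \<times> swf" where "ctr_p p = (cr (snd p), an (fst p))"

text \<open>\<open>alt_p\<close> is \<open>\<sigma>\<^sub>+ \<otimes> a\<^sup>\<dagger> - \<sigma>\<^sub>- \<otimes> a\<close>: its commutator with \<open>H\<^sub>0\<close> is proportional to the
  counter-rotating term \<open>ctr_p\<close>, so it takes the role of the integrated action.\<close>

definition alt_p :: "swf \<times> swf \<Rightarrow> swf \<times> swf" where "alt_p p = (cr (snd p), - an (fst p))"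

lemmas p_defs = num_p_def sz_p_def rot_p_def ctr_p_def alt_p_def

definition rwa_p :: "real \<Rightarrow> real \<Rightarrow> real \<Rightarrow> swf \<times> swf \<Rightarrow> swf \<times> swf" where
  "rwa_p l \<Omega> \<omega> p = complex_of_real (\<Omega> / 2) *\<^sub>P sz_p p + complex_of_real \<omega> *\<^sub>P num_p p + complex_of_real l *\<^sub>P rot_p p"

definition rabi_p :: "real \<Rightarrow> real \<Rightarrow> real \<Rightarrow> swf \<times> swf \<Rightarrow> swf \<times> swf" where
  "rabi_p l \<Omega> \<omega> p = rwa_p l \<Omega> \<omega> p + complex_of_real l *\<^sub>P ctr_p p"

lemma pscl_algebra:
  "c *\<^sub>P (p + q) = c *\<^sub>P p + c *\<^sub>P q" "c *\<^sub>P (p - q) = c *\<^sub>P p - c *\<^sub>P q" "c *\<^sub>P d *\<^sub>P p = (c * d) *\<^sub>P p"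
  "c *\<^sub>P (- p) = - (c *\<^sub>P p)" "(c + d) *\<^sub>P p = c *\<^sub>P p + d *\<^sub>P p" "1 *\<^sub>P p = p"
  by (simp_all add: pscl_def prod_eq_iff scl_add_right scl_diff_right scl_add_left)

lemma pip_algebra:
  "pip (p + q) r = pip p r + pip q r" "pip r (p + q) = pip r p + pip r q"
  "pip (c *\<^sub>P p) q = cnj c * pip p q" "pip p (c *\<^sub>P q) = c * pip p q"
  by (simp_all add: pip_def pscl_def sip_add_left sip_add_right algebra_simps)

lemma p_linear: "plinear num_p" "plinear sz_p" "plinear rot_p" "plinear ctr_p" "plinear alt_p"
  by (auto simp: plinear_def p_defs pscl_def)

lemma p_sym: "psym num_p" "psym sz_p" "psym rot_p" "psym ctr_p"
  by (auto simp: psym_def p_defs pip_def sip_an sip_cr add.commute)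

lemma plinear_add: "plinear S \<Longrightarrow> plinear T \<Longrightarrow> plinear (\<lambda>p. S p + T p)"
  and plinear_scl: "plinear S \<Longrightarrow> plinear (\<lambda>p. c *\<^sub>P S p)"
  by (auto simp: plinear_def pscl_algebra mult.commute)

lemma psym_add: "psym S \<Longrightarrow> psym T \<Longrightarrow> psym (\<lambda>p. S p + T p)"
  and psym_scl: "psym S \<Longrightarrow> psym (\<lambda>p. complex_of_real r *\<^sub>P S p)"
  by (auto simp: psym_def pip_algebra)

lemma tensor_spinor_fun:
  assumes "\<And>f. T (swf_fun f) = swf_fun (t f)"
  shows "tensor M T (spinor_fun p) x = M *v spinor_fun (t (fst p), t (snd p)) x"
proof -
  have "(\<chi> i. T (\<lambda>y. spinor_fun p y $ i) x) = spinor_fun (t (fst p), t (snd p)) x"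
    using assms by (simp add: vec2_ext)
  then show ?thesis by (simp only: tensor_def)
qed

lemma pauli_mult:
  "\<sigma>x *v v = vector [v $ 2, v $ 1]" "\<sigma>z *v v = vector [v $ 1, - v $ 2]"
  "\<sigma>plus *v v = vector [v $ 2, 0]" "\<sigma>minus *v v = vector [0, v $ 1]"
  by (simp_all add: \<sigma>x_def \<sigma>z_def \<sigma>plus_def \<sigma>minus_def vec2_ext matrix_vector_mult_def sum_2 vector_2)

lemmas tensor_cases =
  tensor_spinor_fun[where T = id and t = id, simplified]
  tensor_spinor_fun[where T = "cre \<circ> ann" and t = "\<lambda>f. cr (an f)"]
  tensor_spinor_fun[where T = ann and t = an]
  tensor_spinor_fun[where T = cre and t = cr]
  tensor_spinor_fun[where T = "\<lambda>f x. ann f x + cre f x" and t = "\<lambda>f. an f + cr f"]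

lemmas swf_rep_eqs = plus_swf.rep_eq minus_swf.rep_eq uminus_swf.rep_eq zero_swf.rep_eq scl.rep_eq an.rep_eq cr.rep_eq

lemma num_op_eq: "num_op = graph num_p"
  unfolding num_op_def
  by (rule core_closure_eq_graph)
    (simp add: fun_eq_iff tensor_cases swf_rep_eqs num_p_def)

lemma H0_eq: "H0 \<omega> = graph (\<lambda>p. complex_of_real (\<omega> / 2) *\<^sub>P sz_p p + complex_of_real \<omega> *\<^sub>P num_p p)"
  unfolding H0_def
  by (rule core_closure_eq_graph)
    (simp add: fun_eq_iff tensor_cases swf_rep_eqs pscl_def p_defs pauli_mult vec2_ext vector_2,
      simp add: scaleR_conv_of_real)

lemma H_RWA_eq: "H_RWA l \<Omega> \<omega> = graph (rwa_p l \<Omega> \<omega>)"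
  unfolding H_RWA_def
  by (rule core_closure_eq_graph)
    (simp add: fun_eq_iff tensor_cases swf_rep_eqs pscl_def p_defs rwa_p_def pauli_mult vec2_ext vector_2,
      simp add: scaleR_conv_of_real)

lemma H_eq: "H l \<Omega> \<omega> = graph (rabi_p l \<Omega> \<omega>)"
  unfolding H_def
  by (rule core_closure_eq_graph)
    (simp add: fun_eq_iff tensor_cases swf_rep_eqs pscl_def p_defs rwa_p_def rabi_p_def pauli_mult vec2_ext vector_2,
      simp add: scaleR_conv_of_real algebra_simps)

subsection \<open>Eigenbases\<close>

text \<open>Pairing with a fixed spin direction and a common translation turns the spinor question
  into scalar completeness for one combination of components.\<close>

lemma combination_vanishes:
  assumes "\<And>n. cinner (sket (a *\<^sub>S translate c (hermite n), b *\<^sub>S translate c (hermite n))) \<psi> = 0"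
  shows "AE x in lborel. cnj a * rep_spinor \<psi> x $ 1 + cnj b * rep_spinor \<psi> x $ 2 = 0"
proof (rule hermite_total)
  note comp = component_square_integrable[OF sq_int_rep[of \<psi>]]
  note [measurable] = comp(1)
  show "(\<lambda>x. cnj a * rep_spinor \<psi> x $ 1 + cnj b * rep_spinor \<psi> x $ 2) \<in> borel_measurable lborel"
    by measurable
  show "integrable lborel (\<lambda>x. (cmod (cnj a * rep_spinor \<psi> x $ 1 + cnj b * rep_spinor \<psi> x $ 2))\<^sup>2)"
  proof (rule Bochner_Integration.integrable_bound)
    show "integrable lborel (\<lambda>x. 2 * (cmod a)\<^sup>2 * (cmod (rep_spinor \<psi> x $ 1))\<^sup>2
        + 2 * (cmod b)\<^sup>2 * (cmod (rep_spinor \<psi> x $ 2))\<^sup>2)"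
      using comp(2) by simp
    have "(cmod (z + w))\<^sup>2 \<le> 2 * (cmod z)\<^sup>2 + 2 * (cmod w)\<^sup>2" for z w
    proof -
      have "(cmod (z + w))\<^sup>2 \<le> (cmod z + cmod w)\<^sup>2" by (intro power_mono norm_triangle_ineq) auto
      also have "\<dots> \<le> 2 * (cmod z)\<^sup>2 + 2 * (cmod w)\<^sup>2"
        using sum_squares_bound[of "cmod z" "cmod w"] by (simp add: power2_sum)
      finally show ?thesis .
    qed
    from this[of "cnj a * _" "cnj b * _"]
    show "AE x in lborel. norm ((cmod (cnj a * rep_spinor \<psi> x $ 1 + cnj b * rep_spinor \<psi> x $ 2))\<^sup>2)
        \<le> norm (2 * (cmod a)\<^sup>2 * (cmod (rep_spinor \<psi> x $ 1))\<^sup>2 + 2 * (cmod b)\<^sup>2 * (cmod (rep_spinor \<psi> x $ 2))\<^sup>2)"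
      by (simp add: norm_mult power_mult_distrib mult.assoc)
  qed measurable
  fix n
  have "integrable lborel (\<lambda>x. cnj (swf_fun f x) * rep_spinor \<psi> x $ i)" for f i
    by (rule square_integrable_mult)
      (use comp schwartz_measurable[OF swf_in[of f]] swf_square_integrable in auto)
  then show "(LINT x|lborel. cnj (swf_fun (translate c (hermite n)) x) *
      (cnj a * rep_spinor \<psi> x $ 1 + cnj b * rep_spinor \<psi> x $ 2)) = 0"
    using assms[of n] unfolding cinner_sket_eq
    by (simp add: scl.rep_eq distrib_left mult.left_commute[of _ "cnj a"] mult.left_commute[of _ "cnj b"] mult.assoc
        del: hermite.simps)
qed

lemma spinor_eq_0:
  assumes "AE x in lborel. rep_spinor \<psi> x $ 1 = 0" "AE x in lborel. rep_spinor \<psi> x $ 2 = 0"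
  shows "\<psi> = 0"
proof -
  have "AE x in lborel. rep_spinor \<psi> x = 0"
    using assms by eventually_elim (simp add: vec2_ext)
  then have "ket (rep_spinor \<psi>) = ket (\<lambda>_. 0)"
    by (subst ket_eq_iff) (auto simp: sq_int_rep sq_int_0)
  then show ?thesis by (simp add: zero_spinor_def)
qed

text \<open>Even indices carry spin up and odd ones spin down; \<open>k div 2\<close> is the
  oscillator level.\<close>

definition std :: "nat \<Rightarrow> swf \<times> swf" where
  "std k = (if even k then (hermite (k div 2), 0) else (0, hermite (k div 2)))"

lemma translate_0 [simp]: "translate 0 f = f"
  by transfer simp

lemma parity_half_inj: "i div 2 = j div 2 \<Longrightarrow> even i = even j \<Longrightarrow> i = (j :: nat)"
  by (metis dvd_mult_div_cancel odd_two_times_div_two_succ)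

lemma std_total:
  assumes "\<And>n. cinner (sket (hermite n, 0)) \<psi> = 0" "\<And>n. cinner (sket (0, hermite n)) \<psi> = 0"
  shows "\<psi> = 0"
proof (rule spinor_eq_0)
  show "AE x in lborel. rep_spinor \<psi> x $ 1 = 0"
    using combination_vanishes[of 1 0 0 \<psi>] assms by (simp del: hermite.simps)
  show "AE x in lborel. rep_spinor \<psi> x $ 2 = 0"
    using combination_vanishes[of 0 0 1 \<psi>] assms by (simp del: hermite.simps)
qed

interpretation std: orthonormal_basis "\<lambda>k. sket (std k)"
proof
  show "cinner (sket (std i)) (sket (std j)) = (if i = j then 1 else 0)" for i j
    using parity_half_inj[of i j] by (auto simp: cinner_sket std_def sip_hermite simp del: hermite.simps)
  fix \<psi> assume *: "\<And>k. cinner (sket (std k)) \<psi> = 0"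
  show "\<psi> = 0"
    using *[of "2 * _"] *[of "2 * _ + 1"] by (intro std_total) (simp_all add: std_def del: hermite.simps)
qed

text \<open>The spin parts (1, 1) and (1, -1), over the root of 2, diagonalise \<sigma>x. On them
  the coupling pushes the oscillator in opposite directions, hence opposite translations.\<close>

definition disp :: "real \<Rightarrow> nat \<Rightarrow> swf \<times> swf" where
  "disp c k = (let s = (if even k then 1 else -1); f = complex_of_real (1 / sqrt 2) *\<^sub>S translate (s * c) (hermite (k div 2))
     in (f, complex_of_real s *\<^sub>S f))"

lemma disp_basis: "orthonormal_basis (\<lambda>k. sket (disp c k))"
proof
  have s: "2 * complex_of_real (1 / sqrt 2) * complex_of_real (1 / sqrt 2) = 1"
    unfolding mult.assoc of_real_mult[symmetric] by simp
  show "cinner (sket (disp c i)) (sket (disp c j)) = (if i = j then 1 else 0)" for i j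
  proof (cases "even i = even j")
    case True
    then show ?thesis
      using parity_half_inj[of i j] s
      by (auto simp: cinner_sket disp_def Let_def sip_translate sip_hermite mult.assoc[symmetric]
          simp del: hermite.simps of_real_divide)
  next
    case False
    then show ?thesis by (auto simp: cinner_sket disp_def Let_def)
  qed
  fix \<psi> assume *: "\<And>k. cinner (sket (disp c k)) \<psi> = 0"
  have 1: "AE x in lborel. cnj (complex_of_real (1 / sqrt 2)) * rep_spinor \<psi> x $ 1
      + cnj (complex_of_real (1 / sqrt 2)) * rep_spinor \<psi> x $ 2 = 0"
    using *[of "2 * _"] by (intro combination_vanishes[of _ c]) (simp add: disp_def Let_def del: hermite.simps of_real_divide)
  have 2: "AE x in lborel. cnj (complex_of_real (1 / sqrt 2)) * rep_spinor \<psi> x $ 1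
      + cnj (- complex_of_real (1 / sqrt 2)) * rep_spinor \<psi> x $ 2 = 0"
    using *[of "2 * _ + 1"] by (intro combination_vanishes[of _ "- c"]) (simp add: disp_def Let_def del: hermite.simps of_real_divide)
  have "AE x in lborel. rep_spinor \<psi> x $ 1 = 0 \<and> rep_spinor \<psi> x $ 2 = 0"
    using 1 2
  proof eventually_elim
    case (elim x)
    then have "complex_of_real (1 / sqrt 2) * (rep_spinor \<psi> x $ 1 + rep_spinor \<psi> x $ 2) = 0"
      "complex_of_real (1 / sqrt 2) * (rep_spinor \<psi> x $ 1 - rep_spinor \<psi> x $ 2) = 0"
      by (simp_all add: distrib_left right_diff_distrib)
    then have "rep_spinor \<psi> x $ 1 + rep_spinor \<psi> x $ 2 = 0" "rep_spinor \<psi> x $ 1 - rep_spinor \<psi> x $ 2 = 0"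
      by simp_all
    then show ?case by (simp add: eq_neg_iff_add_eq_0)
  qed
  then show "\<psi> = 0" by (intro spinor_eq_0) auto
qed

text \<open>A linear coupling displaces the oscillator: completing the square in position space turns it
  into a translation, up to a constant.\<close>

lemma an_translate: "an (translate c f) = translate c (an f) - complex_of_real (c / sqrt 2) *\<^sub>S translate c f"
  and cr_translate: "cr (translate c f) = translate c (cr f) - complex_of_real (c / sqrt 2) *\<^sub>S translate c f"
  by (simp_all add: an_eq cr_eq dif_simps mult_x_simps scl_add_right scl_diff_right algebra_simps)

text \<open>Both ladder operators shift by -d under the translation. The terms linear in d cancel
  the coupling, and the quadratic ones leave d^2 - 2 d^2 = -d^2.\<close>

lemma displaced_eigen:
  fixes \<omega> d :: real and n :: nat
  assumes c: "c = sqrt 2 * d"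
  defines "u \<equiv> translate c (hermite n)"
  shows "complex_of_real \<omega> *\<^sub>S cr (an u) + complex_of_real (\<omega> * d) *\<^sub>S (an u + cr u)
    = complex_of_real (\<omega> * real n - \<omega> * d\<^sup>2) *\<^sub>S u"
proof -
  have cd: "c / sqrt 2 = d" by (simp add: c)
  have "cr (an u) = translate c (cr (an (hermite n))) - complex_of_real d *\<^sub>S translate c (an (hermite n))
      - complex_of_real d *\<^sub>S (translate c (cr (hermite n)) - complex_of_real d *\<^sub>S u)"
    unfolding u_def an_translate cr_linear cr_translate cd by simp
  moreover have "an u = translate c (an (hermite n)) - complex_of_real d *\<^sub>S u"
    "cr u = translate c (cr (hermite n)) - complex_of_real d *\<^sub>S u"
    unfolding u_def an_translate cr_translate cd by simp_all
  ultimately have "complex_of_real \<omega> *\<^sub>S cr (an u) + complex_of_real (\<omega> * d) *\<^sub>S (an u + cr u)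
      = complex_of_real \<omega> *\<^sub>S translate c (cr (an (hermite n))) - complex_of_real (\<omega> * d\<^sup>2) *\<^sub>S u"
    by (simp add: scl_add_right scl_diff_right power2_eq_square mult.assoc)
  also have "translate c (cr (an (hermite n))) = complex_of_real (real n) *\<^sub>S u"
    by (simp only: cr_an_hermite translate_simps u_def)
  finally show ?thesis
    using scl_add_left[of "complex_of_real (\<omega> * real n)" "- complex_of_real (\<omega> * d\<^sup>2)" u] by simp
qed

definition disp_p :: "real \<Rightarrow> real \<Rightarrow> swf \<times> swf \<Rightarrow> swf \<times> swf" where
  "disp_p l \<omega> p = complex_of_real \<omega> *\<^sub>P num_p p + complex_of_real l *\<^sub>P (rot_p p + ctr_p p)"

text \<open>Where \<sigma>x has eigenvalue \<open>s\<close>, the coupling is s l (a + its adjoint),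
  so the displacement parameter is s l / \<omega>. The energy shift depends on s^2 = 1 only.\<close>

lemma disp_schwartz_basis:
  assumes "\<omega> \<noteq> 0"
  shows "schwartz_basis (disp (sqrt 2 * l / \<omega>)) (disp_p l \<omega>) (\<lambda>k. \<omega> * real (k div 2) - l\<^sup>2 / \<omega>)"
proof (rule schwartz_basis.intro[OF disp_basis], standard)
  show "plinear (disp_p l \<omega>)" "psym (disp_p l \<omega>)"
    unfolding disp_p_def[abs_def] by (intro plinear_add plinear_scl p_linear psym_add psym_scl p_sym)+
  fix k :: nat
  define s :: real where "s = (if even k then 1 else -1)"
  define u where "u = translate (s * (sqrt 2 * l / \<omega>)) (hermite (k div 2))"
  have ss: "s * s = 1" by (simp add: s_def)
  have disp: "disp (sqrt 2 * l / \<omega>) k = complex_of_real (1 / sqrt 2) *\<^sub>P (u, complex_of_real s *\<^sub>S u)"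
    unfolding disp_def s_def[symmetric] u_def[symmetric] Let_def pscl_Pair scl_scl by (simp only: mult.commute)
  have "complex_of_real \<omega> *\<^sub>S cr (an u) + complex_of_real (\<omega> * (s * l / \<omega>)) *\<^sub>S (an u + cr u)
      = complex_of_real (\<omega> * real (k div 2) - \<omega> * (s * l / \<omega>)\<^sup>2) *\<^sub>S u"
    unfolding u_def by (rule displaced_eigen) simp
  also have "\<omega> * (s * l / \<omega>) = s * l" using assms by simp
  also have "\<omega> * (s * l / \<omega>)\<^sup>2 = l\<^sup>2 / \<omega>" using assms ss by (simp add: power2_eq_square)
  finally have eig: "complex_of_real \<omega> *\<^sub>S cr (an u) + complex_of_real (s * l) *\<^sub>S (an u + cr u)
      = complex_of_real (\<omega> * real (k div 2) - l\<^sup>2 / \<omega>) *\<^sub>S u" .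
  have "disp_p l \<omega> (u, complex_of_real s *\<^sub>S u) = complex_of_real (\<omega> * real (k div 2) - l\<^sup>2 / \<omega>) *\<^sub>P (u, complex_of_real s *\<^sub>S u)"
  proof -
    have "fst (disp_p l \<omega> (u, complex_of_real s *\<^sub>S u)) = complex_of_real \<omega> *\<^sub>S cr (an u) + complex_of_real (s * l) *\<^sub>S (an u + cr u)"
      by (simp add: disp_p_def p_defs scl_add_right mult.commute)
    moreover have "snd (disp_p l \<omega> (u, complex_of_real s *\<^sub>S u))
        = complex_of_real s *\<^sub>S (complex_of_real \<omega> *\<^sub>S cr (an u) + complex_of_real (s * l) *\<^sub>S (an u + cr u))"
    proof -
      have sl: "complex_of_real s * complex_of_real (s * l) = complex_of_real l"
        by (simp only: of_real_mult[symmetric] mult.assoc[symmetric] ss mult_1_left)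
      have "snd (disp_p l \<omega> (u, complex_of_real s *\<^sub>S u))
          = (complex_of_real \<omega> * complex_of_real s) *\<^sub>S cr (an u) + complex_of_real l *\<^sub>S (cr u + an u)"
        by (simp add: disp_p_def p_defs)
      then show ?thesis
        by (simp only: scl_add_right scl_scl sl, simp only: mult.commute[of "complex_of_real s"] add.commute[of _ "_ *\<^sub>S an u"])
    qed
    ultimately show ?thesis
      by (simp only: prod_eq_iff eig pscl_def fst_conv snd_conv scl_scl mult.commute[of "complex_of_real s"])
  qed
  then show "disp_p l \<omega> (disp (sqrt 2 * l / \<omega>) k) = complex_of_real (\<omega> * real (k div 2) - l\<^sup>2 / \<omega>) *\<^sub>P disp (sqrt 2 * l / \<omega>) k"
    using plinearD(2)[OF \<open>plinear (disp_p l \<omega>)\<close>] unfolding disp by (simp only: pscl_algebra mult.commute)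
qed

text \<open>The eigenvector is (b, m - a), nonzero because \<open>b\<close> is; \<open>m\<close>
  solves (m - a)(m - d) = b^2. The second eigenvector is its rotation by a right angle, with
  eigenvalue given by the trace.\<close>

lemma symmetric_2x2_eigen:
  fixes a b d :: real
  assumes "b \<noteq> 0"
  obtains x y m m' where "x\<^sup>2 + y\<^sup>2 = 1" "a * x + b * y = m * x" "b * x + d * y = m * y"
    "a * y - b * x = m' * y" "d * x - b * y = m' * x"
proof -
  define r where "r = sqrt ((a - d)\<^sup>2 / 4 + b\<^sup>2)"
  define m where "m = (a + d) / 2 + r"
  define y0 where "y0 = m - a"
  define n where "n = sqrt (b\<^sup>2 + y0\<^sup>2)"
  have r2: "r * r = (a - d)\<^sup>2 / 4 + b\<^sup>2" unfolding r_def by simp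
  have m: "(m - a) * (m - d) = b\<^sup>2" using r2 by (simp add: m_def power2_eq_square field_simps)
  have "b\<^sup>2 + y0\<^sup>2 > 0" using assms by (simp add: add_pos_nonneg)
  then have n: "n * n = b\<^sup>2 + y0\<^sup>2" "n > 0" by (simp_all add: n_def)
  show ?thesis
  proof (rule that[of "b / n" "y0 / n" m "a + d - m"])
    show "(b / n)\<^sup>2 + (y0 / n)\<^sup>2 = 1"
      using n by (simp add: power_divide add_divide_distrib[symmetric]) (simp add: power2_eq_square)
    show "a * (b / n) + b * (y0 / n) = m * (b / n)"
      using n(2) by (simp add: y0_def field_simps)
    show "b * (b / n) + d * (y0 / n) = m * (y0 / n)"
      using n(2) m by (simp add: y0_def field_simps power2_eq_square)
    show "a * (y0 / n) - b * (b / n) = (a + d - m) * (y0 / n)"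
      using n(2) m by (simp add: y0_def field_simps power2_eq_square)
    show "d * (b / n) - b * (y0 / n) = (a + d - m) * (b / n)"
      using n(2) by (simp add: y0_def field_simps)
  qed
qed

text \<open>The conserved excitation number \<open>N + (1 + \<sigma>\<^sub>z) / 2\<close>.\<close>

definition exc_p :: "swf \<times> swf \<Rightarrow> swf \<times> swf" where
  "exc_p p = num_p p + (fst p, 0)"

text \<open>Conservation of excitations splits the space into the state (0, h_0) and two-dimensional
  blocks spanned by (h_n, 0) and (0, h_(n+1)); within each block a symmetric matrix is diagonalised,
  which does not disturb the excitation number.\<close>

lemma rwa_schwartz_basis:
  assumes "l \<noteq> 0"
  obtains v \<mu> where "schwartz_basis v (rwa_p l \<Omega> \<omega>) \<mu>"
    "\<And>k. exc_p (v k) = complex_of_real (real ((k + 1) div 2)) *\<^sub>P v k"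
proof -
  have "\<exists>x y m m'. x\<^sup>2 + y\<^sup>2 = 1 \<and>
      (\<Omega> / 2 + \<omega> * n) * x + (l * sqrt (Suc n)) * y = m * x \<and> (l * sqrt (Suc n)) * x + (\<omega> * Suc n - \<Omega> / 2) * y = m * y \<and>
      (\<Omega> / 2 + \<omega> * n) * y - (l * sqrt (Suc n)) * x = m' * y \<and> (\<omega> * Suc n - \<Omega> / 2) * x - (l * sqrt (Suc n)) * y = m' * x"
    for n :: nat
    using symmetric_2x2_eigen[of "l * sqrt (Suc n)" "\<Omega> / 2 + \<omega> * n" "\<omega> * Suc n - \<Omega> / 2"] assms
    by (metis mult_eq_0_iff of_nat_0_neq real_sqrt_eq_zero_cancel_iff)
  then obtain x y m m' where xy: "\<And>n. (x n)\<^sup>2 + (y n)\<^sup>2 = 1"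
    and e: "\<And>n. (\<Omega> / 2 + \<omega> * real n) * x n + (l * sqrt (Suc n)) * y n = m n * x n"
      "\<And>n. (l * sqrt (Suc n)) * x n + (\<omega> * Suc n - \<Omega> / 2) * y n = m n * y n"
      "\<And>n. (\<Omega> / 2 + \<omega> * real n) * y n - (l * sqrt (Suc n)) * x n = m' n * y n"
      "\<And>n. (\<omega> * Suc n - \<Omega> / 2) * x n - (l * sqrt (Suc n)) * y n = m' n * x n"
    by metis
  \<comment> \<open>The vector with coordinates a, b in the block of n + 1 excitations.\<close>
  define B where "B n a b = (complex_of_real a *\<^sub>S hermite n, complex_of_real b *\<^sub>S hermite (Suc n))" for n a b
  have B_pip: "pip (B n a b) (B n' a' b') = (if n = n' then complex_of_real (a * a' + b * b') else 0)" for n a b n' a' b'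
    by (simp add: B_def sip_hermite del: hermite.simps)
  have B0: "pip (0, hermite 0) (B n a b) = 0" "pip (B n a b) (0, hermite 0) = 0" for n a b
    by (simp_all add: B_def sip_hermite del: hermite.simps)
  have B_rwa: "rwa_p l \<Omega> \<omega> (B n a b) = B n ((\<Omega> / 2 + \<omega> * real n) * a + (l * sqrt (Suc n)) * b)
      ((l * sqrt (Suc n)) * a + (\<omega> * Suc n - \<Omega> / 2) * b)" for n a b
  proof -
    have "fst (rwa_p l \<Omega> \<omega> (B n a b)) = (complex_of_real (\<Omega> / 2) * complex_of_real a + complex_of_real \<omega> * (complex_of_real a * complex_of_real (real n))
        + complex_of_real l * (complex_of_real b * complex_of_real (sqrt (Suc n)))) *\<^sub>S hermite n"
      by (simp only: rwa_p_def p_defs B_def pscl_def fst_conv snd_conv fst_add an_linear cr_linear cr_an_hermite an_hermite_Suc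
          scl_scl scl_add_left)
    moreover have "snd (rwa_p l \<Omega> \<omega> (B n a b)) = (- (complex_of_real (\<Omega> / 2) * complex_of_real b) + complex_of_real \<omega> * (complex_of_real b * complex_of_real (real (Suc n)))
        + complex_of_real l * (complex_of_real a * complex_of_real (sqrt (Suc n)))) *\<^sub>S hermite (Suc n)"
      by (simp only: rwa_p_def p_defs B_def pscl_def fst_conv snd_conv snd_add an_linear cr_linear cr_an_hermite cr_hermite
          scl_scl scl_add_left scl_minus_right scl_minus_left)
    ultimately show ?thesis
      by (simp add: B_def prod_eq_iff algebra_simps del: hermite.simps)
  qed
  have B_exc: "exc_p (B n a b) = complex_of_real (real (Suc n)) *\<^sub>P B n a b" for n a b
  proof -
    have "fst (exc_p (B n a b)) = (complex_of_real a * complex_of_real (real n) + complex_of_real a) *\<^sub>S hermite n"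
      by (simp only: exc_p_def p_defs B_def fst_conv fst_add an_linear cr_linear cr_an_hermite scl_scl scl_add_left)
    moreover have "snd (exc_p (B n a b)) = (complex_of_real b * complex_of_real (real (Suc n))) *\<^sub>S hermite (Suc n)"
      by (simp only: exc_p_def p_defs B_def snd_conv snd_add an_linear cr_linear cr_an_hermite scl_scl add_0_right)
    ultimately show ?thesis
      by (simp add: B_def pscl_def prod_eq_iff algebra_simps del: hermite.simps)
  qed
  \<comment> \<open>Index 0 is the isolated state; the successors 2n + 1 and 2n + 2 fill the block
    of n + 1 excitations, so vector \<open>k\<close> carries \<open>(k + 1) div 2\<close> of
    them.\<close>
  define v where "v k = (case k of 0 \<Rightarrow> (0, hermite 0) | Suc j \<Rightarrow>
    (if even j then B (j div 2) (x (j div 2)) (y (j div 2)) else B (j div 2) (- y (j div 2)) (x (j div 2))))" for k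
  define \<mu> where "\<mu> k = (case k of 0 \<Rightarrow> - \<Omega> / 2 | Suc j \<Rightarrow> (if even j then m (j div 2) else m' (j div 2)))" for k
  have basis: "orthonormal_basis (\<lambda>k. sket (v k))"
  proof
    have "pip (0, hermite 0) (0, hermite 0) = 1" by (simp add: sip_hermite del: hermite.simps)
    moreover have "x n * x n + y n * y n = 1" for n using xy[of n] by (simp add: power2_eq_square)
    ultimately show "cinner (sket (v i)) (sket (v j)) = (if i = j then 1 else 0)" for i j
      using parity_half_inj[of "i - 1" "j - 1"]
      by (auto simp: cinner_sket v_def B_pip B0 mult.commute add.commute simp del: pip_Pair hermite.simps of_real_add of_real_mult split: nat.split)
    fix \<psi> assume *: "\<And>k. cinner (sket (v k)) \<psi> = 0"
    have B_c: "cinner (sket (B n a b)) \<psi> = a * cinner (sket (hermite n, 0)) \<psi> + b * cinner (sket (0, hermite (Suc n))) \<psi>" for n a b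
    proof -
      have "B n a b = complex_of_real a *\<^sub>P (hermite n, 0) + complex_of_real b *\<^sub>P (0, hermite (Suc n))"
        by (simp add: B_def del: hermite.simps)
      then show ?thesis by (simp only: sket_add sket_scl cinner_add_left cinner_scaleC_left complex_cnj_complex_of_real)
    qed
    have *: "cinner (sket (hermite n, 0)) \<psi> = 0 \<and> cinner (sket (0, hermite (Suc n))) \<psi> = 0" for n
    proof -
      define p q where "p = cinner (sket (hermite n, 0)) \<psi>" and "q = cinner (sket (0, hermite (Suc n))) \<psi>"
      have 1: "x n * p + y n * q = 0" "- y n * p + x n * q = 0"
        using *[of "Suc (2 * n)"] *[of "Suc (Suc (2 * n))"] by (simp_all add: v_def B_c p_def q_def del: hermite.simps)
      have xy': "complex_of_real (x n) * x n + complex_of_real (y n) * y n = 1"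
        using xy[of n] by (simp add: power2_eq_square flip: of_real_mult of_real_add)
      \<comment> \<open>The coordinate change within a block is a rotation; its transpose recovers
        the standard coefficients.\<close>
      have "p = x n * (x n * p + y n * q) - y n * (- y n * p + x n * q)"
        "q = y n * (x n * p + y n * q) + x n * (- y n * p + x n * q)"
        using arg_cong[OF xy', of "\<lambda>z. z * p"] arg_cong[OF xy', of "\<lambda>z. z * q"] by (simp_all add: algebra_simps)
      then show ?thesis unfolding 1 by (simp add: p_def q_def)
    qed
    moreover have "cinner (sket (0, hermite 0)) \<psi> = 0" using \<open>\<And>k. cinner (sket (v k)) \<psi> = 0\<close>[of 0] by (simp add: v_def del: hermite.simps)
    ultimately show "\<psi> = 0"
      by (intro std_total; metis not0_implies_Suc)
  qed
  have vac: "rwa_p l \<Omega> \<omega> (0, hermite 0) = complex_of_real (- \<Omega> / 2) *\<^sub>P (0, hermite 0)"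
    by (simp add: rwa_p_def p_defs an_hermite_0 del: hermite.simps)
  have "schwartz_basis v (rwa_p l \<Omega> \<omega>) \<mu>"
  proof (rule schwartz_basis.intro[OF basis], standard)
    show "plinear (rwa_p l \<Omega> \<omega>)" "psym (rwa_p l \<Omega> \<omega>)"
      unfolding rwa_p_def[abs_def] by (intro plinear_add plinear_scl p_linear psym_add psym_scl p_sym)+
    have B_scl: "complex_of_real c *\<^sub>P B n a b = B n (c * a) (c * b)" for c n a b
      by (simp add: B_def del: hermite.simps)
    have "rwa_p l \<Omega> \<omega> (B n (x n) (y n)) = complex_of_real (m n) *\<^sub>P B n (x n) (y n)" for n
      unfolding B_rwa B_scl e ..
    moreover have "rwa_p l \<Omega> \<omega> (B n (- y n) (x n)) = complex_of_real (m' n) *\<^sub>P B n (- y n) (x n)" for n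
      unfolding B_rwa B_scl using e(3,4)[of n] by (simp add: algebra_simps)
    ultimately show "rwa_p l \<Omega> \<omega> (v k) = complex_of_real (\<mu> k) *\<^sub>P v k" for k
      using vac by (cases k) (simp_all add: v_def \<mu>_def del: pscl_Pair)
  qed
  moreover have "exc_p (v k) = complex_of_real (real ((k + 1) div 2)) *\<^sub>P v k" for k
  proof (cases k)
    case 0
    then show ?thesis by (simp add: v_def exc_p_def p_defs an_hermite_0 zero_prod_def del: hermite.simps)
  next
    case (Suc j)
    then show ?thesis by (simp add: v_def B_exc)
  qed
  ultimately show ?thesis by (rule that)
qed

subsection \<open>The propagators\<close>

lemma std_schwartz_basis:
  assumes "plinear T" "psym T" "\<And>n. T (hermite n, 0) = complex_of_real (f n) *\<^sub>P (hermite n, 0)"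
    "\<And>n. T (0, hermite n) = complex_of_real (g n) *\<^sub>P (0, hermite n)"
  shows "schwartz_basis std T (\<lambda>k. if even k then f (k div 2) else g (k div 2))"
  by (rule schwartz_basis.intro[OF std.orthonormal_basis_axioms], standard)
    (use assms in \<open>auto simp: std_def simp del: hermite.simps\<close>)

interpretation sz: schwartz_basis std sz_p "\<lambda>k. if even k then 1 else - 1"
  by (rule std_schwartz_basis[OF p_linear(2) p_sym(2)]) (auto simp: sz_p_def simp del: hermite.simps)

text \<open>Extension of \<open>sz_p\<close> from Schwartz spinors to the whole space, as a
  multiplier in the standard basis.\<close>

definition sz_op :: "spinor \<Rightarrow> spinor" where
  "sz_op = std.mult (\<lambda>k. complex_of_real (if even k then 1 else - 1))"

lemma coeff_sz_op:
  "cinner (sket (std k)) (sz_op \<psi>) = complex_of_real (if even k then 1 else - 1) * cinner (sket (std k)) \<psi>"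
  unfolding sz_op_def by (rule std.coeff_mult) simp

lemma sz_op_linear: "clinear sz_op"
  unfolding sz_op_def by (rule std.mult_linear) simp

lemma norm_sz_op: "norm (sz_op \<psi>) = norm \<psi>"
proof -
  have "(\<lambda>k. (cmod (cinner (sket (std k)) \<psi>))\<^sup>2) sums (norm (sz_op \<psi>))\<^sup>2"
  proof -
    have "cmod (cinner (sket (std k)) (sz_op \<psi>)) = cmod (cinner (sket (std k)) \<psi>)" for k
      by (simp add: coeff_sz_op norm_mult)
    then show ?thesis using std.parseval_norm[of "sz_op \<psi>"] by simp
  qed
  from sums_unique2[OF std.parseval_norm this] show ?thesis by (simp add: power2_eq_iff_nonneg)
qed

lemma sz_op_sket: "sz_op (sket p) = sket (sz_p p)"
  by (rule std.coeff_eqI) (simp only: coeff_sz_op sz.coeff_T)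

lemma sz_op_sym: "cinner (sz_op \<phi>) \<psi> = cinner \<phi> (sz_op \<psi>)"
  unfolding sz_op_def by (rule std.mult_self_adjoint) simp_all

lemma in_graph_iff:
  "(\<psi>, \<eta>) \<in> graph T \<longleftrightarrow> (\<exists>p. (\<lambda>n. sket (p n)) \<longlonglongrightarrow> \<psi> \<and> (\<lambda>n. sket (T (p n))) \<longlonglongrightarrow> \<eta>)"
proof
  assume "(\<psi>, \<eta>) \<in> graph T"
  then obtain z where z: "\<And>n. z n \<in> range (\<lambda>p. (sket p, sket (T p)))" "z \<longlonglongrightarrow> (\<psi>, \<eta>)"
    unfolding graph_def closure_sequential by blast
  from z(1) have "\<exists>p. z n = (sket p, sket (T p))" for n by (meson imageE)
  then obtain p where p: "\<And>n. z n = (sket (p n), sket (T (p n)))" by metis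
  then have "z = (\<lambda>n. (sket (p n), sket (T (p n))))" by (rule ext)
  then show "\<exists>p. (\<lambda>n. sket (p n)) \<longlonglongrightarrow> \<psi> \<and> (\<lambda>n. sket (T (p n))) \<longlonglongrightarrow> \<eta>"
    using tendsto_fst[OF z(2)] tendsto_snd[OF z(2)] by (intro exI[of _ p]) simp
next
  assume "\<exists>p. (\<lambda>n. sket (p n)) \<longlonglongrightarrow> \<psi> \<and> (\<lambda>n. sket (T (p n))) \<longlonglongrightarrow> \<eta>"
  then obtain p where "(\<lambda>n. sket (p n)) \<longlonglongrightarrow> \<psi>" "(\<lambda>n. sket (T (p n))) \<longlonglongrightarrow> \<eta>" by blast
  then have "(\<lambda>n. (sket (p n), sket (T (p n)))) \<longlonglongrightarrow> (\<psi>, \<eta>)" by (rule tendsto_Pair)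
  then show "(\<psi>, \<eta>) \<in> graph T"
    unfolding graph_def closure_sequential by (intro exI[of _ "\<lambda>n. (sket (p n), sket (T (p n)))"]) auto
qed

text \<open>Closure commutes with adding a bounded operator, because the bounded part of an
  approximating sequence converges automatically.\<close>

lemma graph_bounded_perturbation:
  assumes B: "bounded_linear B" "\<And>p. B (sket p) = sket (S p)"
  shows "graph (\<lambda>p. T p + S p) = {(\<psi>, \<eta> + B \<psi>) | \<psi> \<eta>. (\<psi>, \<eta>) \<in> graph T}"
proof -
  have "(\<psi>, \<eta>) \<in> graph (\<lambda>p. T p + S p) \<longleftrightarrow> (\<psi>, \<eta> - B \<psi>) \<in> graph T" for \<psi> \<eta>
  proof -
    have "(\<lambda>n. sket (T (p n) + S (p n))) \<longlonglongrightarrow> \<eta> \<longleftrightarrow> (\<lambda>n. sket (T (p n))) \<longlonglongrightarrow> \<eta> - B \<psi>"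
      if "(\<lambda>n. sket (p n)) \<longlonglongrightarrow> \<psi>" for p
    proof -
      have S: "(\<lambda>n. sket (S (p n))) \<longlonglongrightarrow> B \<psi>"
        using bounded_linear.tendsto[OF B(1) that] by (simp only: B(2))
      show ?thesis
        using tendsto_diff[OF _ S, of "\<lambda>n. sket (T (p n) + S (p n))" \<eta>] tendsto_add[OF _ S, of "\<lambda>n. sket (T (p n))" "\<eta> - B \<psi>"]
        by (auto simp: sket_add)
    qed
    then show ?thesis unfolding in_graph_iff by blast
  qed
  note * = this
  show ?thesis
  proof (intro set_eqI iffI)
    fix z assume "z \<in> graph (\<lambda>p. T p + S p)"
    then show "z \<in> {(\<psi>, \<eta> + B \<psi>) | \<psi> \<eta>. (\<psi>, \<eta>) \<in> graph T}"
      using *[of "fst z" "snd z"] by (cases z) (auto intro!: exI[of _ "snd z - B (fst z)"])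
  next
    fix z assume "z \<in> {(\<psi>, \<eta> + B \<psi>) | \<psi> \<eta>. (\<psi>, \<eta>) \<in> graph T}"
    then show "z \<in> graph (\<lambda>p. T p + S p)" by (auto simp: *)
  qed
qed

lemma rabi_generates:
  assumes "\<omega> \<noteq> 0"
  shows "generates (H l \<Omega> \<omega>) (propagator (H l \<Omega> \<omega>))"
proof -
  interpret D: schwartz_basis "disp (sqrt 2 * l / \<omega>)" "disp_p l \<omega>" "\<lambda>k. \<omega> * real (k div 2) - l\<^sup>2 / \<omega>"
    by (rule disp_schwartz_basis[OF assms])
  let ?A = "graph (disp_p l \<omega>)"
  define B where "B \<psi> = complex_of_real (\<Omega> / 2) *\<^sub>C sz_op \<psi>" for \<psi>
  have B: "clinear B" "norm (B \<psi>) \<le> \<bar>\<Omega> / 2\<bar> * norm \<psi>" "cinner (B \<phi>) \<psi> = cinner \<phi> (B \<psi>)" for \<phi> \<psi>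
    by (simp_all add: B_def clinear_def clinearD[OF sz_op_linear] norm_sz_op scaleC_add_right mult.commute sz_op_sym)
  have Bs: "B (sket p) = sket (complex_of_real (\<Omega> / 2) *\<^sub>P sz_p p)" for p
    by (simp only: B_def sz_op_sket sket_scl)
  have H: "H l \<Omega> \<omega> = {(\<psi>, \<eta> + B \<psi>) | \<psi> \<eta>. (\<psi>, \<eta>) \<in> ?A}"
  proof -
    have "rabi_p l \<Omega> \<omega> = (\<lambda>p. disp_p l \<omega> p + complex_of_real (\<Omega> / 2) *\<^sub>P sz_p p)"
      by (rule ext) (simp add: rabi_p_def rwa_p_def disp_p_def pscl_algebra algebra_simps)
    then show ?thesis
      unfolding H_eq using graph_bounded_perturbation[OF bounded_linear_clinear[OF B(1,2)] Bs] by simp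
  qed
  obtain U where U: "generates (H l \<Omega> \<omega>) U"
    using generates_bounded_perturbation[OF D.evol_generates B] unfolding H D.graph_eq_diag by blast
  \<comment> \<open>A bounded perturbation keeps the domain; its density makes \<open>U\<close> the
    value of \<open>propagator\<close>.\<close>
  have "Domain (H l \<Omega> \<omega>) = Domain ?A" unfolding H by blast
  then have "closure (Domain (H l \<Omega> \<omega>)) = UNIV" using D.dense_domain_diag by (simp add: D.graph_eq_diag)
  from propagator_eq[OF U this] U show ?thesis by simp
qed

lemma H0_propagator_unitary: "unitary (propagator (H0 \<omega>) t)"
proof -
  interpret F: schwartz_basis std "\<lambda>p. complex_of_real (\<omega> / 2) *\<^sub>P sz_p p + complex_of_real \<omega> *\<^sub>P num_p p"
    "\<lambda>k. if even k then \<omega> / 2 + \<omega> * real (k div 2) else - (\<omega> / 2) + \<omega> * real (k div 2)"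
  proof (rule std_schwartz_basis)
    show "plinear (\<lambda>p. complex_of_real (\<omega> / 2) *\<^sub>P sz_p p + complex_of_real \<omega> *\<^sub>P num_p p)"
      "psym (\<lambda>p. complex_of_real (\<omega> / 2) *\<^sub>P sz_p p + complex_of_real \<omega> *\<^sub>P num_p p)"
      by (intro plinear_add plinear_scl psym_add psym_scl p_linear p_sym)+
  qed (simp_all add: p_defs cr_an_hermite scl_add_left scl_diff_left distrib_left del: hermite.simps)
  show ?thesis unfolding H0_eq F.graph_eq_diag std.propagator_diag by (rule std.evol_unitary)
qed

subsection \<open>Ladder estimates\<close>

text \<open>This and the five identities below reduce norms of ladder words to the forms of 1, N and
  N^2, so that the estimates become linear arithmetic.\<close>

lemma an_norm: "sip (an f) (an f) = sip f (cr (an f))"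
  by (rule sip_an)

lemma cr_norm: "sip (cr f) (cr f) = sip f (cr (an f)) + sip f f"
  by (simp add: sip_cr an_cr sip_add_right)

lemma num_norm: "sip (cr (an f)) (cr (an f)) = sip f (cr (an (cr (an f))))"
  by (simp add: sip_cr sip_an)

lemma an_an_norm: "sip (an (an f)) (an (an f)) = sip f (cr (an (cr (an f)))) - sip f (cr (an f))"
  by (simp add: sip_an an_cr sip_add_right)

lemma an_cr_norm: "sip (an (cr f)) (an (cr f)) = sip f (cr (an (cr (an f)))) + 2 * sip f (cr (an f)) + sip f f"
  by (simp add: an_cr sip_add_right sip_add_left sip_cr sip_an)

lemma cr_cr_norm: "sip (cr (cr f)) (cr (cr f)) = sip f (cr (an (cr (an f)))) + 3 * sip f (cr (an f)) + 2 * sip f f"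
  by (simp add: sip_cr an_cr sip_add_right)


lemma ladder_nonneg:
  "0 \<le> Re (sip f (cr (an f)))" "0 \<le> Re (sip f (cr (an (cr (an f)))))" "0 \<le> Re (sip f f)"
  using Re_sip_self_nonneg[of "an f"] Re_sip_self_nonneg[of "cr (an f)"] Re_sip_self_nonneg[of f]
  by (simp_all add: an_norm num_norm)

lemma norm_sket: "(norm (sket p))\<^sup>2 = Re (pip p p)"
  using cinner_self[of "sket p"] by (simp add: cinner_sket)

text \<open>With \<open>M\<close> for the excitation number \<open>exc_p\<close>: \<open>exc1_p\<close> is \<open>M + 1\<close>, \<open>exc12_p\<close> is
  \<open>(M + 1)(M + 2)\<close>, \<open>num2_p\<close> is \<open>N + 2\<close> and \<open>num23_p\<close> is \<open>(N + 2)(N + 3)\<close>, all expanded.\<close>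

definition exc1_p :: "swf \<times> swf \<Rightarrow> swf \<times> swf" where "exc1_p p = exc_p p + p"
definition exc12_p :: "swf \<times> swf \<Rightarrow> swf \<times> swf" where
  "exc12_p p = exc_p (exc_p p) + complex_of_real 3 *\<^sub>P exc_p p + complex_of_real 2 *\<^sub>P p"

definition num2_p :: "swf \<times> swf \<Rightarrow> swf \<times> swf" where "num2_p p = num_p p + complex_of_real 2 *\<^sub>P p"
definition num23_p :: "swf \<times> swf \<Rightarrow> swf \<times> swf" where
  "num23_p p = num_p (num_p p) + complex_of_real 5 *\<^sub>P num_p p + complex_of_real 6 *\<^sub>P p"

lemmas exc_defs = exc_p_def exc1_p_def exc12_p_def num2_p_def num23_p_def

text \<open>Spin down contributes N + 1, exactly M + 1 there. Spin up contributes N, while M + 1 is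
  N + 2.\<close>

lemma first_order_bounds:
  "(norm (sket (alt_p p)))\<^sup>2 \<le> Re (pip p (exc1_p p))" "(norm (sket (ctr_p p)))\<^sup>2 \<le> Re (pip p (exc1_p p))"
  using ladder_nonneg[of "fst p"] ladder_nonneg[of "snd p"]
  by (simp_all add: norm_sket pip_def exc_defs p_defs sip_add_right an_norm cr_norm)

text \<open>Here (M + 1)(M + 2) is (N + 1)(N + 2) on spin down, attained by two creations, and (N +
  2)(N + 3) on spin up; every other word has smaller form.\<close>

lemma second_order_bounds:
  "(norm (sket (rot_p (alt_p p))))\<^sup>2 \<le> Re (pip p (exc12_p p))"
  "(norm (sket (ctr_p (alt_p p))))\<^sup>2 \<le> Re (pip p (exc12_p p))"
  "(norm (sket (alt_p (rot_p p))))\<^sup>2 \<le> Re (pip p (exc12_p p))"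
  using ladder_nonneg[of "fst p"] ladder_nonneg[of "snd p"]
  by (simp_all add: norm_sket pip_def exc_defs p_defs pscl_def sip_add_right distrib_left
      num_norm an_an_norm an_cr_norm cr_cr_norm)

text \<open>M equals N on spin down and N + 1 on spin up; this is the origin of the weights N + 2
  and (N + 2)(N + 3).\<close>

lemma excitation_le_number:
  "Re (pip p (exc1_p p)) \<le> Re (pip p (num2_p p))" "Re (pip p (exc12_p p)) \<le> Re (pip p (num23_p p))"
  using ladder_nonneg[of "fst p"] ladder_nonneg[of "snd p"]
  by (simp_all add: norm_sket pip_def exc_defs p_defs pscl_def sip_add_right distrib_left)

text \<open>The first term of \<open>alt_p\<close> raises oscillator and spin together, the second
  lowers both, so the free energy changes by plus or minus \<omega> + \<Omega>; the minus sign in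
  \<open>alt_p\<close> makes the two contributions add up to \<open>ctr_p\<close>.\<close>

lemma intertwining:
  "rabi_p l \<Omega> \<omega> (alt_p p) - alt_p (rwa_p l \<Omega> \<omega> p) = complex_of_real (\<omega> + \<Omega>) *\<^sub>P ctr_p p
    + complex_of_real l *\<^sub>P (rot_p (alt_p p) + ctr_p (alt_p p) - alt_p (rot_p p))"
proof -
  \<comment> \<open>The spin flips between -\<Omega>/2 and \<Omega>/2, so two halves have to be
    merged.\<close>
  have half: "complex_of_real (\<Omega> / 2) *\<^sub>S f + complex_of_real (\<Omega> / 2) *\<^sub>S f = complex_of_real \<Omega> *\<^sub>S f" for f
    unfolding scl_add_left[symmetric] of_real_add[symmetric] by simp
  show ?thesis
    unfolding prod_eq_iff
    by (simp add: rabi_p_def rwa_p_def p_defs pscl_def an_cr scl_add_right scl_diff_right scl_add_left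
        del: of_real_divide, simp add: algebra_simps half[symmetric] del: of_real_divide)
qed

subsection \<open>The rotating-wave estimate\<close>

lemma plinear_rabi: "plinear (rabi_p l \<Omega> \<omega>)"
  unfolding rabi_p_def[abs_def] rwa_p_def by (intro plinear_add plinear_scl p_linear)

lemma psym_exc: "psym exc_p" "plinear exc_p"
  by (auto simp: psym_def plinear_def exc_p_def p_defs pip_def pscl_def sip_add_left sip_add_right sip_an sip_cr scl_add_right)

lemma exc_forms:
  "plinear exc1_p" "psym exc1_p" "plinear exc12_p" "psym exc12_p"
proof -
  have p: "plinear (\<lambda>p. p)" "psym (\<lambda>p. p)" by (auto simp: plinear_def psym_def)
  have pp: "plinear (\<lambda>p. exc_p (exc_p p))" by (simp add: plinear_def plinearD[OF psym_exc(2)] del: split_paired_All)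
  have "pip (exc_p (exc_p p)) q = pip p (exc_p (exc_p q))" for p q by (simp only: psymD[OF psym_exc(1)])
  then have ps: "psym (\<lambda>p. exc_p (exc_p p))" by (simp add: psym_def del: split_paired_All)
  show "plinear exc1_p" "psym exc1_p"
    unfolding exc1_p_def[abs_def] by (intro plinear_add psym_add psym_exc p)+
  show "plinear exc12_p" "psym exc12_p"
    unfolding exc12_p_def[abs_def] by (intro plinear_add plinear_scl psym_add psym_scl psym_exc p pp ps)+
qed

lemma norm_combination_le:
  assumes "norm (x :: spinor) \<le> r1" "norm y \<le> r2" "norm z \<le> r2" "norm w \<le> r2"
  shows "norm (complex_of_real a *\<^sub>C x - complex_of_real b *\<^sub>C (y + z - w)) \<le> \<bar>a\<bar> * r1 + \<bar>b\<bar> * (3 * r2)"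
proof -
  have "norm (y + z - w) \<le> 3 * r2"
    using norm_triangle_ineq4[of "y + z" w] norm_triangle_ineq[of y z] assms by linarith
  then have "norm (complex_of_real a *\<^sub>C x) \<le> \<bar>a\<bar> * r1" "norm (complex_of_real b *\<^sub>C (y + z - w)) \<le> \<bar>b\<bar> * (3 * r2)"
    using assms(1) by (simp_all add: mult_left_mono)
  then show ?thesis
    using norm_triangle_ineq4[of "complex_of_real a *\<^sub>C x" "complex_of_real b *\<^sub>C (y + z - w)"] by linarith
qed

text \<open>The estimate in terms of M, which the RWA evolution conserves. It is proved on
  truncations in the RWA eigenbasis with bounds independent of the truncation, then extended by
  continuity.\<close>

lemma rwa_estimate_eigen:
  fixes p :: "swf \<times> swf"
  assumes "\<omega> \<noteq> 0" "0 \<le> \<kappa>" "l > 0"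
    and R: "schwartz_basis v (rwa_p l \<Omega> \<omega>) \<mu>"
    and exc: "\<And>k. exc_p (v k) = complex_of_real (real ((k + 1) div 2)) *\<^sub>P v k"
  defines "r1 \<equiv> sqrt (Re (pip p (exc1_p p)))" and "r2 \<equiv> sqrt (Re (pip p (exc12_p p)))"
  shows "norm (propagator (H_RWA l \<Omega> \<omega>) t (sket p) - propagator (H l \<Omega> \<omega>) t (sket p))
    \<le> 2 * \<kappa> * r1 + \<bar>t\<bar> * (\<bar>l - \<kappa> * (\<omega> + \<Omega>)\<bar> * r1 + 3 * \<kappa> * l * r2)"
proof -
  interpret R: schwartz_basis v "rwa_p l \<Omega> \<omega>" \<mu> by (rule R)
  \<comment> \<open>The RWA eigenvectors also diagonalise the weights, so one set of coefficients
    serves both the evolution and the estimates.\<close>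
  interpret E1: schwartz_basis v exc1_p "\<lambda>k. real ((k + 1) div 2) + 1"
    by (rule schwartz_basis.intro[OF R.orthonormal_basis_axioms], standard)
      (use exc exc_forms in \<open>auto simp: exc1_p_def pscl_algebra simp del: split_paired_All\<close>)
  interpret E2: schwartz_basis v exc12_p "\<lambda>k. (real ((k + 1) div 2) + 1) * (real ((k + 1) div 2) + 2)"
  proof (rule schwartz_basis.intro[OF R.orthonormal_basis_axioms], standard)
    fix k
    define m where "m = complex_of_real (real ((k + 1) div 2))"
    have "exc12_p (v k) = (m * m + 3 * m + 2) *\<^sub>P v k"
      unfolding exc12_p_def exc plinearD(2)[OF psym_exc(2)] m_def[symmetric] pscl_algebra(3) pscl_algebra(5) by simp
    moreover have "complex_of_real ((real ((k + 1) div 2) + 1) * (real ((k + 1) div 2) + 2)) = m * m + 3 * m + 2"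
      by (simp add: m_def algebra_simps)
    ultimately show "exc12_p (v k) = complex_of_real ((real ((k + 1) div 2) + 1) * (real ((k + 1) div 2) + 2)) *\<^sub>P v k"
      by simp
  qed (rule exc_forms)+
  define U where "U = propagator (H l \<Omega> \<omega>)"
  have U: "generates (H l \<Omega> \<omega>) U" unfolding U_def by (rule rabi_generates[OF assms(1)])
  note Uu = generatesD(1)[OF U]
  note Ul = clinearD[OF unitaryD(1)[OF Uu]]
  have RWA: "propagator (H_RWA l \<Omega> \<omega>) = R.evol \<mu>"
    unfolding H_RWA_eq R.graph_eq_diag by (rule R.propagator_diag)
  define c where "c k = cinner (sket (v k)) (sket p)" for k
  define z where "z s k = cis (- (s * \<mu> k)) * c k" for s k
  \<comment> \<open>The truncated RWA orbit as a pair of Schwartz functions, on which all ladder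
    maps are defined.\<close>
  define \<Phi> where "\<Phi> n s = (\<Sum>k<n. z s k *\<^sub>P v k)" for n s
  have \<Phi>: "sket (\<Phi> n s) = R.evol \<mu> s (R.trunc n (sket p))" for n s
    by (simp add: \<Phi>_def z_def c_def R.evol_trunc sket_sum sket_scl)
  have coeff: "cmod (cinner (sket (v k)) (sket (\<Phi> n s))) \<le> cmod (c k)" for k n s
    by (simp add: \<Phi> R.trunc_def R.coeff_sum norm_mult c_def)
  \<comment> \<open>The evolution multiplies coefficients by phases and truncation deletes some of
    them; since the weights are nonnegative, the form cannot exceed its value at
    \<open>p\<close>.\<close>
  have q1: "Re (pip (\<Phi> n s) (exc1_p (\<Phi> n s))) \<le> Re (pip p (exc1_p p))" for n s
    by (rule sums_le[OF _ E1.form_sums E1.form_sums]) (auto intro!: mult_left_mono power_mono simp: coeff[unfolded c_def])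
  have q2: "Re (pip (\<Phi> n s) (exc12_p (\<Phi> n s))) \<le> Re (pip p (exc12_p p))" for n s
    by (rule sums_le[OF _ E2.form_sums E2.form_sums]) (auto intro!: mult_left_mono power_mono simp: coeff[unfolded c_def])
  have b1: "norm (sket (alt_p (\<Phi> n s))) \<le> r1" "norm (sket (ctr_p (\<Phi> n s))) \<le> r1"
    and b2: "norm (sket (rot_p (alt_p (\<Phi> n s)))) \<le> r2" "norm (sket (ctr_p (alt_p (\<Phi> n s)))) \<le> r2"
      "norm (sket (alt_p (rot_p (\<Phi> n s)))) \<le> r2" for n s
    unfolding r1_def r2_def
    using first_order_bounds[of "\<Phi> n s"] second_order_bounds[of "\<Phi> n s"] q1[of n s] q2[of n s]
    by (auto intro!: real_le_rsqrt)
  \<comment> \<open>Stated for arbitrary Schwartz vectors \<open>f k\<close>, since it is applied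
    both to \<open>v k\<close> and to \<open>alt_p (v k)\<close>, which are not eigenvectors in
    general.\<close>
  have deriv: "((\<lambda>s. U (- s) (sket (\<Sum>k<n. z s k *\<^sub>P f k))) has_vector_derivative
      \<i> *\<^sub>C U (- s) (sket (\<Sum>k<n. z s k *\<^sub>P (rabi_p l \<Omega> \<omega> (f k) - complex_of_real (\<mu> k) *\<^sub>P f k)))) (at s)"
    for n s and f :: "nat \<Rightarrow> swf \<times> swf"
  proof -
    have 1: "((\<lambda>s. z s k *\<^sub>C U (- s) (sket (f k))) has_vector_derivative
        \<i> *\<^sub>C (z s k *\<^sub>C U (- s) (sket (rabi_p l \<Omega> \<omega> (f k) - complex_of_real (\<mu> k) *\<^sub>P f k)))) (at s)" for k
    proof -
      have dz: "((\<lambda>s. z s k) has_vector_derivative (- \<i> * \<mu> k * z s k)) (at s)"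
        by (auto simp: z_def cis_conv_exp intro!: derivative_eq_intros has_vector_derivative_mult_left
            has_vector_derivative_real_field)
      have "((\<lambda>s. - s) has_vector_derivative - 1) (at s)" by (auto intro!: derivative_eq_intros)
      from vector_diff_chain_at[OF this generates_deriv[OF U, of "sket (f k)" "sket (rabi_p l \<Omega> \<omega> (f k))"]]
      have "((\<lambda>s. U (- s) (sket (f k))) has_vector_derivative \<i> *\<^sub>C U (- s) (sket (rabi_p l \<Omega> \<omega> (f k)))) (at s)"
        by (simp add: o_def H_eq in_graph)
      from has_vector_derivative_scaleC[OF dz this] show ?thesis
        by (simp add: sket_diff sket_scl Ul scaleC_diff_right algebra_simps)
    qed
    have "((\<lambda>s. \<Sum>k<n. z s k *\<^sub>C U (- s) (sket (f k))) has_vector_derivative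
        (\<Sum>k<n. \<i> *\<^sub>C (z s k *\<^sub>C U (- s) (sket (rabi_p l \<Omega> \<omega> (f k) - complex_of_real (\<mu> k) *\<^sub>P f k))))) (at s)"
      by (intro has_vector_derivative_sum 1)
    then show ?thesis by (simp only: sket_sum sket_scl Ul scaleC_sum_right)
  qed
  have est: "norm (U (- t) (sket (\<Phi> n t)) - sket (\<Phi> n 0))
      \<le> 2 * \<kappa> * r1 + \<bar>t\<bar> * (\<bar>l - \<kappa> * (\<omega> + \<Omega>)\<bar> * r1 + 3 * \<kappa> * l * r2)" for n
  proof -
    \<comment> \<open>The orbit seen from the frame of \<open>H\<close>, corrected by \<kappa> times
      \<open>alt_p\<close>; the correction removes \<kappa> (\<omega> + \<Omega>)
      \<open>ctr_p\<close> from the velocity.\<close>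
    define X where "X s = U (- s) (sket (\<Phi> n s)) - complex_of_real \<kappa> *\<^sub>C U (- s) (sket (alt_p (\<Phi> n s)))" for s
    define Q where "Q s = complex_of_real (l - \<kappa> * (\<omega> + \<Omega>)) *\<^sub>P ctr_p (\<Phi> n s)
        - complex_of_real (\<kappa> * l) *\<^sub>P (rot_p (alt_p (\<Phi> n s)) + ctr_p (alt_p (\<Phi> n s)) - alt_p (rot_p (\<Phi> n s)))" for s
    have X': "(X has_vector_derivative \<i> *\<^sub>C U (- s) (sket (Q s))) (at s)" for s
    proof -
      have 1: "(\<Sum>k<n. z s k *\<^sub>P (rabi_p l \<Omega> \<omega> (v k) - complex_of_real (\<mu> k) *\<^sub>P v k)) = complex_of_real l *\<^sub>P ctr_p (\<Phi> n s)"
        by (simp add: R.eigen[symmetric] rabi_p_def \<Phi>_def plinear_sum[OF plinear_scl[OF p_linear(4)]])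
      \<comment> \<open>Linearity of this combination lets the eigenvalues \<open>\<mu> k\<close> be
        absorbed as the action of the RWA Hamiltonian and the sum be reassembled at the orbit
        point.\<close>
      define S where "S q = rabi_p l \<Omega> \<omega> (alt_p q) - alt_p (rwa_p l \<Omega> \<omega> q)" for q
      have S: "plinear S"
        by (simp add: plinear_def S_def plinearD[OF plinear_rabi] plinearD[OF p_linear(5)] plinearD[OF R.lin] pscl_algebra
            del: split_paired_All)
      have "(\<Sum>k<n. z s k *\<^sub>P (rabi_p l \<Omega> \<omega> (alt_p (v k)) - complex_of_real (\<mu> k) *\<^sub>P alt_p (v k)))
          = (\<Sum>k<n. z s k *\<^sub>P S (v k))"
        by (simp only: S_def R.eigen plinearD[OF p_linear(5)])
      also have "\<dots> = S (\<Phi> n s)" unfolding \<Phi>_def by (rule plinear_sum[OF S, symmetric])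
      finally have 2: "(\<Sum>k<n. z s k *\<^sub>P (rabi_p l \<Omega> \<omega> (alt_p (v k)) - complex_of_real (\<mu> k) *\<^sub>P alt_p (v k))) = S (\<Phi> n s)" .
      have d1: "((\<lambda>s. U (- s) (sket (\<Phi> n s))) has_vector_derivative \<i> *\<^sub>C U (- s) (sket (complex_of_real l *\<^sub>P ctr_p (\<Phi> n s)))) (at s)"
        using deriv[where n = n and f = v and s = s] unfolding 1 \<Phi>_def[symmetric] .
      have d2: "((\<lambda>s. U (- s) (sket (alt_p (\<Phi> n s)))) has_vector_derivative \<i> *\<^sub>C U (- s) (sket (S (\<Phi> n s)))) (at s)"
        using deriv[where n = n and f = "\<lambda>k. alt_p (v k)" and s = s] unfolding 2 plinear_sum[OF p_linear(5), symmetric] \<Phi>_def[symmetric] .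
      have Q: "Q s = complex_of_real l *\<^sub>P ctr_p (\<Phi> n s) - complex_of_real \<kappa> *\<^sub>P S (\<Phi> n s)"
        unfolding Q_def S_def intertwining by (simp add: prod_eq_iff pscl_def scl_diff_left scl_add_left scl_add_right scl_diff_right algebra_simps)
      have "(X has_vector_derivative (\<i> *\<^sub>C U (- s) (sket (complex_of_real l *\<^sub>P ctr_p (\<Phi> n s)))
          - complex_of_real \<kappa> *\<^sub>C (\<i> *\<^sub>C U (- s) (sket (S (\<Phi> n s)))))) (at s)"
        unfolding X_def[abs_def]
        by (intro has_vector_derivative_diff d1 bounded_linear.has_vector_derivative[OF bounded_linear_scaleC d2])
      then show ?thesis
        by (simp add: Q sket_diff sket_scl Ul scaleC_diff_right mult.commute)
    qed
    define M where "M = \<bar>l - \<kappa> * (\<omega> + \<Omega>)\<bar> * r1 + 3 * \<kappa> * l * r2"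
    have "norm (X t - X 0) \<le> M * norm (t - 0)"
    proof (rule differentiable_bound[OF convex_UNIV])
      fix s
      show "(X has_derivative (\<lambda>h. h *\<^sub>R (\<i> *\<^sub>C U (- s) (sket (Q s))))) (at s within UNIV)"
        using X'[of s] by (simp add: has_vector_derivative_def)
      have "norm (sket (Q s)) \<le> \<bar>l - \<kappa> * (\<omega> + \<Omega>)\<bar> * r1 + \<bar>\<kappa> * l\<bar> * (3 * r2)"
        unfolding Q_def sket_diff sket_scl sket_add by (intro norm_combination_le b1 b2)
      also have "\<dots> = M" using assms(2,3) by (simp add: M_def)
      finally show "onorm (\<lambda>h. h *\<^sub>R (\<i> *\<^sub>C U (- s) (sket (Q s)))) \<le> M"
        by (intro onorm_le) (simp add: unitaryD(2)[OF Uu] mult.commute[of _ "norm (sket (Q s))"] mult_right_mono)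
    qed auto
    \<comment> \<open>Undoing the correction leaves one boundary term at each end of the time
      interval, each of norm at most \<kappa> r1.\<close>
    moreover have "U (- t) (sket (\<Phi> n t)) - sket (\<Phi> n 0) = (X t - X 0)
        + complex_of_real \<kappa> *\<^sub>C (U (- t) (sket (alt_p (\<Phi> n t))) - sket (alt_p (\<Phi> n 0)))"
      by (simp add: X_def generatesD(2)[OF U] scaleC_diff_right)
    moreover have "norm (complex_of_real \<kappa> *\<^sub>C (U (- t) (sket (alt_p (\<Phi> n t))) - sket (alt_p (\<Phi> n 0)))) \<le> \<kappa> * (r1 + r1)"
    proof -
      have "norm (U (- t) (sket (alt_p (\<Phi> n t))) - sket (alt_p (\<Phi> n 0))) \<le> r1 + r1"
        using norm_triangle_ineq4[of "U (- t) (sket (alt_p (\<Phi> n t)))" "sket (alt_p (\<Phi> n 0))"] b1(1)[of n t] b1(1)[of n 0]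
        unfolding unitaryD(2)[OF Uu] by linarith
      then show ?thesis using assms(2) by (simp add: mult_left_mono del: norm_triangle_ineq4)
    qed
    ultimately have "norm (U (- t) (sket (\<Phi> n t)) - sket (\<Phi> n 0)) \<le> M * norm (t - 0) + \<kappa> * (r1 + r1)"
      by (smt (verit) norm_triangle_ineq)
    then show ?thesis by (simp add: M_def algebra_simps)
  qed
  \<comment> \<open>Applying the isometry \<open>U (- t)\<close> turns the difference of the two
    evolutions into the quantity just estimated.\<close>
  have "norm (R.evol \<mu> t (R.trunc n (sket p)) - U t (R.trunc n (sket p)))
      \<le> 2 * \<kappa> * r1 + \<bar>t\<bar> * (\<bar>l - \<kappa> * (\<omega> + \<Omega>)\<bar> * r1 + 3 * \<kappa> * l * r2)" for n
  proof -
    have "U (- t) (R.evol \<mu> t (R.trunc n (sket p)) - U t (R.trunc n (sket p))) = U (- t) (sket (\<Phi> n t)) - sket (\<Phi> n 0)"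
      by (simp add: Ul \<Phi> generates_inverse[OF U] R.evol_0)
    then show ?thesis using est[of n] unitaryD(2)[OF Uu, of "- t"] by metis
  qed
  moreover have "(\<lambda>n. norm (R.evol \<mu> t (R.trunc n (sket p)) - U t (R.trunc n (sket p))))
      \<longlonglongrightarrow> norm (R.evol \<mu> t (sket p) - U t (sket p))"
    by (intro tendsto_norm tendsto_diff R.trunc_tendsto bounded_linear.tendsto[OF unitaryD(4)[OF Uu]]
        bounded_linear.tendsto[OF unitaryD(4)[OF R.evol_unitary]])
  ultimately show ?thesis
    unfolding RWA U_def[symmetric] by (intro LIMSEQ_le_const2) auto
qed

theorem rwa_estimate:
  assumes "\<omega> \<noteq> 0" "0 \<le> \<kappa>" "l > 0"
  shows "norm (propagator (H_RWA l \<Omega> \<omega>) t (sket p) - propagator (H l \<Omega> \<omega>) t (sket p))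
    \<le> 2 * \<kappa> * sqrt (Re (pip p (num2_p p)))
      + \<bar>t\<bar> * (\<bar>l - \<kappa> * (\<omega> + \<Omega>)\<bar> * sqrt (Re (pip p (num2_p p))) + 3 * \<kappa> * l * sqrt (Re (pip p (num23_p p))))"
proof -
  have "l \<noteq> 0" using assms by simp
  then obtain v \<mu> where v: "schwartz_basis v (rwa_p l \<Omega> \<omega>) \<mu>"
    "\<And>k. exc_p (v k) = complex_of_real (real ((k + 1) div 2)) *\<^sub>P v k"
    using rwa_schwartz_basis by blast
  show ?thesis
    using assms excitation_le_number[of p]
    by (intro order_trans[OF rwa_estimate_eigen[OF assms v]] add_mono mult_left_mono real_sqrt_le_mono) auto
qed

lemma rwa_propagator_unitary:
  assumes "l \<noteq> 0"
  shows "unitary (propagator (H_RWA l \<Omega> \<omega>) t)"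
proof -
  obtain v \<mu> where "schwartz_basis v (rwa_p l \<Omega> \<omega>) \<mu>"
    using rwa_schwartz_basis[OF assms] by blast
  then interpret R: schwartz_basis v "rwa_p l \<Omega> \<omega>" \<mu> .
  show ?thesis unfolding H_RWA_eq R.graph_eq_diag R.propagator_diag by (rule R.evol_unitary)
qed

subsection \<open>Spectral measures of diagonal operators\<close>

context orthonormal_basis
begin

lemma norm_mult_le:
  assumes "\<And>k. cmod (m k) \<le> 1"
  shows "norm (mult m \<psi>) \<le> norm \<psi>"
proof -
  have "(norm (mult m \<psi>))\<^sup>2 \<le> (norm \<psi>)\<^sup>2"
  proof (rule sums_le[OF _ parseval_norm parseval_norm])
    fix k
    have "cmod (m k) * cmod (cinner (e k) \<psi>) \<le> 1 * cmod (cinner (e k) \<psi>)"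
      by (intro mult_right_mono assms) simp
    then show "(cmod (cinner (e k) (mult m \<psi>)))\<^sup>2 \<le> (cmod (cinner (e k) \<psi>))\<^sup>2"
      by (simp add: coeff_mult[OF assms] norm_mult power_mono)
  qed
  then show ?thesis by (simp add: power2_le_iff_abs_le)
qed

text \<open>The spectral measure of \<open>diag \<mu>\<close>: projection onto the basis vectors
  whose eigenvalue lies in \<open>B\<close>.\<close>

definition proj :: "(nat \<Rightarrow> real) \<Rightarrow> real set \<Rightarrow> spinor \<Rightarrow> spinor" where
  "proj \<mu> B = mult (\<lambda>k. if \<mu> k \<in> B then 1 else 0)"

lemma coeff_proj [simp]: "cinner (e k) (proj \<mu> B \<psi>) = (if \<mu> k \<in> B then cinner (e k) \<psi> else 0)"
  unfolding proj_def by (subst coeff_mult) auto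

lemma proj_linear: "clinear (proj \<mu> B)"
  unfolding proj_def by (rule mult_linear) simp

lemma norm_proj_le: "norm (proj \<mu> B \<psi>) \<le> norm \<psi>"
  unfolding proj_def by (rule norm_mult_le) simp

lemma proj_trunc: "proj \<mu> B (trunc n \<psi>) = (\<Sum>k<n. (if \<mu> k \<in> B then cinner (e k) \<psi> else 0) *\<^sub>C e k)"
  by (rule coeff_eqI) (simp add: trunc_def coeff_sum)

text \<open>A finite truncation sees only finitely many eigenvalues, so its projections stabilise;
  the tail is uniformly small because projections are contractions.\<close>

lemma proj_tendsto:
  assumes "\<And>k. \<forall>\<^sub>F m in sequentially. \<mu> k \<in> G m \<longleftrightarrow> \<mu> k \<in> B"
  shows "(\<lambda>m. proj \<mu> (G m) \<psi>) \<longlonglongrightarrow> proj \<mu> B \<psi>"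
proof (rule tendstoI)
  fix r :: real assume "r > 0"
  then have "\<forall>\<^sub>F n in sequentially. dist (trunc n \<psi>) \<psi> < r / 2"
    by (intro tendstoD[OF trunc_tendsto]) simp
  then obtain n where n: "norm (\<psi> - trunc n \<psi>) < r / 2"
    by (auto simp: eventually_sequentially dist_norm norm_minus_commute)
  have "\<forall>\<^sub>F m in sequentially. \<forall>k\<in>{..<n}. \<mu> k \<in> G m \<longleftrightarrow> \<mu> k \<in> B"
    by (rule eventually_ball_finite) (use assms in auto)
  then show "\<forall>\<^sub>F m in sequentially. dist (proj \<mu> (G m) \<psi>) (proj \<mu> B \<psi>) < r"
  proof (rule eventually_mono)
    fix m assume "\<forall>k\<in>{..<n}. \<mu> k \<in> G m \<longleftrightarrow> \<mu> k \<in> B"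
    then have "proj \<mu> (G m) (trunc n \<psi>) = proj \<mu> B (trunc n \<psi>)"
      unfolding proj_trunc by (intro sum.cong) auto
    then have "proj \<mu> (G m) \<psi> - proj \<mu> B \<psi> = proj \<mu> (G m) (\<psi> - trunc n \<psi>) - proj \<mu> B (\<psi> - trunc n \<psi>)"
      by (simp add: clinearD[OF proj_linear])
    then have "dist (proj \<mu> (G m) \<psi>) (proj \<mu> B \<psi>) \<le> norm (proj \<mu> (G m) (\<psi> - trunc n \<psi>)) + norm (proj \<mu> B (\<psi> - trunc n \<psi>))"
      by (simp only: dist_norm norm_triangle_ineq4)
    also have "\<dots> \<le> norm (\<psi> - trunc n \<psi>) + norm (\<psi> - trunc n \<psi>)"
      by (intro add_mono norm_proj_le)
    also have "\<dots> < r" using n by simp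
    finally show "dist (proj \<mu> (G m) \<psi>) (proj \<mu> B \<psi>) < r" .
  qed
qed

lemma proj_projection_valued_measure: "projection_valued_measure (proj \<mu>)"
  unfolding projection_valued_measure_def
proof (intro conjI allI ballI impI)
  show "orth_projection (proj \<mu> B)" for B
    unfolding orth_projection_def
  proof (intro conjI allI proj_linear)
    show "proj \<mu> B \<circ> proj \<mu> B = proj \<mu> B" by (intro ext coeff_eqI) simp
    show "cinner (proj \<mu> B \<phi>) \<psi> = cinner \<phi> (proj \<mu> B \<psi>)" for \<phi> \<psi>
      unfolding proj_def by (rule mult_self_adjoint) auto
  qed
  show "proj \<mu> UNIV = id" by (intro ext coeff_eqI) simp
  fix F :: "nat \<Rightarrow> real set" and \<psi> assume disj: "disjoint_family F"
  have "(\<Sum>n<m. proj \<mu> (F n) \<psi>) = proj \<mu> (\<Union>n<m. F n) \<psi>" for m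
  proof (induction m)
    case (Suc m)
    have "x \<notin> F m" if "n < m" "x \<in> F n" for n x
      using disj that disjoint_family_onD[of F UNIV n m] by auto
    then have "proj \<mu> (F m) \<psi> + proj \<mu> (\<Union>n<m. F n) \<psi> = proj \<mu> (\<Union>n<Suc m. F n) \<psi>"
      by (intro coeff_eqI) (auto simp: cinner_add_right lessThan_Suc)
    then show ?case using Suc by (simp add: add.commute)
  qed (auto intro!: coeff_eqI)
  moreover have "(\<lambda>m. proj \<mu> (\<Union>n<m. F n) \<psi>) \<longlonglongrightarrow> proj \<mu> (\<Union>n. F n) \<psi>"
  proof (rule proj_tendsto)
    fix k
    show "\<forall>\<^sub>F m in sequentially. \<mu> k \<in> (\<Union>n<m. F n) \<longleftrightarrow> \<mu> k \<in> (\<Union>n. F n)"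
    proof (cases "\<mu> k \<in> (\<Union>n. F n)")
      case True
      then obtain n where "\<mu> k \<in> F n" by blast
      then show ?thesis by (intro eventually_mono[OF eventually_gt_at_top[of n]]) auto
    qed auto
  qed
  ultimately show "(\<lambda>n. proj \<mu> (F n) \<psi>) sums proj \<mu> (\<Union>n. F n) \<psi>" by (simp add: sums_def)
qed

text \<open>Point masses |<e_k, psi>|^2 at the eigenvalues, written as the image of a weighted
  counting measure so that integrals become series.\<close>

definition weight_measure :: "(nat \<Rightarrow> real) \<Rightarrow> spinor \<Rightarrow> real measure" where
  "weight_measure \<mu> \<psi> = distr (density (count_space UNIV) (\<lambda>k. ennreal ((cmod (cinner (e k) \<psi>))\<^sup>2))) borel \<mu>"

lemma diag_measure_proj: "diag_measure (proj \<mu>) \<psi> = weight_measure \<mu> \<psi>"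
proof -
  have "ennreal (Re (cinner \<psi> (proj \<mu> B \<psi>))) = emeasure (weight_measure \<mu> \<psi>) B" if B: "B \<in> sets borel" for B
  proof -
    have "(\<lambda>k. Re (cnj (cinner (e k) \<psi>) * cinner (e k) (proj \<mu> B \<psi>))) sums Re (cinner \<psi> (proj \<mu> B \<psi>))"
      by (intro sums_Re parseval)
    moreover have "Re (cnj z * z) = (cmod z)\<^sup>2" for z by (simp add: cmod_power2) (simp add: power2_eq_square)
    then have "Re (cnj (cinner (e k) \<psi>) * cinner (e k) (proj \<mu> B \<psi>)) = (cmod (cinner (e k) \<psi>))\<^sup>2 * indicator (\<mu> -` B) k" for k
      by (simp split: split_indicator)
    ultimately have "(\<lambda>k. (cmod (cinner (e k) \<psi>))\<^sup>2 * indicator (\<mu> -` B) k) sums Re (cinner \<psi> (proj \<mu> B \<psi>))" by simp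
    then have "(\<Sum>k. ennreal ((cmod (cinner (e k) \<psi>))\<^sup>2 * indicator (\<mu> -` B) k)) = ennreal (Re (cinner \<psi> (proj \<mu> B \<psi>)))"
      by (intro suminf_ennreal_eq) auto
    moreover have "emeasure (weight_measure \<mu> \<psi>) B = (\<Sum>k. ennreal ((cmod (cinner (e k) \<psi>))\<^sup>2 * indicator (\<mu> -` B) k))"
      using B unfolding weight_measure_def
      by (simp add: emeasure_distr emeasure_density nn_integral_count_space_nat ennreal_mult ennreal_indicator)
    ultimately show ?thesis by simp
  qed
  then have "diag_measure (proj \<mu>) \<psi> = measure_of UNIV (sets borel) (emeasure (weight_measure \<mu> \<psi>))"
    unfolding diag_measure_def by (intro measure_of_eq) (auto simp: sets.sigma_sets_eq[of "borel :: real measure", simplified])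
  also have "\<dots> = weight_measure \<mu> \<psi>"
    using measure_of_of_measure[of "weight_measure \<mu> \<psi>"] by (simp add: weight_measure_def)
  finally show ?thesis .
qed

lemma integrable_weight_measure:
  fixes f :: "real \<Rightarrow> 'b :: {banach, second_countable_topology}"
  assumes [measurable]: "f \<in> borel_measurable borel"
  shows "integrable (weight_measure \<mu> \<psi>) f \<longleftrightarrow> summable (\<lambda>k. (cmod (cinner (e k) \<psi>))\<^sup>2 * norm (f (\<mu> k)))"
  unfolding weight_measure_def
  by (subst integrable_distr_eq, simp, simp, subst integrable_density)
    (auto simp: integrable_count_space_nat_iff)

lemma integral_weight_measure:
  fixes f :: "real \<Rightarrow> 'b :: {banach, second_countable_topology}"
  assumes [measurable]: "f \<in> borel_measurable borel" and "integrable (weight_measure \<mu> \<psi>) f"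
  shows "(LINT x|weight_measure \<mu> \<psi>. f x) = (\<Sum>k. (cmod (cinner (e k) \<psi>))\<^sup>2 *\<^sub>R f (\<mu> k))"
proof -
  have "summable (\<lambda>k. (cmod (cinner (e k) \<psi>))\<^sup>2 * norm (f (\<mu> k)))"
    using assms(2) by (simp add: integrable_weight_measure)
  then have "integrable (count_space UNIV) (\<lambda>k. (cmod (cinner (e k) \<psi>))\<^sup>2 *\<^sub>R f (\<mu> k))"
    by (simp add: integrable_count_space_nat_iff)
  then show ?thesis
    unfolding weight_measure_def
    by (subst integral_distr, simp, simp, subst integral_density) (auto simp: integral_count_space_nat)
qed

lemma spectral_integral_diag:
  assumes [measurable]: "F \<in> borel_measurable borel"
  shows "is_spectral_integral (proj \<mu>) (\<lambda>x. complex_of_real (F x)) (diag (\<lambda>k. F (\<mu> k)))"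
  unfolding is_spectral_integral_def diag_measure_proj
proof (intro conjI clinear_graph_diag)
  have F2: "integrable (weight_measure \<mu> \<psi>) (\<lambda>x. (cmod (complex_of_real (F x)))\<^sup>2) \<longleftrightarrow>
      summable (\<lambda>k. (F (\<mu> k) * cmod (cinner (e k) \<psi>))\<^sup>2)" for \<psi>
    by (subst integrable_weight_measure) (auto simp: power_mult_distrib mult.commute)
  show "Domain (diag (\<lambda>k. F (\<mu> k))) = {\<psi>. integrable (weight_measure \<mu> \<psi>) (\<lambda>x. (cmod (complex_of_real (F x)))\<^sup>2)}"
    by (simp only: F2 diag_Domain_iff[symmetric] Collect_mem_eq)
  show "\<forall>(\<psi>, \<eta>)\<in>diag (\<lambda>k. F (\<mu> k)). cinner \<psi> \<eta> = (LINT x|weight_measure \<mu> \<psi>. complex_of_real (F x))"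
  proof clarify
    fix \<psi> \<eta> assume d: "(\<psi>, \<eta>) \<in> diag (\<lambda>k. F (\<mu> k))"
    then have "summable (\<lambda>k. (F (\<mu> k) * cmod (cinner (e k) \<psi>))\<^sup>2)" by (auto simp: diag_Domain_iff[symmetric])
    then have s: "summable (\<lambda>k. (cmod (cinner (e k) \<psi>))\<^sup>2 + (F (\<mu> k) * cmod (cinner (e k) \<psi>))\<^sup>2)"
      by (intro summable_add summable_coeff)
    \<comment> \<open>The domain condition concerns F^2; integrability of F follows from |F| <= 1 +
      F^2, as the weights themselves are summable.\<close>
    have int: "integrable (weight_measure \<mu> \<psi>) (\<lambda>x. complex_of_real (F x))"
    proof (subst integrable_weight_measure, simp, rule summable_comparison_test'[OF s, of 0])
      fix k
      define c where "c = cmod (cinner (e k) \<psi>)"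
      have "c\<^sup>2 * \<bar>F (\<mu> k)\<bar> \<le> c\<^sup>2 * (1 + (F (\<mu> k))\<^sup>2)"
        using sum_squares_bound[of 1 "\<bar>F (\<mu> k)\<bar>"] by (intro mult_left_mono) auto
      then show "norm ((cmod (cinner (e k) \<psi>))\<^sup>2 * norm (complex_of_real (F (\<mu> k))))
          \<le> (cmod (cinner (e k) \<psi>))\<^sup>2 + (F (\<mu> k) * cmod (cinner (e k) \<psi>))\<^sup>2"
        unfolding c_def[symmetric] by (simp add: abs_mult power_mult_distrib algebra_simps)
    qed
    have "cnj (cinner (e k) \<psi>) * cinner (e k) \<eta> = (cmod (cinner (e k) \<psi>))\<^sup>2 *\<^sub>R complex_of_real (F (\<mu> k))" for k
    proof -
      have "cnj z * (complex_of_real r * z) = (cmod z)\<^sup>2 *\<^sub>R complex_of_real r" for z r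
        unfolding scaleR_conv_of_real complex_norm_square by simp
      then show ?thesis using d by (simp add: diag_def)
    qed
    then have "(\<lambda>k. (cmod (cinner (e k) \<psi>))\<^sup>2 *\<^sub>R complex_of_real (F (\<mu> k))) sums cinner \<psi> \<eta>"
      using parseval[of \<psi> \<eta>] by simp
    then show "cinner \<psi> \<eta> = (LINT x|weight_measure \<mu> \<psi>. complex_of_real (F x))"
      using integral_weight_measure[OF _ int] by (simp add: sums_iff)
  qed
qed

end

section \<open>Uniqueness of the spectral measure and the functional calculus\<close>

lemma clinear_graphD:
  assumes "clinear_graph T"
  shows "(\<psi>, \<eta>) \<in> T \<Longrightarrow> (\<psi>, \<eta>') \<in> T \<Longrightarrow> \<eta> = \<eta>'"
    "(\<psi>, \<eta>) \<in> T \<Longrightarrow> (\<psi>', \<eta>') \<in> T \<Longrightarrow> (\<psi> + \<psi>', \<eta> + \<eta>') \<in> T"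
    "(\<psi>, \<eta>) \<in> T \<Longrightarrow> (c *\<^sub>C \<psi>, c *\<^sub>C \<eta>) \<in> T"
  using assms by (auto simp: clinear_graph_def single_valued_def)

text \<open>Polarisation: equality of the forms on \<open>\<psi>\<close> + c \<open>\<phi>\<close>
  for all complex c isolates the off-diagonal terms, and the domain separates vectors.\<close>

lemma form_determines_operator:
  assumes S: "clinear_graph S" and T: "clinear_graph T" and dom: "Domain S = Domain T"
    and form: "\<And>\<psi> \<eta> \<eta>'. (\<psi>, \<eta>) \<in> S \<Longrightarrow> (\<psi>, \<eta>') \<in> T \<Longrightarrow> cinner \<psi> \<eta> = cinner \<psi> \<eta>'"
    and dense: "\<And>\<psi>. (\<And>\<phi>. \<phi> \<in> Domain S \<Longrightarrow> cinner \<phi> \<psi> = 0) \<Longrightarrow> \<psi> = 0"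
  shows "S = T"
proof -
  have eq: "\<eta> = \<eta>'" if \<psi>: "(\<psi>, \<eta>) \<in> S" "(\<psi>, \<eta>') \<in> T" for \<psi> \<eta> \<eta>'
  proof -
    have "cinner \<phi> (\<eta> - \<eta>') = 0" if "\<phi> \<in> Domain S" for \<phi>
    proof -
      obtain \<xi> \<xi>' where \<phi>: "(\<phi>, \<xi>) \<in> S" "(\<phi>, \<xi>') \<in> T" using \<open>\<phi> \<in> Domain S\<close> dom by blast
      have "cinner (\<psi> + c *\<^sub>C \<phi>) (\<eta> + c *\<^sub>C \<xi>) = cinner (\<psi> + c *\<^sub>C \<phi>) (\<eta>' + c *\<^sub>C \<xi>')" for c
        by (intro form clinear_graphD(2,3)[OF S] clinear_graphD(2,3)[OF T] \<psi> \<phi>)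
      then have pol: "c * cinner \<psi> (\<xi> - \<xi>') + cnj c * cinner \<phi> (\<eta> - \<eta>') = 0" for c
        using form[OF \<psi>] form[OF \<phi>] by (simp add: cinner_add_left cinner_add_right cinner_diff_right algebra_simps)
      \<comment> \<open>c = \<i> shows that the two mixed terms are equal and c = 1 that they are
        opposite, so both vanish.\<close>
      have "\<i> * (cinner \<psi> (\<xi> - \<xi>') - cinner \<phi> (\<eta> - \<eta>')) = 0"
        using pol[of \<i>] by (simp add: right_diff_distrib)
      with pol[of 1] show ?thesis by simp
    qed
    then show ?thesis using dense[of "\<eta> - \<eta>'"] by simp
  qed
  show ?thesis
  proof (intro subset_antisym subrelI)
    fix \<psi> \<eta>
    show "(\<psi>, \<eta>) \<in> T" if "(\<psi>, \<eta>) \<in> S" using that eq dom by blast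
    show "(\<psi>, \<eta>) \<in> S" if "(\<psi>, \<eta>) \<in> T" using that eq dom by blast
  qed
qed

locale pvm =
  fixes E :: "real set \<Rightarrow> spinor \<Rightarrow> spinor"
  assumes E: "projection_valued_measure E"
begin

lemma E_linear: "B \<in> sets borel \<Longrightarrow> clinear (E B)"
  and E_idem: "B \<in> sets borel \<Longrightarrow> E B (E B \<psi>) = E B \<psi>"
  and E_sym: "B \<in> sets borel \<Longrightarrow> cinner (E B \<phi>) \<psi> = cinner \<phi> (E B \<psi>)"
  and E_UNIV [simp]: "E UNIV \<psi> = \<psi>"
  using E by (auto simp: projection_valued_measure_def orth_projection_def fun_eq_iff)

lemma E_sums: "range F \<subseteq> sets borel \<Longrightarrow> disjoint_family F \<Longrightarrow> (\<lambda>n. E (F n) \<psi>) sums E (\<Union>n. F n) \<psi>"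
  using E by (auto simp: projection_valued_measure_def)

lemma E_empty [simp]: "E {} \<psi> = 0"
proof -
  have "(\<lambda>n :: nat. E {} \<psi>) sums E {} \<psi>"
    using E_sums[of "\<lambda>_. {}" \<psi>] by (auto simp: disjoint_family_on_def)
  then have "(\<lambda>n :: nat. E {} \<psi>) \<longlonglongrightarrow> 0" by (intro summable_LIMSEQ_zero) (auto simp: sums_iff)
  then show ?thesis by (simp add: LIMSEQ_const_iff)
qed

lemma E_Un:
  assumes "A \<in> sets borel" "B \<in> sets borel" "A \<inter> B = {}"
  shows "E (A \<union> B) \<psi> = E A \<psi> + E B \<psi>"
proof (rule sums_unique2)
  show "(\<lambda>n. E (binaryset A B n) \<psi>) sums (E A \<psi> + E B \<psi>)"
    by (rule binaryset_sums[of "\<lambda>A. E A \<psi>"]) simp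
  have "disjoint_family (binaryset A B)"
    using assms(3) by (auto simp: disjoint_family_on_def binaryset_def)
  then show "(\<lambda>n. E (binaryset A B n) \<psi>) sums E (A \<union> B) \<psi>"
    using E_sums[of "binaryset A B" \<psi>] assms(1,2) by (simp add: range_binaryset_eq UN_binaryset_eq)
qed

text \<open>Only additivity is postulated. Idempotence on the union makes the two projections
  anticommute; multiplying by either one shows that they also commute, so the product is 0.\<close>

lemma E_disjoint:
  assumes "A \<in> sets borel" "B \<in> sets borel" "A \<inter> B = {}"
  shows "E A (E B \<psi>) = 0"
proof -
  note l = clinearD[OF E_linear[OF assms(1)]] clinearD[OF E_linear[OF assms(2)]]
  have anti: "E A (E B \<psi>) + E B (E A \<psi>) = 0" for \<psi>
  proof -
    have "E (A \<union> B) (E (A \<union> B) \<psi>) = E (A \<union> B) \<psi>" using assms by (intro E_idem) auto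
    then show ?thesis using assms by (simp add: E_Un l E_idem algebra_simps)
  qed
  have "E A (E B \<psi>) + E A (E B (E A \<psi>)) = 0"
    using arg_cong[OF anti[of \<psi>], of "E A"] assms by (simp add: l E_idem)
  moreover have "E A (E B (E A \<psi>)) + E B (E A \<psi>) = 0"
    using anti[of "E A \<psi>"] assms by (simp add: E_idem)
  ultimately have "E A (E B \<psi>) = E B (E A \<psi>)" by (metis add.commute add_left_imp_eq)
  with anti[of \<psi>] have "2 *\<^sub>R E A (E B \<psi>) = 0" by (simp add: scaleR_2)
  then show ?thesis by simp
qed

lemma E_Int:
  assumes "A \<in> sets borel" "B \<in> sets borel"
  shows "E A (E B \<psi>) = E (A \<inter> B) \<psi>"
proof -
  have AB: "A \<inter> B \<in> sets borel" "A - B \<in> sets borel" "B - A \<in> sets borel" using assms by auto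
  have "E A \<phi> = E (A \<inter> B) \<phi> + E (A - B) \<phi>" for \<phi>
    using E_Un[OF AB(1,2)] by (simp add: Int_Diff_Un Int_Diff_disjoint)
  moreover have "E B \<psi> = E (A \<inter> B) \<psi> + E (B - A) \<psi>"
    using E_Un[OF AB(1,3)] Int_Diff_disjoint[of B A] Int_Diff_Un[of B A] by (simp add: Int_commute)
  moreover have "E (A - B) (E (A \<inter> B) \<psi>) = 0" "E (A \<inter> B) (E (B - A) \<psi>) = 0" "E (A - B) (E (B - A) \<psi>) = 0"
    by (intro E_disjoint AB; blast)+
  ultimately show ?thesis
    by (simp add: clinearD[OF E_linear[OF AB(1)]] clinearD[OF E_linear[OF AB(2)]] E_idem[OF AB(1)])
qed

lemma E_form: "B \<in> sets borel \<Longrightarrow> cinner \<psi> (E B \<psi>) = complex_of_real ((norm (E B \<psi>))\<^sup>2)"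
  unfolding cinner_self[symmetric] by (simp only: E_sym E_idem)

lemma E_norm_le: "B \<in> sets borel \<Longrightarrow> norm (E B \<psi>) \<le> norm \<psi>"
proof -
  assume "B \<in> sets borel"
  then have "norm (E B \<psi>) * norm (E B \<psi>) \<le> norm \<psi> * norm (E B \<psi>)"
    using cinner_cauchy_schwarz[of \<psi> "E B \<psi>"] by (simp add: E_form norm_power power2_eq_square norm_mult)
  then show ?thesis by (cases "E B \<psi> = 0") auto
qed

lemma sets_diag_measure [simp, measurable_cong]: "sets (diag_measure E \<psi>) = sets borel"
  and space_diag_measure [simp]: "space (diag_measure E \<psi>) = UNIV"
  using sets.sigma_sets_eq[of "borel :: real measure"] by (simp_all add: diag_measure_def)

lemma emeasure_diag_measure:
  assumes "B \<in> sets borel"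
  shows "emeasure (diag_measure E \<psi>) B = ennreal ((norm (E B \<psi>))\<^sup>2)"
proof -
  have "emeasure (diag_measure E \<psi>) B = ennreal (Re (cinner \<psi> (E B \<psi>)))"
    unfolding diag_measure_def
  proof (rule emeasure_measure_of_sigma)
    show "sigma_algebra UNIV (sets (borel :: real measure))"
      using sets.sigma_algebra_axioms[of "borel :: real measure"] by simp
    show "positive (sets borel) (\<lambda>B. ennreal (Re (cinner \<psi> (E B \<psi>))))"
      by (simp add: positive_def)
    show "countably_additive (sets borel) (\<lambda>B. ennreal (Re (cinner \<psi> (E B \<psi>))))"
    proof (rule countably_additiveI)
      fix F :: "nat \<Rightarrow> real set" assume F: "range F \<subseteq> sets borel" "disjoint_family F"
      have "(\<lambda>n. Re (cinner \<psi> (E (F n) \<psi>))) sums Re (cinner \<psi> (E (\<Union>n. F n) \<psi>))"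
        by (intro sums_Re bounded_linear.sums[OF bounded_linear_cinner_right E_sums[OF F]])
      then show "(\<Sum>n. ennreal (Re (cinner \<psi> (E (F n) \<psi>)))) = ennreal (Re (cinner \<psi> (E (\<Union>n. F n) \<psi>)))"
        using F by (intro suminf_ennreal_eq) (auto simp: E_form range_subsetD)
    qed
  qed (rule assms)
  then show ?thesis by (simp add: E_form[OF assms])
qed

lemma finite_diag_measure: "finite_measure (diag_measure E \<psi>)"
  by (rule finite_measureI) (simp add: emeasure_diag_measure)

lemma diag_measure_restrict:
  assumes [measurable]: "B \<in> sets borel"
  shows "diag_measure E (E B \<psi>) = density (diag_measure E \<psi>) (\<lambda>x. ennreal (indicator B x))"
proof (rule measure_eqI)
  fix C assume "C \<in> sets (diag_measure E (E B \<psi>))"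
  then have [measurable]: "C \<in> sets borel" by simp
  have "emeasure (density (diag_measure E \<psi>) (\<lambda>x. ennreal (indicator B x))) C = (\<integral>\<^sup>+x. indicator (B \<inter> C) x \<partial>diag_measure E \<psi>)"
    by (subst emeasure_density, simp, simp, rule nn_integral_cong) (simp split: split_indicator)
  then show "emeasure (diag_measure E (E B \<psi>)) C = emeasure (density (diag_measure E \<psi>) (\<lambda>x. ennreal (indicator B x))) C"
    by (simp add: emeasure_diag_measure E_Int Int_commute)
qed simp

text \<open>Adding \<open>E B \<psi>\<close> doubles the part of \<open>\<psi>\<close> in
  \<open>B\<close>; the squared norm there is multiplied by 4 = 1 + 3.\<close>

lemma diag_measure_add_restrict:
  assumes [measurable]: "B \<in> sets borel"
  shows "diag_measure E (\<psi> + E B \<psi>) = density (diag_measure E \<psi>) (\<lambda>x. ennreal (1 + 3 * indicator B x))"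
proof (rule measure_eqI)
  fix C assume "C \<in> sets (diag_measure E (\<psi> + E B \<psi>))"
  then have C [measurable]: "C \<in> sets borel" by simp
  have "E C \<psi> = E (C \<inter> B) \<psi> + E (C - B) \<psi>"
    using E_Un[of "C \<inter> B" "C - B"] by (auto simp: Int_Diff_Un)
  moreover have orth: "cinner (r *\<^sub>C E (C \<inter> B) \<psi>) (E (C - B) \<psi>) = 0" for r
  proof -
    have "cinner (E (C \<inter> B) \<psi>) (E (C - B) \<psi>) = cinner \<psi> (E (C \<inter> B) (E (C - B) \<psi>))"
      by (rule E_sym) measurable
    also have "E (C \<inter> B) (E (C - B) \<psi>) = 0" by (rule E_disjoint) auto
    finally show ?thesis by simp
  qed
  moreover have "E C (\<psi> + E B \<psi>) = 2 *\<^sub>C E (C \<inter> B) \<psi> + E (C - B) \<psi>"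
    using calculation(1) scaleC_add_left[of 1 1 "E (C \<inter> B) \<psi>"] by (simp add: clinearD[OF E_linear[OF C]] E_Int)
  ultimately have "(norm (E C (\<psi> + E B \<psi>)))\<^sup>2 = (norm (E C \<psi>))\<^sup>2 + 3 * (norm (E (C \<inter> B) \<psi>))\<^sup>2"
    using inner_self_pythagoras[OF orth[of 1]] inner_self_pythagoras[OF orth[of 2]] by (simp add: power_mult_distrib)
  moreover have "emeasure (density (diag_measure E \<psi>) (\<lambda>x. ennreal (1 + 3 * indicator B x))) C
      = (\<integral>\<^sup>+x. indicator C x + 3 * indicator (C \<inter> B) x \<partial>diag_measure E \<psi>)"
    by (subst emeasure_density, simp, simp, rule nn_integral_cong) (simp split: split_indicator)
  then have "emeasure (density (diag_measure E \<psi>) (\<lambda>x. ennreal (1 + 3 * indicator B x))) C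
      = ennreal ((norm (E C \<psi>))\<^sup>2) + 3 * ennreal ((norm (E (C \<inter> B) \<psi>))\<^sup>2)"
    by (simp add: nn_integral_add nn_integral_cmult emeasure_diag_measure)
  moreover have "ennreal (a + 3 * b) = ennreal a + 3 * ennreal b" if "0 \<le> a" "0 \<le> b" for a b
    using that by (simp add: ennreal_mult)
  ultimately show "emeasure (diag_measure E (\<psi> + E B \<psi>)) C = emeasure (density (diag_measure E \<psi>) (\<lambda>x. ennreal (1 + 3 * indicator B x))) C"
    by (simp only: emeasure_diag_measure[OF C] zero_le_power2)
qed simp

end

text \<open>Comparing the quadratic form at an eigenvector \<open>\<psi>\<close> of eigenvalue \<open>n\<close>, at \<open>E B \<psi>\<close>, and at
  \<open>\<psi> + E B \<psi>\<close> shows that \<open>x - n\<close> integrates to zero over \<open>B\<close>.\<close>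

lemma (in pvm) eigenvector_concentrated:
  assumes A: "is_spectral_integral E complex_of_real A"
    and sym: "\<And>\<phi> \<xi>. (\<phi>, \<xi>) \<in> A \<Longrightarrow> cinner \<psi> \<xi> = complex_of_real n * cinner \<psi> \<phi>"
    and \<psi>: "(\<psi>, complex_of_real n *\<^sub>C \<psi>) \<in> A"
    and B [measurable]: "B \<in> sets borel" and side: "(\<forall>x\<in>B. n < x) \<or> (\<forall>x\<in>B. x < n)"
  shows "E B \<psi> = 0"
proof -
  let ?M = "diag_measure E \<psi>"
  interpret M: finite_measure ?M by (rule finite_diag_measure)
  have lin: "clinear_graph A" and dom: "\<And>\<phi>. \<phi> \<in> Domain A \<longleftrightarrow> integrable (diag_measure E \<phi>) (\<lambda>x. x\<^sup>2)"
    and form: "\<And>\<phi> \<eta>. (\<phi>, \<eta>) \<in> A \<Longrightarrow> cinner \<phi> \<eta> = complex_of_real (LINT x|diag_measure E \<phi>. x)"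
    using A by (auto simp: is_spectral_integral_def integral_complex_of_real)
  have sq: "integrable ?M (\<lambda>x. x\<^sup>2)" using dom \<psi> by blast
  have id: "integrable ?M (\<lambda>x. x)"
  proof (rule Bochner_Integration.integrable_bound)
    show "integrable ?M (\<lambda>x. 1 + x\<^sup>2)" using sq by simp
    show "AE x in ?M. norm x \<le> norm (1 + x\<^sup>2)"
    proof (rule always_eventually, rule allI)
      fix x :: real
      have "\<bar>x\<bar> \<le> 1 + x\<^sup>2" using sum_squares_bound[of 1 "\<bar>x\<bar>"] by simp
      then show "norm x \<le> norm (1 + x\<^sup>2)" by simp
    qed
  qed measurable
  have id_B: "integrable ?M (\<lambda>x. indicator B x * x)"
    using integrable_mult_indicator[OF _ id, of B] by simp
  define a where "a = (LINT x|?M. indicator B x * x)"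
  have "integrable (diag_measure E (E B \<psi>)) (\<lambda>x. x\<^sup>2)"
    unfolding diag_measure_restrict[OF B] using integrable_mult_indicator[OF _ sq, of B] by (subst integrable_density) auto
  then obtain \<eta> where \<eta>: "(E B \<psi>, \<eta>) \<in> A" using dom by blast
  have "cinner (E B \<psi>) \<eta> = complex_of_real a"
    unfolding form[OF \<eta>] diag_measure_restrict[OF B] a_def by (subst integral_density) auto
  moreover have "cinner \<psi> (complex_of_real n *\<^sub>C \<psi>) = complex_of_real (LINT x|?M. x)" by (rule form[OF \<psi>])
  moreover have "cinner (\<psi> + E B \<psi>) (complex_of_real n *\<^sub>C \<psi> + \<eta>) = complex_of_real ((LINT x|?M. x) + 3 * a)"
  proof -
    have "(LINT x|density ?M (\<lambda>x. ennreal (1 + 3 * indicator B x)). x) = (LINT x|?M. x + 3 * (indicator B x * x))"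
      by (subst integral_density) (auto intro!: Bochner_Integration.integral_cong split: split_indicator)
    also have "\<dots> = (LINT x|?M. x) + 3 * a" using id id_B by (simp add: a_def)
    finally show ?thesis
      unfolding form[OF clinear_graphD(2)[OF lin \<psi> \<eta>]] diag_measure_add_restrict[OF B] by simp
  qed
  moreover have "cinner \<psi> \<eta> = complex_of_real (n * (norm (E B \<psi>))\<^sup>2)"
    using sym[OF \<eta>] by (simp add: E_form)
  moreover have "cinner (E B \<psi>) \<psi> = complex_of_real ((norm (E B \<psi>))\<^sup>2)"
    by (simp only: E_sym[OF B] E_form[OF B])
  \<comment> \<open>The two mixed terms are what remains of the form at the sum: each equals n |E B
    psi|^2, and together they equal 3 a - a.\<close>
  ultimately have "complex_of_real (n * (norm (E B \<psi>))\<^sup>2 + n * (norm (E B \<psi>))\<^sup>2) = complex_of_real (a + a)"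
    by (simp add: cinner_add_left cinner_add_right algebra_simps)
  then have a: "a = n * (norm (E B \<psi>))\<^sup>2" by (simp only: of_real_eq_iff)
  have m: "measure ?M B = (norm (E B \<psi>))\<^sup>2" by (simp add: measure_def emeasure_diag_measure)
  have int: "integrable ?M (\<lambda>x. indicator B x * x - n * indicator B x)"
    using id_B by (auto simp: M.emeasure_eq_measure)
  have "(LINT x|?M. indicator B x * x - n * indicator B x) = a - n * measure ?M B"
    using id_B by (subst Bochner_Integration.integral_diff) (auto simp: a_def M.emeasure_eq_measure)
  then have zero: "(LINT x|?M. indicator B x * x - n * indicator B x) = 0" by (simp add: a m)
  \<comment> \<open>On one side of n the integrand has constant sign, so a zero integral forces it
    to vanish almost everywhere.\<close>
  have "AE x in ?M. indicator B x * x - n * indicator B x = 0"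
  proof (cases "\<forall>x\<in>B. n < x")
    case True
    then have "0 \<le> indicator B x * x - n * indicator B x" for x
      by (auto simp: less_imp_le split: split_indicator)
    then show ?thesis using integral_nonneg_eq_0_iff_AE[OF int] zero by blast
  next
    case False
    then have "\<forall>x\<in>B. x < n" using side by blast
    then have "0 \<le> - (indicator B x * x - n * indicator B x)" for x
      by (auto simp: less_imp_le split: split_indicator)
    moreover have "(LINT x|?M. - (indicator B x * x - n * indicator B x)) = 0"
      using zero by (simp only: integral_minus minus_zero)
    ultimately have "AE x in ?M. - (indicator B x * x - n * indicator B x) = 0"
      using integral_nonneg_eq_0_iff_AE[OF integrable_minus[OF int]] by blast
    then show ?thesis by (simp only: neg_equal_0_iff_equal)
  qed
  then have "AE x in ?M. x \<notin> B"
  proof (rule eventually_mono)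
    fix x assume "indicator B x * x - n * indicator B x = 0"
    then show "x \<notin> B" using side by (auto simp: indicator_def split: if_splits)
  qed
  then have "emeasure ?M B = 0" by (subst (asm) AE_iff_measurable[of B]) auto
  then show ?thesis by (simp add: emeasure_diag_measure)
qed

context orthonormal_basis
begin

text \<open>The complement of {\<open>\<mu> k\<close>} consists of two half-lines on which x -
  \<open>\<mu> k\<close> has constant sign, so any spectral measure concentrates \<open>e k\<close>
  at its eigenvalue. Basis vectors then determine each bounded projection.\<close>

lemma spectral_measure_unique:
  assumes sp: "spectral_measure (diag \<mu>) E" and C: "C \<in> sets borel"
  shows "E C = proj \<mu> C"
proof
  interpret pvm E by standard (use sp in \<open>simp add: spectral_measure_def\<close>)
  have A: "is_spectral_integral E complex_of_real (diag \<mu>)" using sp by (simp add: spectral_measure_def)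
  have basis: "E C (e k) = proj \<mu> C (e k)" for k
  proof -
    have out: "E B (e k) = 0" if "B \<in> sets borel" "(\<forall>x\<in>B. \<mu> k < x) \<or> (\<forall>x\<in>B. x < \<mu> k)" for B
      by (rule eigenvector_concentrated[OF A _ diag_basis that]) (auto simp: diag_def)
    have "E UNIV (e k) = E {..<\<mu> k} (e k) + E {\<mu> k..} (e k)"
    proof -
      have "{..<\<mu> k} \<union> {\<mu> k..} = UNIV" "{..<\<mu> k} \<inter> {\<mu> k..} = {}" by auto
      then show ?thesis using E_Un[of "{..<\<mu> k}" "{\<mu> k..}" "e k"] by auto
    qed
    also have "E {\<mu> k..} (e k) = E {\<mu> k} (e k) + E {\<mu> k<..} (e k)"
      by (subst E_Un[symmetric]) (auto intro!: arg_cong[where f = "\<lambda>A. E A (e k)"])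
    finally have conc: "E {\<mu> k} (e k) = e k" by (simp add: out)
    have "E C (e k) = E (C \<inter> {\<mu> k}) (e k)" using E_Int[OF C, of "{\<mu> k}" "e k"] by (simp add: conc)
    also have "\<dots> = (if \<mu> k \<in> C then e k else 0)" by (simp add: conc)
    also have "\<dots> = proj \<mu> C (e k)" by (rule coeff_eqI) (auto simp: orthonormal)
    finally show ?thesis .
  qed
  fix \<psi>
  have "bounded_linear (E C)" "bounded_linear (proj \<mu> C)"
    using bounded_linear_clinear[OF E_linear[OF C], of 1] bounded_linear_clinear[OF proj_linear, of _ _ 1] E_norm_le[OF C] norm_proj_le
    by auto
  then have "(\<lambda>n. E C (trunc n \<psi>)) \<longlonglongrightarrow> E C \<psi>" "(\<lambda>n. proj \<mu> C (trunc n \<psi>)) \<longlonglongrightarrow> proj \<mu> C \<psi>"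
    using bounded_linear.tendsto trunc_tendsto by blast+
  moreover have "E C (trunc n \<psi>) = proj \<mu> C (trunc n \<psi>)" for n
    unfolding trunc_def by (simp add: clinearD[OF E_linear[OF C]] clinearD[OF proj_linear] basis)
  ultimately show "E C \<psi> = proj \<mu> C \<psi>" using LIMSEQ_unique by simp
qed

text \<open>The description ranges over the spectral measure as well: uniqueness of that measure
  fixes the diagonal measures, and the quadratic form then fixes the operator.\<close>

lemma fun_calc_diag:
  assumes [measurable]: "F \<in> borel_measurable borel"
  shows "fun_calc (\<lambda>x. complex_of_real (F x)) (diag \<mu>) = diag (\<lambda>k. F (\<mu> k))"
  unfolding fun_calc_def
proof (rule the_equality)
  have sp: "spectral_measure (diag \<mu>) (proj \<mu>)"
    unfolding spectral_measure_def
    using proj_projection_valued_measure spectral_integral_diag[of "\<lambda>x. x" \<mu>] by simp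
  show "\<exists>E. spectral_measure (diag \<mu>) E \<and> is_spectral_integral E (\<lambda>x. complex_of_real (F x)) (diag (\<lambda>k. F (\<mu> k)))"
    using sp spectral_integral_diag[OF assms] by blast
  fix T assume "\<exists>E. spectral_measure (diag \<mu>) E \<and> is_spectral_integral E (\<lambda>x. complex_of_real (F x)) T"
  then obtain E where E: "spectral_measure (diag \<mu>) E" "is_spectral_integral E (\<lambda>x. complex_of_real (F x)) T" by blast
  have "diag_measure E \<psi> = diag_measure (proj \<mu>) \<psi>" for \<psi>
    unfolding diag_measure_def
  proof (rule measure_of_eq)
    fix B assume "B \<in> sigma_sets UNIV (sets (borel :: real measure))"
    then have "B \<in> sets borel" using sets.sigma_sets_eq[of "borel :: real measure"] by simp
    then show "ennreal (Re (cinner \<psi> (E B \<psi>))) = ennreal (Re (cinner \<psi> (proj \<mu> B \<psi>)))"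
      by (simp add: spectral_measure_unique[OF E(1)])
  qed simp
  then have T: "is_spectral_integral (proj \<mu>) (\<lambda>x. complex_of_real (F x)) T"
    using E(2) by (simp add: is_spectral_integral_def)
  note D = spectral_integral_diag[OF assms, of \<mu>]
  show "T = diag (\<lambda>k. F (\<mu> k))"
  proof (rule form_determines_operator)
    show "clinear_graph T" "clinear_graph (diag (\<lambda>k. F (\<mu> k)))" "Domain T = Domain (diag (\<lambda>k. F (\<mu> k)))"
      using T D by (simp_all only: is_spectral_integral_def)
    show "cinner \<psi> \<eta> = cinner \<psi> \<eta>'" if "(\<psi>, \<eta>) \<in> T" "(\<psi>, \<eta>') \<in> diag (\<lambda>k. F (\<mu> k))" for \<psi> \<eta> \<eta>'
      using T D that unfolding is_spectral_integral_def by fastforce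
    show "\<psi> = 0" if "\<And>\<phi>. \<phi> \<in> Domain T \<Longrightarrow> cinner \<phi> \<psi> = 0" for \<psi>
    proof (rule total)
      fix k
      have "e k \<in> Domain (diag (\<lambda>k. F (\<mu> k)))" using diag_basis by blast
      then show "cinner (e k) \<psi> = 0" using T D by (intro that) (simp only: is_spectral_integral_def)
    qed
  qed
qed

lemma norm_app_diag:
  assumes "(\<lambda>k. (\<mu> k * cmod (cinner (e k) \<psi>))\<^sup>2) sums r"
  shows "norm (app (diag \<mu>) \<psi>) = sqrt r"
proof -
  have "\<psi> \<in> Domain (diag \<mu>)" using assms by (auto simp: diag_Domain_iff sums_iff)
  then obtain \<eta> where \<eta>: "(\<psi>, \<eta>) \<in> diag \<mu>" by blast
  then have "app (diag \<mu>) \<psi> = \<eta>"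
    unfolding app_def using clinear_graphD(1)[OF clinear_graph_diag] by blast
  moreover have "(\<lambda>k. (\<mu> k * cmod (cinner (e k) \<psi>))\<^sup>2) sums (norm \<eta>)\<^sup>2"
    using parseval_norm[of \<eta>] \<eta> by (simp add: diag_def norm_mult power_mult_distrib)
  then have "(norm \<eta>)\<^sup>2 = r" using assms sums_unique2 by blast
  ultimately show ?thesis by auto
qed

end

subsection \<open>The number operator and the limit\<close>

interpretation num: schwartz_basis std num_p "\<lambda>k. real (k div 2)"
  using std_schwartz_basis[OF p_linear(1) p_sym(1), of real real]
  by (simp add: num_p_def cr_an_hermite del: hermite.simps)

lemma number_forms:
  "schwartz_basis std num2_p (\<lambda>k. real (k div 2) + 2)"
  "schwartz_basis std num23_p (\<lambda>k. (real (k div 2) + 2) * (real (k div 2) + 3))"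
proof -
  have p: "plinear (\<lambda>p. p)" "psym (\<lambda>p. p)" by (auto simp: plinear_def psym_def)
  have "pip (num_p (num_p p)) q = pip p (num_p (num_p q))" for p q by (simp only: psymD[OF p_sym(1)])
  then have nn: "plinear (\<lambda>p. num_p (num_p p))" "psym (\<lambda>p. num_p (num_p p))"
    by (simp_all add: plinear_def psym_def plinearD[OF p_linear(1)] del: split_paired_All)
  have "schwartz_basis std num2_p (\<lambda>k. if even k then real (k div 2) + 2 else real (k div 2) + 2)"
  proof (rule std_schwartz_basis)
    show "plinear num2_p" "psym num2_p"
      unfolding num2_p_def[abs_def] by (intro plinear_add plinear_scl psym_add psym_scl p_linear p_sym p)+
  qed (simp_all add: num2_p_def num_p_def cr_an_hermite scl_add_left del: hermite.simps)
  then show "schwartz_basis std num2_p (\<lambda>k. real (k div 2) + 2)" by simp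
  have "schwartz_basis std num23_p (\<lambda>k. if even k then (real (k div 2) + 2) * (real (k div 2) + 3)
      else (real (k div 2) + 2) * (real (k div 2) + 3))"
  proof (rule std_schwartz_basis)
    show "plinear num23_p" "psym num23_p"
      unfolding num23_p_def[abs_def] by (intro plinear_add plinear_scl psym_add psym_scl p_linear p_sym p nn)+
    have scl6: "(m * m) *\<^sub>S f + ((5 * m) *\<^sub>S f + 6 *\<^sub>S f) = ((m + 2) * (m + 3)) *\<^sub>S f" for m f
      unfolding scl_add_left[symmetric] by (simp add: algebra_simps)
    show "num23_p (hermite n, 0) = complex_of_real ((real n + 2) * (real n + 3)) *\<^sub>P (hermite n, 0)"
      "num23_p (0, hermite n) = complex_of_real ((real n + 2) * (real n + 3)) *\<^sub>P (0, hermite n)" for n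
      using scl6[of "of_nat n" "hermite n"]
      by (simp_all add: num23_p_def num_p_def cr_an_hermite add.assoc del: hermite.simps)
  qed
  then show "schwartz_basis std num23_p (\<lambda>k. (real (k div 2) + 2) * (real (k div 2) + 3))" by simp
qed

text \<open>Squaring undoes the root in each coefficient, so the norm prescribed by functional
  calculus becomes the algebraic form bounded above.\<close>

lemma norm_sqrt_N2: "norm (app sqrt_N2 (sket p)) = sqrt (Re (pip p (num2_p p)))"
proof -
  interpret Q: schwartz_basis std num2_p "\<lambda>k. real (k div 2) + 2" by (rule number_forms)
  have "sqrt_N2 = std.diag (\<lambda>k. sqrt (real (k div 2) + 2))"
    unfolding sqrt_N2_def num_op_eq num.graph_eq_diag by (subst std.fun_calc_diag) auto
  moreover have "(sqrt (real m + 2) * x)\<^sup>2 = (real m + 2) * x\<^sup>2" for m x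
    by (simp add: power_mult_distrib)
  ultimately show ?thesis using std.norm_app_diag[of "\<lambda>k. sqrt (real (k div 2) + 2)"] Q.form_sums[of p] by simp
qed

lemma norm_sqrt_N2_N3: "norm (app sqrt_N2_N3 (sket p)) = sqrt (Re (pip p (num23_p p)))"
proof -
  interpret Q: schwartz_basis std num23_p "\<lambda>k. (real (k div 2) + 2) * (real (k div 2) + 3)" by (rule number_forms)
  have "sqrt_N2_N3 = std.diag (\<lambda>k. sqrt ((real (k div 2) + 2) * (real (k div 2) + 3)))"
    unfolding sqrt_N2_N3_def num_op_eq num.graph_eq_diag by (subst std.fun_calc_diag) auto
  moreover have "(sqrt ((real m + 2) * (real m + 3)) * x)\<^sup>2 = (real m + 2) * (real m + 3) * x\<^sup>2" for m x
    by (simp add: power_mult_distrib)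
  ultimately show ?thesis
    using std.norm_app_diag[of "\<lambda>k. sqrt ((real (k div 2) + 2) * (real (k div 2) + 3))"] Q.form_sums[of p] by simp
qed

section \<open>Strong convergence as the oscillator frequency grows\<close>

lemma schwartz_dense:
  assumes "r > 0"
  obtains p where "norm (\<psi> - sket p) < r"
proof -
  have "\<forall>\<^sub>F n in sequentially. dist (std.trunc n \<psi>) \<psi> < r" using tendstoD[OF std.trunc_tendsto assms] .
  then obtain n where "dist (std.trunc n \<psi>) \<psi> < r" by (auto simp: eventually_sequentially)
  moreover have "std.trunc n \<psi> = sket (\<Sum>k<n. cinner (sket (std k)) \<psi> *\<^sub>P std k)"
    by (simp add: std.trunc_def sket_sum sket_scl)
  ultimately show ?thesis by (intro that) (simp add: dist_norm norm_minus_commute)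
qed

text \<open>The spin frequency may depend on \<nu>; only divergence of the sum \<nu> +
  \<open>w \<nu>\<close> enters. This treats fixed \<Omega> and fixed detuning at once.\<close>

lemma rwa_limit:
  assumes l: "l > 0" and w: "filterlim (\<lambda>\<nu>. \<nu> + w \<nu>) at_top at_top" and K: "compact K"
  shows "uniform_limit K
    (\<lambda>\<nu> t. norm (propagator (H_RWA l (w \<nu>) \<nu>) t \<psi> - propagator (H l (w \<nu>) \<nu>) t \<psi>)) (\<lambda>t. 0) at_top"
proof (rule uniform_limitI)
  fix e :: real assume "e > 0"
  \<comment> \<open>The approximation error is paid once for each propagator, leaving e / 2 for the
    Schwartz spinor.\<close>
  then obtain p where p: "norm (\<psi> - sket p) < e / 4" using schwartz_dense[of "e / 4" \<psi>] by auto
  obtain T where T: "\<And>t. t \<in> K \<Longrightarrow> \<bar>t\<bar> \<le> T"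
    using compact_imp_bounded[OF K] unfolding bounded_iff by auto
  define a b where "a = sqrt (Re (pip p (num2_p p)))" and "b = sqrt (Re (pip p (num23_p p)))"
  have ab: "0 \<le> b"
  proof -
    have "0 \<le> Re (pip p (exc12_p p))"
      using second_order_bounds(1)[of p] zero_le_power2[of "norm (sket (rot_p (alt_p p)))"] by linarith
    then show ?thesis using excitation_le_number(2)[of p] by (simp add: b_def)
  qed
  have "((\<lambda>\<nu>. (2 * l * a + T * (3 * l * l * b)) / (\<nu> + w \<nu>)) \<longlongrightarrow> 0) at_top"
    by (intro tendsto_divide_0[OF tendsto_const] filterlim_at_top_imp_at_infinity w)
  then have "\<forall>\<^sub>F \<nu> in at_top. \<bar>(2 * l * a + T * (3 * l * l * b)) / (\<nu> + w \<nu>)\<bar> < e / 2"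
    using \<open>e > 0\<close> by (auto dest: tendstoD[of _ _ _ "e / 2"] simp: dist_real_def)
  moreover have "\<forall>\<^sub>F \<nu> in at_top. 0 < \<nu> + w \<nu>" using filterlim_at_top_dense[THEN iffD1, OF w] by blast
  moreover have "\<forall>\<^sub>F \<nu> in at_top. (0 :: real) < \<nu>" by (rule eventually_gt_at_top)
  ultimately show "\<forall>\<^sub>F \<nu> in at_top. \<forall>t\<in>K.
      dist (norm (propagator (H_RWA l (w \<nu>) \<nu>) t \<psi> - propagator (H l (w \<nu>) \<nu>) t \<psi>)) 0 < e"
  proof eventually_elim
    case (elim \<nu>)
    show ?case
    proof
      fix t assume "t \<in> K"
      define V W where "V = propagator (H_RWA l (w \<nu>) \<nu>) t" and "W = propagator (H l (w \<nu>) \<nu>) t"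
      have V: "unitary V" and W: "unitary W"
        unfolding V_def W_def using l elim by (auto intro!: rwa_propagator_unitary generatesD(1)[OF rabi_generates])
      \<comment> \<open>This choice cancels the first-order term in the velocity, so the whole bound
        is of order 1 / (\<nu> + \<open>w \<nu>\<close>).\<close>
      define \<kappa> where "\<kappa> = l / (\<nu> + w \<nu>)"
      have \<kappa>: "0 \<le> \<kappa>" "l - \<kappa> * (\<nu> + w \<nu>) = 0" using l elim by (simp_all add: \<kappa>_def)
      have "norm (V (sket p) - W (sket p)) \<le> 2 * \<kappa> * a + \<bar>t\<bar> * (3 * \<kappa> * l * b)"
        using rwa_estimate[of \<nu> \<kappa> l "w \<nu>" t p] elim l \<kappa> unfolding V_def W_def a_def b_def by simp
      also have "\<dots> \<le> 2 * \<kappa> * a + T * (3 * \<kappa> * l * b)"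
        using T[OF \<open>t \<in> K\<close>] \<kappa> l ab by (intro add_left_mono mult_right_mono) auto
      also have "\<dots> = (2 * l * a + T * (3 * l * l * b)) / (\<nu> + w \<nu>)"
        by (simp add: \<kappa>_def add_divide_distrib)
      also have "\<dots> < e / 2" using elim(1) by linarith
      finally have core: "norm (V (sket p) - W (sket p)) < e / 2" .
      have "V \<psi> - W \<psi> = V (\<psi> - sket p) - W (\<psi> - sket p) + (V (sket p) - W (sket p))"
        by (simp add: clinearD[OF unitaryD(1)[OF V]] clinearD[OF unitaryD(1)[OF W]])
      then have "norm (V \<psi> - W \<psi>) \<le> norm (V (\<psi> - sket p)) + norm (W (\<psi> - sket p)) + norm (V (sket p) - W (sket p))"
        by (metis (no_types, lifting) add_right_mono norm_triangle_ineq norm_triangle_ineq4 order_trans)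
      also have "\<dots> < e" using p core by (simp add: unitaryD(2)[OF V] unitaryD(2)[OF W])
      finally show "dist (norm (propagator (H_RWA l (w \<nu>) \<nu>) t \<psi> - propagator (H l (w \<nu>) \<nu>) t \<psi>)) 0 < e"
        by (simp add: V_def W_def)
    qed
  qed
qed

text \<open>The informal limit leaves open what stays fixed as \<omega> grows; the second conjunct
  keeps \<Omega> fixed, the third the detuning.\<close>

theorem theorem2p1:
  fixes l \<Omega> \<omega> \<Delta> :: real
  assumes "l > 0" and "\<Omega> > 0" and "\<omega> > 0" and "\<Delta> = \<Omega> - \<omega>"
  shows "(\<forall>\<Psi>\<in>schwartz_spinor. \<forall>t.
      norm (U2 l \<Omega> \<omega> t (ket \<Psi>) - U1 l \<Omega> \<omega> t (ket \<Psi>)) \<le>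
        l / \<omega> * (norm (app sqrt_N2 (ket \<Psi>)) +
          \<bar>t\<bar> * (\<bar>\<Delta>\<bar> * norm (app sqrt_N2 (ket \<Psi>)) + 3 * l * norm (app sqrt_N2_N3 (ket \<Psi>))))) \<and>
    (\<forall>\<psi> K. compact K \<longrightarrow>
      uniform_limit K
        (\<lambda>\<nu> t. norm (propagator (H_RWA l \<Omega> \<nu>) t \<psi> - propagator (H l \<Omega> \<nu>) t \<psi>))
        (\<lambda>t. 0) at_top) \<and>
    (\<forall>\<psi> K. compact K \<longrightarrow>
      uniform_limit K
        (\<lambda>\<nu> t. norm (propagator (H_RWA l (\<nu> + \<Delta>) \<nu>) t \<psi> - propagator (H l (\<nu> + \<Delta>) \<nu>) t \<psi>))
        (\<lambda>t. 0) at_top)"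
proof (intro conjI ballI allI impI)
  fix \<Psi> t assume "\<Psi> \<in> schwartz_spinor"
  then obtain p where "\<Psi> = spinor_fun p" using range_spinor_fun by blast
  then have \<Psi>: "ket \<Psi> = sket p" by (simp add: sket_def)
  define V W U where "V = propagator (H_RWA l \<Omega> \<omega>) t (sket p)" and "W = propagator (H l \<Omega> \<omega>) t (sket p)"
    and "U = propagator (H0 \<omega>) (- t)"
  define a b where "a = sqrt (Re (pip p (num2_p p)))" and "b = sqrt (Re (pip p (num23_p p)))"
  have "0 \<le> a" "0 \<le> b"
    using norm_sqrt_N2[of p] norm_sqrt_N2_N3[of p] unfolding a_def b_def by (metis norm_ge_zero)+
  have U: "unitary U" unfolding U_def by (rule H0_propagator_unitary)
  have "U2 l \<Omega> \<omega> t (ket \<Psi>) - U1 l \<Omega> \<omega> t (ket \<Psi>) = U (V - W)"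
    by (simp add: U1_def U2_def \<Psi> V_def W_def clinearD[OF unitaryD(1)[OF U]] flip: U_def)
  then have "norm (U2 l \<Omega> \<omega> t (ket \<Psi>) - U1 l \<Omega> \<omega> t (ket \<Psi>)) = norm (V - W)"
    by (simp add: unitaryD(2)[OF U])
  \<comment> \<open>With \<kappa> = l / (2 \<omega>) the boundary term is exactly l / \<omega>, and
    the coefficient of \<open>ctr_p\<close> collapses to -\<kappa> \<Delta>.\<close>
  also have "\<dots> \<le> 2 * (l / (2 * \<omega>)) * a + \<bar>t\<bar> * (\<bar>l - l / (2 * \<omega>) * (\<omega> + \<Omega>)\<bar> * a + 3 * (l / (2 * \<omega>)) * l * b)"
    unfolding V_def W_def a_def b_def using assms by (intro rwa_estimate) auto
  also have "l - l / (2 * \<omega>) * (\<omega> + \<Omega>) = - (l / (2 * \<omega>)) * \<Delta>"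
  proof -
    have "\<Omega> = \<omega> + \<Delta>" using assms by simp
    then show ?thesis using assms(3) by (simp add: field_simps)
  qed
  also have "2 * (l / (2 * \<omega>)) * a + \<bar>t\<bar> * (\<bar>- (l / (2 * \<omega>)) * \<Delta>\<bar> * a + 3 * (l / (2 * \<omega>)) * l * b)
      = l / \<omega> * (a + \<bar>t\<bar> * ((\<bar>\<Delta>\<bar> * a + 3 * l * b) / 2))"
    using assms by (simp add: abs_mult field_simps)
  \<comment> \<open>The time-dependent part comes out with a spare factor 1/2, which is dropped
    here.\<close>
  also have "\<dots> \<le> l / \<omega> * (a + \<bar>t\<bar> * (\<bar>\<Delta>\<bar> * a + 3 * l * b))"
    using assms \<open>0 \<le> a\<close> \<open>0 \<le> b\<close> by (intro mult_left_mono add_left_mono) auto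
  finally show "norm (U2 l \<Omega> \<omega> t (ket \<Psi>) - U1 l \<Omega> \<omega> t (ket \<Psi>)) \<le>
      l / \<omega> * (norm (app sqrt_N2 (ket \<Psi>)) +
        \<bar>t\<bar> * (\<bar>\<Delta>\<bar> * norm (app sqrt_N2 (ket \<Psi>)) + 3 * l * norm (app sqrt_N2_N3 (ket \<Psi>))))"
    by (simp only: \<Psi> norm_sqrt_N2 norm_sqrt_N2_N3 a_def b_def)
next
  fix \<psi> and K :: "real set" assume K: "compact K"
  have "filterlim (\<lambda>\<nu>. \<nu> + \<Omega>) at_top at_top"
    by (rule filterlim_at_top_mono[OF filterlim_ident]) (use assms in auto)
  from rwa_limit[OF assms(1) this K]
  show "uniform_limit K
      (\<lambda>\<nu> t. norm (propagator (H_RWA l \<Omega> \<nu>) t \<psi> - propagator (H l \<Omega> \<nu>) t \<psi>)) (\<lambda>t. 0) at_top" .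
  \<comment> \<open>The detuning may be negative, but 2 \<nu> + \<Delta> >= \<nu> as soon as \<nu>
    >= -\<Delta>.\<close>
  have "filterlim (\<lambda>\<nu>. \<nu> + (\<nu> + \<Delta>)) at_top at_top"
    by (rule filterlim_at_top_mono[OF filterlim_ident])
      (rule eventually_mono[OF eventually_ge_at_top[of "- \<Delta>"]], simp)
  from rwa_limit[OF assms(1) this K]
  show "uniform_limit K
      (\<lambda>\<nu> t. norm (propagator (H_RWA l (\<nu> + \<Delta>) \<nu>) t \<psi> - propagator (H l (\<nu> + \<Delta>) \<nu>) t \<psi>)) (\<lambda>t. 0) at_top" .
qed

end
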